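(* Let $s\in(0,1)$, $n>2s$, let $\Omega\subset\mathbb{R}^n$ be an open bounded set with Lipschitz boundary, and let $K:\mathbb{R}^n\setminus\{0\}\to(0,+\infty)$ satisfy: (k1) $\gamma K\in L^1(\mathbb{R}^n)$, where $\gamma(x):=\min\{|x|^2,1\}$; (k2) there exists $\beta>0$ such that $K(x)\ge\beta|x|^{-(n+2s)}$ for every $x\in\mathbb{R}^n\setminus\{0\}$; (k3) $K(x)=K(-x)$ for every $x\in\mathbb{R}^n\setminus\{0\}$. Let $f\in\mathcal{A}$ with $F(\xi):=\int_0^\xi f(t)\,dt$, and let $h\in L^\infty(\Omega)\setminus\{0\}$ with $h\ge0$ a.e. in $\Omega$. Let $0\le a<b\le+\infty$ and $q\in[1,2^* )$, where $2^*:=2n/(n-2s)$. Assume that there exists $\psi\in\mathfrak{F}_q$ such that, for each $\lambda\in(a,b)$, the function $g_\lambda^{F,\psi}=\lambda\psi-F$ is coercive and has a unique global minimum in $\mathbb{R}$. Further, suppose that there exists a number $r>0$ satisfying $$r\in(\alpha(F,\psi,b),\beta(F,\psi,a))$$ and $$\sup_{\xi\in\psi^{-1}(r)}F(\xi)<\frac{r^{2/q}}{2\left(c_q\,\gamma_\psi\,\operatorname{ess\,sup}_{x\in\Omega}h(x)\right)^{2/q}\|h\|_{L^1(\Omega)}^{(q-2)/q}}.$$ Then the problem $$-\mathcal{L}_K u=h(x)f(u)\ \text{ in }\Omega,\qquad u=0\ \text{ in }\mathbb{R}^n\setminus\Omega,$$ admits at least one weak solution $u\in X_0$ which is a local minimum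 of the energy functional $J_K$ on $X_0$ and satisfies $$\int_Q|u(x)-u(y)|^2K(x-y)\,dx\,dy<\left(\frac{r\,\|h\|_{L^1(\Omega)}}{c_q\,\gamma_\psi\,\operatorname{ess\,sup}_{x\in\Omega}h(x)}\right)^{2/q}.$$
   Context: Function space. Let $\mathcal{C}\Omega:=\mathbb{R}^n\setminus\Omega$ and $Q:=(\mathbb{R}^n\times\mathbb{R}^n)\setminus(\mathcal{C}\Omega\times\mathcal{C}\Omega)$. $X$ is the linear space of Lebesgue measurable functions $g:\mathbb{R}^n\to\mathbb{R}$ such that $g|_\Omega\in L^2(\Omega)$ and $(x,y)\mapsto(g(x)-g(y))\sqrt{K(x-y)}$ belongs to $L^2(Q,dx\,dy)$; $X_0:=\{g\in X: g=0\text{ a.e. in }\mathbb{R}^n\setminus\Omega\}$, which is a Hilbert space with norm $\|v\|_{X_0}:=\big(\int_Q|v(x)-v(y)|^2K(x-y)\,dx\,dy\big)^{1/2}$. The space $X_0$ embeds continuously in $L^\nu(\mathbb{R}^n)$ for $\nu\in[1,2^*]$, and $$c_q:=\sup_{u\in X_0\setminus\{0\}}\frac{\|u\|_{L^q(\Omega)}^q}{\|u\|_{X_0}^q}<+\infty .$$ Class $\mathcal{A}$. $\mathcal{A}$ is the class of all continuous $f:\mathbb{R}\to\mathbb{R}$ such that $\sup_{t\in\mathbb{R}}\frac{|f(t)|}{1+|t|^{\gamma-1}}<+\infty$ for some exponent $\gamma\in[1,2^* )$. Weak solution and energy. A weak solution of $-\mathcal{L}_Ku=h(x)f(u)$ in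 $\Omega$, $u=0$ in $\mathbb{R}^n\setminus\Omega$, is a function $u\in X_0$ such that $$\int_Q(u(x)-u(y))(\varphi(x)-\varphi(y))K(x-y)\,dx\,dy=\int_\Omega h(x)f(u(x))\varphi(x)\,dx\quad\text{for every }\varphi\in X_0.$$ The energy functional is $J_K:X_0\to\mathbb{R}$, $J_K(u):=\frac12\|u\|_{X_0}^2-\int_\Omega h(x)F(u(x))\,dx$. Notation for functions $\phi,\psi:\mathbb{R}\to\mathbb{R}$. For $\lambda\in[a,b]$, $\lambda<+\infty$, set $g_\lambda^{\phi,\psi}:=\lambda\psi-\phi$. Let $M(\phi,\psi,\lambda)$ be the set of all global minima (minimum points) of $g_\lambda^{\phi,\psi}$ if $\lambda<+\infty$, and $M(\phi,\psi,+\infty):=\emptyset$. Set $$\alpha(\phi,\psi,b):=\max\Big\{\inf_{t\in\mathbb{R}}\psi(t),\ \sup_{t\in M(\phi,\psi,b)}\psi(t)\Big\},\qquad \beta(\phi,\psi,a):=\min\Big\{\sup_{t\in\mathbb{R}}\psi(t),\ \inf_{t\in M(\phi,\psi,a)}\psi(t)\Big\},$$ with the conventions $\sup\emptyset=-\infty$, $\inf\emptyset=+\infty$. A function $g:\mathbb{R}\to\mathbb{R}$ is coercive if $g(t)\to+\infty$ as $|t|\to+\infty$; "unique global minimum" means that the set of global minimum points is a singleton. Class $\mathfrak{F}_q$. For $q\in[1,2^* )$, $\mathfrak{F}_q$ is the family of all lower semicontinuous functions $\psi:\mathbb{R}\to\mathbb{R}$ such that: $\sup_{t\in\mathbb{R}}\psi(t)>0$;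 $\inf_{t\in\mathbb{R}}\frac{\psi(t)}{1+|t|^q}>-\infty$; and $\gamma_\psi:=\sup_{t\in\mathbb{R}\setminus\{0\}}\frac{\psi(t)}{|t|^q}<+\infty$. *)

theory Defs
  imports "HOL-Analysis.Analysis" "HOL-Probability.Essential_Supremum"
begin

section \<open>Domains with Lipschitz boundary\<close>

text \<open>
  Near every boundary point, after choosing a direction \<open>e\<close> (the ``vertical'' axis of a rotated
  coordinate system), the set is the strict epigraph of a Lipschitz function \<open>g\<close> of the remaining
  coordinates. The hyperplane of the remaining coordinates is the orthogonal complement of \<open>e\<close>,
  which also covers dimension one, where it is the origin alone.
\<close>

definition lipschitz_boundary :: "'a::euclidean_space set \<Rightarrow> bool" where
  "lipschitz_boundary \<Omega> \<longleftrightarrow>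
    (\<forall>p \<in> frontier \<Omega>. \<exists>e \<rho> L (g :: 'a \<Rightarrow> real).
       norm e = 1 \<and> 0 < \<rho> \<and> L-lipschitz_on {y. y \<bullet> e = 0} g \<and>
       (\<forall>x \<in> ball p \<rho>. x \<in> \<Omega> \<longleftrightarrow> g (x - (x \<bullet> e) *\<^sub>R e) < x \<bullet> e))"


section \<open>The function space\<close>

text \<open>
  Functions defined up to null sets are handled through representatives, and Lebesgue integrals
  over \<open>S\<close> are integrals with respect to \<open>lebesgue_on S\<close>. The kernel \<open>K\<close> is a total function; its
  value at \<open>0\<close> never matters, since it is only used on the diagonal, where it is multiplied by
  \<open>u x - u x = 0\<close>.
\<close>

definition L2_on :: "'a::euclidean_space set \<Rightarrow> ('a \<Rightarrow> real) set" where
  "L2_on S = {g \<in> borel_measurable (lebesgue_on S). integrable (lebesgue_on S) (\<lambda>x. (g x)\<^sup>2)}"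

definition Q_set :: "'a set \<Rightarrow> ('a \<times> 'a) set" where
  "Q_set \<Omega> = (UNIV \<times> UNIV) - ((- \<Omega>) \<times> (- \<Omega>))"

definition X_space :: "('a::euclidean_space \<Rightarrow> real) \<Rightarrow> 'a set \<Rightarrow> ('a \<Rightarrow> real) set" where
  "X_space K \<Omega> = {g \<in> borel_measurable lebesgue.
     g \<in> L2_on \<Omega> \<and> (\<lambda>(x, y). (g x - g y) * sqrt (K (x - y))) \<in> L2_on (Q_set \<Omega>)}"

definition X0_space :: "('a::euclidean_space \<Rightarrow> real) \<Rightarrow> 'a set \<Rightarrow> ('a \<Rightarrow> real) set" where
  "X0_space K \<Omega> = {g \<in> X_space K \<Omega>. AE x in lebesgue. x \<notin> \<Omega> \<longrightarrow> g x = 0}"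

definition X0_inner ::
  "('a::euclidean_space \<Rightarrow> real) \<Rightarrow> 'a set \<Rightarrow> ('a \<Rightarrow> real) \<Rightarrow> ('a \<Rightarrow> real) \<Rightarrow> real" where
  "X0_inner K \<Omega> u v =
     (\<integral>(x, y). (u x - u y) * (v x - v y) * K (x - y) \<partial>lebesgue_on (Q_set \<Omega>))"

definition X0_norm :: "('a::euclidean_space \<Rightarrow> real) \<Rightarrow> 'a set \<Rightarrow> ('a \<Rightarrow> real) \<Rightarrow> real" where
  "X0_norm K \<Omega> v = sqrt (\<integral>(x, y). \<bar>v x - v y\<bar>\<^sup>2 * K (x - y) \<partial>lebesgue_on (Q_set \<Omega>))"

definition crit_exp :: "nat \<Rightarrow> real \<Rightarrow> real" where
  "crit_exp n s = 2 * real n / (real n - 2 * s)"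

text \<open>
  The embedding constant. The supremum is taken in the extended nonnegative reals, so that neither
  a non-integrable power nor an unbounded set of quotients could produce a spurious value inside
  it; it is finite for the exponents \<open>1 \<le> q \<le> 2*\<close>.
\<close>

definition emb_const :: "('a::euclidean_space \<Rightarrow> real) \<Rightarrow> 'a set \<Rightarrow> real \<Rightarrow> real" where
  "emb_const K \<Omega> q = enn2real
     (SUP u \<in> {u \<in> X0_space K \<Omega>. \<not> (AE x in lebesgue. u x = 0)}.
        (\<integral>\<^sup>+ x. ennreal (\<bar>u x\<bar> powr q) \<partial>lebesgue_on \<Omega>) / ennreal (X0_norm K \<Omega> u powr q))"


section \<open>The weight\<close>

definition ess_sup_on :: "'a::euclidean_space set \<Rightarrow> ('a \<Rightarrow> real) \<Rightarrow> ereal" where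
  "ess_sup_on \<Omega> h = esssup (lebesgue_on \<Omega>) (\<lambda>x. ereal (h x))"

definition Linf_on :: "'a::euclidean_space set \<Rightarrow> ('a \<Rightarrow> real) set" where
  "Linf_on \<Omega> = {h \<in> borel_measurable (lebesgue_on \<Omega>). ess_sup_on \<Omega> (\<lambda>x. \<bar>h x\<bar>) < \<infinity>}"

definition L1_norm_on :: "'a::euclidean_space set \<Rightarrow> ('a \<Rightarrow> real) \<Rightarrow> real" where
  "L1_norm_on \<Omega> h = (\<integral>x. \<bar>h x\<bar> \<partial>lebesgue_on \<Omega>)"


section \<open>The nonlinearity, weak solutions and the energy\<close>

text \<open>
  In the growth conditions below, \<open>0 powr 0 = 0\<close> differs from the convention \<open>0\<^sup>0 = 1\<close> at the single
  point \<open>t = 0\<close> for \<open>\<gamma> = 1\<close>, which does not affect boundedness.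
\<close>

definition class_A :: "real \<Rightarrow> (real \<Rightarrow> real) set" where
  "class_A p = {f. continuous_on UNIV f \<and>
     (\<exists>\<gamma>. 1 \<le> \<gamma> \<and> \<gamma> < p \<and> bdd_above (range (\<lambda>t. \<bar>f t\<bar> / (1 + \<bar>t\<bar> powr (\<gamma> - 1)))))}"

definition primitive :: "(real \<Rightarrow> real) \<Rightarrow> real \<Rightarrow> real" where
  "primitive f \<xi> = (LBINT t=0..\<xi>. f t)"

definition weak_solution ::
  "('a::euclidean_space \<Rightarrow> real) \<Rightarrow> 'a set \<Rightarrow> ('a \<Rightarrow> real) \<Rightarrow> (real \<Rightarrow> real) \<Rightarrow> ('a \<Rightarrow> real) \<Rightarrow> bool" where
  "weak_solution K \<Omega> h f u \<longleftrightarrow> u \<in> X0_space K \<Omega> \<and>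
     (\<forall>\<phi> \<in> X0_space K \<Omega>.
        X0_inner K \<Omega> u \<phi> = (\<integral>x. h x * f (u x) * \<phi> x \<partial>lebesgue_on \<Omega>))"

definition energy ::
  "('a::euclidean_space \<Rightarrow> real) \<Rightarrow> 'a set \<Rightarrow> ('a \<Rightarrow> real) \<Rightarrow> (real \<Rightarrow> real) \<Rightarrow> ('a \<Rightarrow> real) \<Rightarrow> real" where
  "energy K \<Omega> h f u =
     1 / 2 * (X0_norm K \<Omega> u)\<^sup>2 - (\<integral>x. h x * primitive f (u x) \<partial>lebesgue_on \<Omega>)"

definition X0_local_min ::
  "('a::euclidean_space \<Rightarrow> real) \<Rightarrow> 'a set \<Rightarrow> (('a \<Rightarrow> real) \<Rightarrow> real) \<Rightarrow> ('a \<Rightarrow> real) \<Rightarrow> bool" where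
  "X0_local_min K \<Omega> J u \<longleftrightarrow> u \<in> X0_space K \<Omega> \<and>
     (\<exists>\<epsilon>>0. \<forall>v \<in> X0_space K \<Omega>. X0_norm K \<Omega> (\<lambda>x. v x - u x) < \<epsilon> \<longrightarrow> J u \<le> J v)"


section \<open>The auxiliary function\<close>

definition g_fun :: "(real \<Rightarrow> real) \<Rightarrow> (real \<Rightarrow> real) \<Rightarrow> real \<Rightarrow> real \<Rightarrow> real" where
  "g_fun \<phi> \<psi> l t = l * \<psi> t - \<phi> t"

definition min_points :: "(real \<Rightarrow> real) \<Rightarrow> real set" where
  "min_points g = {t. \<forall>t'. g t \<le> g t'}"

definition M_set :: "(real \<Rightarrow> real) \<Rightarrow> (real \<Rightarrow> real) \<Rightarrow> ereal \<Rightarrow> real set" where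
  "M_set \<phi> \<psi> l = (if l < \<infinity> then min_points (g_fun \<phi> \<psi> (real_of_ereal l)) else {})"

definition alpha :: "(real \<Rightarrow> real) \<Rightarrow> (real \<Rightarrow> real) \<Rightarrow> ereal \<Rightarrow> ereal" where
  "alpha \<phi> \<psi> b = max (INF t. ereal (\<psi> t)) (SUP t \<in> M_set \<phi> \<psi> b. ereal (\<psi> t))"

definition beta :: "(real \<Rightarrow> real) \<Rightarrow> (real \<Rightarrow> real) \<Rightarrow> ereal \<Rightarrow> ereal" where
  "beta \<phi> \<psi> a = min (SUP t. ereal (\<psi> t)) (INF t \<in> M_set \<phi> \<psi> a. ereal (\<psi> t))"

definition coercive :: "(real \<Rightarrow> real) \<Rightarrow> bool" where
  "coercive g \<longleftrightarrow> filterlim g at_top at_infinity"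

definition lower_semicont :: "(real \<Rightarrow> real) \<Rightarrow> bool" where
  "lower_semicont \<psi> \<longleftrightarrow> (\<forall>t c. c < \<psi> t \<longrightarrow> (\<forall>\<^sub>F t' in nhds t. c < \<psi> t'))"

definition F_class :: "real \<Rightarrow> (real \<Rightarrow> real) set" where
  "F_class q = {\<psi>. lower_semicont \<psi> \<and>
     0 < (SUP t. ereal (\<psi> t)) \<and>
     bdd_below (range (\<lambda>t. \<psi> t / (1 + \<bar>t\<bar> powr q))) \<and>
     bdd_above ((\<lambda>t. \<psi> t / \<bar>t\<bar> powr q) ` (UNIV - {0}))}"

definition growth_const :: "real \<Rightarrow> (real \<Rightarrow> real) \<Rightarrow> real" where
  "growth_const q \<psi> = (SUP t \<in> UNIV - {0}. \<psi> t / \<bar>t\<bar> powr q)"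

end

theory Submission
  imports Defs "HOL-Complex_Analysis.Great_Picard"
begin

text \<open>
  Let \<open>N u = \<integral> h * F (u)\<close>, so that the energy is \<open>J u = \<parallel>u\<parallel>\<^sup>2 / 2 - N u\<close>, and let \<open>c\<close> be the bound on
  \<open>\<parallel>u\<parallel>\<^sup>2\<close> in the conclusion. The theorem holds because \<open>N v < c / 2\<close> for all \<open>v\<close> in the ball
  \<open>\<parallel>v\<parallel>\<^sup>2 \<le> c\<close>: then \<open>J\<close> is positive on the sphere and zero at the origin, and a minimizer of \<open>J\<close> over
  the ball lies in the interior, where it is a local minimum and hence a weak solution.

  The bound on \<open>N\<close> comes from a one-dimensional fact. As the multiplier \<open>l\<close> runs through \<open>(a, b)\<close>, the
  value of \<open>\<psi>\<close> at the unique minimizer of \<open>l * \<psi> - F\<close> varies continuously and passes through \<open>r\<close>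
  (\<open>ex_multiplier\<close>). So there are \<open>l > 0\<close> and \<open>\<xi>\<close> with \<open>\<psi> \<xi> = r\<close> and
  \<open>F t \<le> F \<xi> + l * (\<psi> t - r) \<le> F \<xi> + l * (\<gamma> * \<bar>t\<bar>\<^sup>q - r)\<close> for all \<open>t\<close>, where \<open>\<gamma>\<close> is the growth constant of
  \<open>\<psi>\<close>. Inserting \<open>t = v x\<close> and integrating against \<open>h\<close>, the embedding inequality makes the terms with
  \<open>l\<close> at most \<open>0\<close> on the ball, so that \<open>N v \<le> F \<xi> * \<integral> h\<close>, and the hypothesis on \<open>F\<close> over
  the level set of \<open>\<psi>\<close> at height \<open>r\<close> says that this is less than \<open>c / 2\<close>.

  The existence of the minimizer (\<open>ball_minimizer\<close>) rests on two facts about the energy space. Its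
  elements are bounded in \<open>L\<^sup>p\<close> for each \<open>p\<close> below the critical exponent (\<open>fractional_sobolev\<close>); this
  follows from a recursive estimate for the measures of the level sets of \<open>\<bar>u\<bar>\<close>. And bounded sequences
  have almost everywhere convergent subsequences (\<open>fractional_rellich\<close>), since a function of bounded
  energy is close in \<open>L\<^sup>1\<close> to its means over the cells of a fine grid. Almost everywhere convergence and
  Fatou's lemma then take the place of weak convergence. Both facts concern the Gagliardo seminorm of
  order \<open>s\<close>, which the lower bound on the kernel makes subordinate to the energy.
\<close>

section \<open>Minimizers of a one-parameter family of functions on the line\<close>

lemma LIMSEQ_if_subsubseq:
  fixes x :: "nat \<Rightarrow> 'a::topological_space"
  assumes "\<And>j. strict_mono (j :: nat \<Rightarrow> nat) \<Longrightarrow> \<exists>k :: nat \<Rightarrow> nat. strict_mono k \<and> (x \<circ> (j \<circ> k)) \<longlonglongrightarrow> l"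
  shows "x \<longlonglongrightarrow> l"
proof (rule ccontr)
  assume "\<not> ?thesis"
  then obtain S where S: "open S" "l \<in> S" "\<not> eventually (\<lambda>n. x n \<in> S) sequentially"
    by (auto simp: tendsto_def)
  then obtain j :: "nat \<Rightarrow> nat" where j: "strict_mono j" "\<And>n. x (j n) \<notin> S"
    using not_eventually_sequentiallyD by blast
  from assms[OF j(1)] obtain k :: "nat \<Rightarrow> nat" where "(x \<circ> (j \<circ> k)) \<longlonglongrightarrow> l" by blast
  then have "eventually (\<lambda>n. (x \<circ> (j \<circ> k)) n \<in> S) sequentially"
    using S by (simp add: tendsto_def)
  then have "eventually (\<lambda>n::nat. False) sequentially"
    by eventually_elim (use j in simp)
  then show False by simp
qed

text \<open>
  Stability of minimizers under perturbation of the multiplier. A bound on \<open>\<psi>\<close> along the minimizers is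
  all that is needed for compactness: it makes \<open>g_fun F \<psi> c\<close>, for one fixed multiplier \<open>c\<close> at which this
  function is coercive, bounded along them. The values \<open>\<psi> (t (k n))\<close> need not converge to \<open>\<psi> t'\<close> when
  \<open>l = 0\<close>, since \<open>\<psi>\<close> is only lower semicontinuous; for \<open>l > 0\<close> the convergence of the minimum values
  and the continuity of \<open>F\<close> force it.
\<close>

lemma min_points_limit:
  fixes F \<psi> :: "real \<Rightarrow> real"
  assumes F: "continuous_on UNIV F" and lsc: "lower_semicont \<psi>"
    and coer: "coercive (g_fun F \<psi> c)"
    and lim: "\<mu> \<longlonglongrightarrow> l" and "0 \<le> l"
    and t_min: "\<And>n. t n \<in> min_points (g_fun F \<psi> (\<mu> n))"
    and bnd: "\<And>n. \<bar>\<psi> (t n)\<bar> \<le> M"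
  obtains k t' where "strict_mono (k :: nat \<Rightarrow> nat)" "t' \<in> min_points (g_fun F \<psi> l)"
    "\<And>z. z < \<psi> t' \<Longrightarrow> \<forall>\<^sub>F n in sequentially. z < \<psi> (t (k n))"
    "0 < l \<Longrightarrow> (\<lambda>n. \<psi> (t (k n))) \<longlonglongrightarrow> \<psi> t'"
proof -
  have le: "\<mu> n * \<psi> (t n) - F (t n) \<le> \<mu> n * \<psi> x - F x" for n x
    using t_min[of n] by (auto simp: min_points_def g_fun_def)
  have "Bseq \<mu>" using lim by (simp add: convergentI convergent_imp_Bseq)
  then obtain L where L: "\<And>n. \<bar>\<mu> n\<bar> \<le> L" by (auto simp: Bseq_def)
  \<comment> \<open>compare with the competitor \<open>0\<close>, then change the multiplier from \<open>\<mu> n\<close> to \<open>c\<close>\<close>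
  have gc: "g_fun F \<psi> c (t n) \<le> L * \<bar>\<psi> 0\<bar> - F 0 + (\<bar>c\<bar> + L) * M" for n
  proof -
    have "g_fun F \<psi> c (t n) = (\<mu> n * \<psi> (t n) - F (t n)) + (c - \<mu> n) * \<psi> (t n)"
      by (simp add: g_fun_def algebra_simps)
    also have "\<dots> \<le> (\<mu> n * \<psi> 0 - F 0) + \<bar>(c - \<mu> n) * \<psi> (t n)\<bar>"
      using le[of n 0] by linarith
    also have "\<bar>(c - \<mu> n) * \<psi> (t n)\<bar> \<le> (\<bar>c\<bar> + L) * M"
      unfolding abs_mult using L[of n] bnd[of n] by (intro mult_mono) auto
    also have "\<mu> n * \<psi> 0 \<le> L * \<bar>\<psi> 0\<bar>"
      using mult_right_mono[OF L[of n], of "\<bar>\<psi> 0\<bar>"] abs_ge_self[of "\<mu> n * \<psi> 0"] by (simp add: abs_mult)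
    finally show ?thesis by simp
  qed
  have "\<forall>\<^sub>F x in at_infinity. L * \<bar>\<psi> 0\<bar> - F 0 + (\<bar>c\<bar> + L) * M < g_fun F \<psi> c x"
    using coer by (auto simp: coercive_def filterlim_at_top_dense)
  then obtain B where B: "\<And>x. B \<le> norm x \<Longrightarrow> L * \<bar>\<psi> 0\<bar> - F 0 + (\<bar>c\<bar> + L) * M < g_fun F \<psi> c x"
    by (auto simp: eventually_at_infinity)
  have "t n \<in> cball 0 B" for n
    using B[of "t n"] gc[of n] by (cases "B \<le> norm (t n)") auto
  then obtain k t' where k: "strict_mono (k :: nat \<Rightarrow> nat)" "(t \<circ> k) \<longlonglongrightarrow> t'"
    using compact_cball[of "0::real" B] unfolding compact_def by metis
  have Flim: "(\<lambda>n. F (t (k n))) \<longlonglongrightarrow> F t'"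
    using F k(2) by (intro isCont_tendsto_compose[of t' F]) (auto simp: continuous_on_eq_continuous_at o_def)
  have llim: "(\<lambda>n. \<mu> (k n)) \<longlonglongrightarrow> l" using LIMSEQ_subseq_LIMSEQ[OF lim k(1)] by (simp add: o_def)
  have ev: "\<forall>\<^sub>F n in sequentially. z < \<psi> (t (k n))" if "z < \<psi> t'" for z
  proof -
    have "\<forall>\<^sub>F y in nhds t'. z < \<psi> y" using lsc that by (simp add: lower_semicont_def)
    from eventually_compose_filterlim[OF this k(2)] show ?thesis by simp
  qed
  have zero: "(\<lambda>n. (\<mu> (k n) - l) * \<psi> (t (k n))) \<longlonglongrightarrow> 0"
  proof (rule Lim_null_comparison)
    show "\<forall>\<^sub>F n in sequentially. norm ((\<mu> (k n) - l) * \<psi> (t (k n))) \<le> \<bar>\<mu> (k n) - l\<bar> * M"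
      using bnd by (auto simp: abs_mult intro!: always_eventually mult_left_mono)
    show "(\<lambda>n. \<bar>\<mu> (k n) - l\<bar> * M) \<longlonglongrightarrow> 0"
      using tendsto_mult_left_zero[OF tendsto_rabs_zero[OF LIM_zero[OF llim]]] by simp
  qed
  \<comment> \<open>an upper bound for the limit superior of \<open>l * \<psi> (t (k n))\<close>, from minimality of \<open>t (k n)\<close>\<close>
  have ub: "\<forall>\<^sub>F n in sequentially. l * \<psi> (t (k n)) < l * \<psi> x - F x + F t' + e" if "e > 0" for x e
  proof -
    have "(\<lambda>n. \<mu> (k n) * \<psi> x - F x + F (t (k n)) - (\<mu> (k n) - l) * \<psi> (t (k n)))
        \<longlonglongrightarrow> l * \<psi> x - F x + F t' - 0"
      by (intro tendsto_intros llim Flim zero)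
    then have "\<forall>\<^sub>F n in sequentially. \<mu> (k n) * \<psi> x - F x + F (t (k n)) - (\<mu> (k n) - l) * \<psi> (t (k n))
        < l * \<psi> x - F x + F t' + e"
      using that by (auto dest: order_tendstoD(2)[of _ _ _ "l * \<psi> x - F x + F t' + e"])
    then show ?thesis
    proof eventually_elim
      case (elim n)
      then show ?case using le[of "k n" x] by (simp add: algebra_simps)
    qed
  qed
  have lb: "\<forall>\<^sub>F n in sequentially. l * \<psi> t' - e < l * \<psi> (t (k n))" if "e > 0" for e
  proof (cases "l = 0")
    case False
    with \<open>0 \<le> l\<close> have "l > 0" by simp
    then have "\<psi> t' - e / l < \<psi> t'" using that by simp
    from ev[OF this] show ?thesis
      by eventually_elim (use \<open>l > 0\<close> in \<open>simp add: field_simps\<close>)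
  qed (use that in simp)
  have min: "t' \<in> min_points (g_fun F \<psi> l)"
  proof -
    have "l * \<psi> t' - F t' \<le> l * \<psi> x - F x" for x
    proof (rule field_le_epsilon)
      fix e :: real assume "e > 0"
      then have "e / 2 > 0" by simp
      from lb[OF this] ub[OF this, of x]
      have "\<forall>\<^sub>F n in sequentially. l * \<psi> t' - e/2 < l * \<psi> x - F x + F t' + e/2"
        by (rule eventually_elim2) linarith
      then show "l * \<psi> t' - F t' \<le> l * \<psi> x - F x + e" by simp
    qed
    then show ?thesis by (auto simp: min_points_def g_fun_def)
  qed
  have "(\<lambda>n. \<psi> (t (k n))) \<longlonglongrightarrow> \<psi> t'" if "0 < l"
  proof (rule order_tendstoI)
    fix z assume "z > \<psi> t'"
    then have "l * (z - \<psi> t') > 0" using that by simp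
    from ub[OF this, of t'] show "\<forall>\<^sub>F n in sequentially. \<psi> (t (k n)) < z"
      by eventually_elim (use that in \<open>simp add: algebra_simps\<close>)
  qed (rule ev)
  with that k(1) min ev show ?thesis by blast
qed

lemma min_points_antimono:
  assumes "x \<in> min_points (g_fun F \<psi> l)" "y \<in> min_points (g_fun F \<psi> m)" "l < m"
  shows "\<psi> y \<le> \<psi> x"
proof -
  have "l * \<psi> x - F x \<le> l * \<psi> y - F y" "m * \<psi> y - F y \<le> m * \<psi> x - F x"
    using assms by (auto simp: min_points_def g_fun_def)
  then have "(m - l) * \<psi> y \<le> (m - l) * \<psi> x" by (simp add: algebra_simps)
  then show ?thesis using assms(3) by simp
qed

text \<open>
  Ricceri's principle in one variable. Let \<open>t l\<close> be the minimizer for the multiplier \<open>l\<close>. The function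
  \<open>l \<mapsto> \<psi> (t l)\<close> is nonincreasing, and by uniqueness and stability of minimizers it is continuous. If it
  stayed below \<open>r\<close>, the minimizers for \<open>l \<down> a\<close> would accumulate at a minimizer for \<open>a\<close> with
  \<open>\<psi> \<le> r\<close>, against \<open>r < beta\<close>; if it stayed above \<open>r\<close>, then \<open>l \<up> b\<close> would contradict \<open>alpha < r\<close>, in the
  same way for finite \<open>b\<close> and by a direct comparison for \<open>b = \<infinity>\<close>. Hence it takes the value \<open>r\<close>, and the multiplier found is a Lagrange multiplier for the
  maximization of \<open>F\<close> on the level set of \<open>\<psi>\<close> at height \<open>r\<close>.
\<close>

proposition ex_multiplier:
  fixes F \<psi> :: "real \<Rightarrow> real" and a r :: real and b :: ereal
  assumes F: "continuous_on UNIV F" and lsc: "lower_semicont \<psi>"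
    and "0 \<le> a" "ereal a < b"
    and "\<forall>l. a < l \<and> ereal l < b \<longrightarrow>
           coercive (g_fun F \<psi> l) \<and> is_singleton (min_points (g_fun F \<psi> l))"
    and "alpha F \<psi> b < ereal r" "ereal r < beta F \<psi> (ereal a)"
  obtains l \<xi> where "a < l" "\<psi> \<xi> = r" "\<xi> \<in> min_points (g_fun F \<psi> l)"
proof -
  define I where "I = {l. a < l \<and> ereal l < b}"
  have coer: "coercive (g_fun F \<psi> l)" if "l \<in> I" for l using assms that by (auto simp: I_def)
  define t where "t = (\<lambda>l. THE t. t \<in> min_points (g_fun F \<psi> l))"
  have t: "min_points (g_fun F \<psi> l) = {t l}" if lI: "l \<in> I" for l
  proof -
    obtain z where "min_points (g_fun F \<psi> l) = {z}"
      using assms(5) lI unfolding I_def is_singleton_def by auto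
    then show ?thesis by (simp add: t_def)
  qed
  have tm: "t l \<in> min_points (g_fun F \<psi> l)" if "l \<in> I" for l using t[OF that] by simp
  have mono: "\<psi> (t m) \<le> \<psi> (t l)" if "l \<in> I" "m \<in> I" "l \<le> m" for l m
    using min_points_antimono[OF tm tm] that by (cases "l = m") auto
  obtain l0 where l0: "l0 \<in> I"
    using ereal_dense2[OF \<open>ereal a < b\<close>] by (auto simp: I_def)
  have down: "m \<in> I" if "a < m" "m \<le> l" "l \<in> I" for m l
    using that by (auto simp: I_def intro: le_less_trans[of "ereal m" "ereal l" b])
  have hi: "\<exists>l\<in>I. r \<le> \<psi> (t l)"
  proof (rule ccontr)
    assume "\<not> ?thesis"
    then have less: "\<psi> (t l) < r" if "l \<in> I" for l using that by force
    define \<mu> where "\<mu> = (\<lambda>n. a + (l0 - a) / real (Suc n))"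
    have al: "a < l0" using l0 by (simp add: I_def)
    have \<mu>: "a < \<mu> n" "\<mu> n \<le> l0" for n
    proof -
      show "a < \<mu> n" using al by (simp add: \<mu>_def)
      have "(l0 - a) / real (Suc n) \<le> (l0 - a) / 1" using al by (intro divide_left_mono) auto
      then show "\<mu> n \<le> l0" by (simp add: \<mu>_def)
    qed
    have lI: "\<mu> n \<in> I" for n using down[OF \<mu> l0] .
    have "(\<lambda>n. (l0 - a) / real (Suc n)) \<longlonglongrightarrow> 0"
      by real_asymp
    then have "\<mu> \<longlonglongrightarrow> a + 0" unfolding \<mu>_def by (intro tendsto_intros)
    then have lim: "\<mu> \<longlonglongrightarrow> a" by simp
    have bnd: "\<bar>\<psi> (t (\<mu> n))\<bar> \<le> max \<bar>r\<bar> \<bar>\<psi> (t l0)\<bar>" for n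
      using less[OF lI[of n]] mono[OF lI[of n] l0 \<mu>(2)] by auto
    obtain k t' where k: "strict_mono (k::nat\<Rightarrow>nat)" "t' \<in> min_points (g_fun F \<psi> a)"
      "\<And>z. z < \<psi> t' \<Longrightarrow> \<forall>\<^sub>F n in sequentially. z < \<psi> (t (\<mu> (k n)))"
      using min_points_limit[OF F lsc coer[OF l0] lim \<open>0 \<le> a\<close> tm[OF lI] bnd] by metis
    have "\<psi> t' \<le> r"
    proof (rule ccontr)
      assume "\<not> ?thesis"
      then have "\<forall>\<^sub>F n in sequentially. r < \<psi> (t (\<mu> (k n)))" using k(3)[of r] by simp
      then have "\<forall>\<^sub>F n::nat in sequentially. False"
        by eventually_elim (use less[OF lI] in \<open>force dest: less_asym\<close>)
      then show False by simp
    qed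
    moreover have "ereal r < ereal (\<psi> t')"
    proof (rule less_le_trans)
      show "ereal r < (INF x\<in>min_points (g_fun F \<psi> a). ereal (\<psi> x))"
        using assms(7) by (simp add: beta_def M_set_def)
    qed (rule INF_lower[OF k(2)])
    ultimately show False by simp
  qed
  have lo: "\<exists>l\<in>I. \<psi> (t l) \<le> r"
  proof (rule ccontr)
    assume "\<not> ?thesis"
    then have less: "r < \<psi> (t l)" if "l \<in> I" for l using that by force
    show False
    proof (cases b)
      case (real b')
      have lb: "l0 < b'" using l0 by (simp add: I_def real)
      define \<mu> where "\<mu> = (\<lambda>n. b' - (b' - l0) / real (Suc n))"
      have \<mu>: "l0 \<le> \<mu> n" "\<mu> n < b'" for n
      proof -
        have "(b' - l0) / real (Suc n) \<le> (b' - l0) / 1" using lb by (intro divide_left_mono) auto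
        then show "l0 \<le> \<mu> n" by (simp add: \<mu>_def)
      qed (use lb in \<open>simp add: \<mu>_def\<close>)
      have lI: "\<mu> n \<in> I" for n using \<mu>[of n] l0 by (simp add: I_def real)
      have "(\<lambda>n. (b' - l0) / real (Suc n)) \<longlonglongrightarrow> 0"
        by real_asymp
      then have "\<mu> \<longlonglongrightarrow> b' - 0" unfolding \<mu>_def by (intro tendsto_intros)
      then have lim: "\<mu> \<longlonglongrightarrow> b'" by simp
      have bnd: "\<bar>\<psi> (t (\<mu> n))\<bar> \<le> max \<bar>r\<bar> \<bar>\<psi> (t l0)\<bar>" for n
        using less[OF lI[of n]] mono[OF l0 lI[of n] \<mu>(1)] by auto
      have b': "0 < b'" "0 \<le> b'" using \<open>0 \<le> a\<close> l0 lb by (auto simp: I_def)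
      obtain k t' where k: "strict_mono (k::nat\<Rightarrow>nat)" "t' \<in> min_points (g_fun F \<psi> b')"
        "(\<lambda>n. \<psi> (t (\<mu> (k n)))) \<longlonglongrightarrow> \<psi> t'"
        using min_points_limit[OF F lsc coer[OF l0] lim b'(2) tm[OF lI] bnd] b'(1) by metis
      have "r \<le> \<psi> t'"
        using k(3) less[OF lI] by (intro LIMSEQ_le_const) (auto intro: less_imp_le)
      moreover have "ereal (\<psi> t') < ereal r"
      proof (rule le_less_trans)
        show "(SUP x\<in>min_points (g_fun F \<psi> b'). ereal (\<psi> x)) < ereal r"
          using assms(6) by (simp add: alpha_def M_set_def real)
      qed (rule SUP_upper[OF k(2)])
      ultimately show False by simp
    next
      case PInf
      \<comment> \<open>for \<open>b = \<infinity>\<close> a point \<open>x\<close> with \<open>\<psi> x < r\<close> beats every \<open>t l\<close> once \<open>l\<close> is large\<close>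
      have "(INF t. ereal (\<psi> t)) < ereal r" using assms(6) by (auto simp: alpha_def)
      then obtain x where x: "\<psi> x < r" by (auto simp: INF_less_iff)
      have l0m: "l0 * \<psi> (t l0) - F (t l0) \<le> l0 * \<psi> z - F z" for z
        using tm[OF l0] by (auto simp: min_points_def g_fun_def)
      have l0p: "0 \<le> l0" using l0 \<open>0 \<le> a\<close> by (simp add: I_def)
      define C where "C = F (t l0) - F x"
      have "l * (r - \<psi> x) \<le> C" if "l0 \<le> l" for l
      proof -
        have lI: "l \<in> I" using that l0 by (auto simp: I_def PInf)
        have 1: "l * \<psi> (t l) - F (t l) \<le> l * \<psi> x - F x"
          using tm[OF lI] by (auto simp: min_points_def g_fun_def)
        have "F (t l) \<le> F (t l0) + l0 * (\<psi> (t l) - \<psi> (t l0))"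
          using l0m[of "t l"] by (simp add: algebra_simps)
        moreover have "l0 * (\<psi> (t l) - \<psi> (t l0)) \<le> 0"
          using mono[OF l0 lI that] l0p by (simp add: mult_nonneg_nonpos)
        ultimately have "F (t l) \<le> F (t l0)" by simp
        moreover have "l * r \<le> l * \<psi> (t l)" using less[OF lI] l0p that by (intro mult_left_mono) auto
        ultimately show ?thesis using 1 by (simp add: algebra_simps C_def)
      qed
      from this[of "max l0 ((C + 1) / (r - \<psi> x))"] this[of l0]
      have "max l0 ((C + 1) / (r - \<psi> x)) * (r - \<psi> x) \<le> C" by simp
      moreover have "(C + 1) / (r - \<psi> x) * (r - \<psi> x) \<le> max l0 ((C + 1) / (r - \<psi> x)) * (r - \<psi> x)"
        using x by (intro mult_right_mono) auto
      ultimately show False using x by simp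
    next
      case MInf
      with assms show False by simp
    qed
  qed
  obtain lh ll where lh: "lh \<in> I" "r \<le> \<psi> (t lh)" and ll: "ll \<in> I" "\<psi> (t ll) \<le> r" using hi lo by auto
  show ?thesis
  proof (cases "lh \<le> ll")
    case False
    then have "\<psi> (t lh) \<le> \<psi> (t ll)" using mono[OF ll(1) lh(1)] by simp
    then have "\<psi> (t lh) = r" using lh ll by simp
    then show ?thesis using that[of lh "t lh"] lh tm by (auto simp: I_def)
  next
    case True
    have inI: "l \<in> I" if "lh \<le> l" "l \<le> ll" for l using that lh(1) ll(1) down[of l ll] by (auto simp: I_def)
    have cont: "continuous_on {lh..ll} (\<lambda>l. \<psi> (t l))"
      unfolding continuous_on_sequentially
    proof (intro allI ballI impI)
      fix x :: "nat \<Rightarrow> real" and l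
      assume l: "l \<in> {lh..ll}" and x: "(\<forall>n. x n \<in> {lh..ll}) \<and> x \<longlonglongrightarrow> l"
      have lI: "l \<in> I" using inI l by auto
      have xI: "x n \<in> I" for n using inI x by auto
      have lp: "0 < l" using lI \<open>0 \<le> a\<close> by (simp add: I_def)
      show "((\<lambda>l. \<psi> (t l)) \<circ> x) \<longlonglongrightarrow> \<psi> (t l)"
      proof (rule LIMSEQ_if_subsubseq)
        fix j :: "nat \<Rightarrow> nat" assume j: "strict_mono j"
        have bnd: "\<bar>\<psi> (t (x (j n)))\<bar> \<le> max \<bar>\<psi> (t lh)\<bar> \<bar>\<psi> (t ll)\<bar>" for n
          using mono[OF lh(1) xI[of "j n"]] mono[OF xI[of "j n"] ll(1)] x by fastforce
        have lim: "(\<lambda>n. x (j n)) \<longlonglongrightarrow> l" using x LIMSEQ_subseq_LIMSEQ[OF _ j] by (auto simp: o_def)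
        obtain k t' where k: "strict_mono (k::nat\<Rightarrow>nat)" "t' \<in> min_points (g_fun F \<psi> l)"
          "(\<lambda>n. \<psi> (t (x (j (k n))))) \<longlonglongrightarrow> \<psi> t'"
          using min_points_limit[OF F lsc coer[OF l0] lim less_imp_le[OF lp] tm[OF xI] bnd] lp by metis
        have "t' = t l" using k(2) t[OF lI] by simp
        then show "\<exists>k. strict_mono k \<and> (((\<lambda>l. \<psi> (t l)) \<circ> x) \<circ> (j \<circ> k)) \<longlonglongrightarrow> \<psi> (t l)"
          using k by (auto simp: o_def)
      qed
    qed
    obtain l where "lh \<le> l" "l \<le> ll" "\<psi> (t l) = r"
      using IVT2'[of "\<lambda>l. \<psi> (t l)" ll r lh] lh ll True cont by auto
    then show ?thesis using that[of l "t l"] inI tm by (auto simp: I_def)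
  qed
qed

section \<open>The subcritical fractional Sobolev inequality\<close>

text \<open>
  The exponent \<open>p = 2 / (1 - \<theta>)\<close> is the fixed point of \<open>p = 2 + \<theta> * p\<close>, so that the recursion maps a
  bound of the form \<open>a t \<le> S * t powr (-p)\<close> to another one with constant \<open>D' * S powr \<theta>\<close>. For the best
  constant \<open>S\<close> on \<open>{0<..t}\<close>, which is finite because \<open>a\<close> is bounded, this reads \<open>S \<le> D' * S powr \<theta>\<close>
  and bounds \<open>S\<close> independently of \<open>t\<close> and of the bound \<open>V\<close>.
\<close>

lemma decay_from_doubling:
  fixes a :: "real \<Rightarrow> real" and D V \<theta> t :: real
  assumes a: "\<And>t. 0 \<le> a t" "\<And>t. a t \<le> V" and \<theta>: "0 < \<theta>" "\<theta> < 1" and "0 \<le> D"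
    and step: "\<And>t. 0 < t \<Longrightarrow> a t * t\<^sup>2 \<le> D * a (t/2) powr \<theta>" and "0 < t"
  shows "a t \<le> (D * 2 powr (2 * \<theta> / (1 - \<theta>))) powr (1 / (1 - \<theta>)) * t powr (- (2 / (1 - \<theta>)))"
proof -
  define p where "p = 2 / (1 - \<theta>)"
  have p: "0 < p" "p - p * \<theta> = 2"
    using \<theta> by (simp_all add: p_def divide_simps) (simp add: algebra_simps)
  define A where "A = (\<lambda>x. x powr p * a x) ` {0<..t}"
  have bdd: "bdd_above A"
  proof (rule bdd_aboveI)
    fix y assume "y \<in> A"
    then obtain x where x: "y = x powr p * a x" "0 < x" "x \<le> t" by (auto simp: A_def)
    show "y \<le> t powr p * V"
      unfolding x(1) using x p a by (intro mult_mono powr_mono2) auto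
  qed
  define S where "S = Sup A"
  have S: "x powr p * a x \<le> S" if "0 < x" "x \<le> t" for x
    unfolding S_def using that by (intro cSup_upper bdd) (auto simp: A_def)
  have "0 \<le> t powr p * a t" using a by simp
  then have S0: "0 \<le> S" using S[of t] \<open>0 < t\<close> by linarith
  define D' where "D' = D * 2 powr (p * \<theta>)"
  have D0: "0 \<le> D'" using \<open>0 \<le> D\<close> by (simp add: D'_def)
  have "S \<le> D' * S powr \<theta>"
    unfolding S_def
  proof (rule cSup_least)
    show "A \<noteq> {}" using \<open>0 < t\<close> by (auto simp: A_def)
    fix y assume "y \<in> A"
    then obtain x where x: "y = x powr p * a x" "0 < x" "x \<le> t" by (auto simp: A_def)
    have "y = x powr (p * \<theta>) * (a x * x\<^sup>2)"
    proof -
      have "p = p * \<theta> + 2" using p by simp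
      then have "x powr p = x powr (p * \<theta>) * x powr 2" by (metis powr_add)
      then show ?thesis using x by simp
    qed
    also have "\<dots> \<le> x powr (p * \<theta>) * (D * a (x/2) powr \<theta>)"
      using step[OF x(2)] by (intro mult_left_mono) auto
    also have "\<dots> = D' * ((x/2) powr p * a (x/2)) powr \<theta>"
    proof -
      have "((x/2) powr p * a (x/2)) powr \<theta> = x powr (p * \<theta>) / 2 powr (p * \<theta>) * a (x/2) powr \<theta>"
        using x a by (simp add: powr_mult powr_powr powr_divide)
      then show ?thesis by (simp add: D'_def)
    qed
    also have "\<dots> \<le> D' * S powr \<theta>"
      using S[of "x/2"] x a \<theta> D0 by (intro mult_left_mono powr_mono2) auto
    finally show "y \<le> D' * Sup A powr \<theta>" by (simp add: S_def)
  qed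
  have "S \<le> D' powr (1 / (1 - \<theta>))"
  proof (cases "S = 0")
    case False
    then have "S > 0" using S0 by simp
    have "S powr (1 - \<theta>) = S / S powr \<theta>" using \<open>S > 0\<close> by (simp add: powr_diff)
    also have "\<dots> \<le> D'" using \<open>S \<le> D' * S powr \<theta>\<close> \<open>S > 0\<close> by (simp add: divide_le_eq)
    finally have "(S powr (1 - \<theta>)) powr (1 / (1 - \<theta>)) \<le> D' powr (1 / (1 - \<theta>))"
      using \<theta> by (intro powr_mono2) auto
    then show ?thesis using \<theta> \<open>S > 0\<close> by (simp add: powr_powr)
  qed simp
  moreover have "t powr p * a t \<le> S" using S[of t] \<open>0 < t\<close> by simp
  ultimately have "t powr p * a t \<le> D' powr (1 / (1 - \<theta>))" by linarith
  then have "a t \<le> D' powr (1 / (1 - \<theta>)) / t powr p"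
    using \<open>0 < t\<close> by (simp add: field_simps)
  moreover have "p * \<theta> = 2 * \<theta> / (1 - \<theta>)" by (simp add: p_def)
  ultimately show ?thesis by (simp add: D'_def powr_minus divide_inverse p_def mult_ac)
qed

text \<open>
  A dyadic layer cake: below the level \<open>\<tau>\<close> the integrand is at most \<open>\<tau> powr p\<close>, and the levels
  \<open>2^k * \<tau>\<close> contribute a geometric series, convergent because \<open>p < ps\<close>.
\<close>

lemma nn_integral_powr_le_of_weak_type:
  fixes p ps W \<tau> :: real
  assumes "finite_measure M" and [measurable]: "u \<in> borel_measurable M"
    and "0 < p" "p < ps" "0 \<le> W" and \<tau>: "0 < \<tau>"
    and weak: "\<And>t. 0 < t \<Longrightarrow> measure M {x \<in> space M. t < \<bar>u x\<bar>} \<le> W * (\<tau> / t) powr ps"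
  shows "(\<integral>\<^sup>+x. ennreal (\<bar>u x\<bar> powr p) \<partial>M)
    \<le> ennreal ((measure M (space M) + 2 powr p * W / (1 - 2 powr (p - ps))) * \<tau> powr p)"
proof -
  interpret finite_measure M by fact
  define V where "V = measure M (space M)"
  define c where "c = (\<lambda>k::nat. 2 powr p * W * (2 powr (p - ps)) ^ k)"
  have x1: "2 powr (p - ps) < 1" using assms by (simp add: powr_less_one)
  have sm: "summable c" unfolding c_def using x1 by (intro summable_mult summable_geometric) simp
  have c0: "0 \<le> c k" for k using assms by (simp add: c_def)
  define A where "A = (\<lambda>k::nat. {x \<in> space M. 2^k * \<tau> < \<bar>u x\<bar>})"
  have [measurable]: "A k \<in> sets M" for k unfolding A_def by measurable
  have pw: "ennreal (\<bar>u x\<bar> powr p) \<le> ennreal (\<tau> powr p) + (\<Sum>k. ennreal ((2^Suc k * \<tau>) powr p) * indicator (A k) x)"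
    if "x \<in> space M" for x
  proof (cases "\<bar>u x\<bar> \<le> \<tau>")
    case True
    then have "ennreal (\<bar>u x\<bar> powr p) \<le> ennreal (\<tau> powr p)"
      using assms by (intro ennreal_leI powr_mono2) auto
    then show ?thesis by (simp add: add_increasing2)
  next
    case False
    define P where "P = (\<lambda>k::nat. \<bar>u x\<bar> \<le> 2^k * \<tau>)"
    obtain k0 where "\<bar>u x\<bar> / \<tau> < 2 ^ k0" using real_arch_pow[of 2 "\<bar>u x\<bar> / \<tau>"] by auto
    then have "P k0" using \<tau> by (simp add: P_def field_simps)
    then obtain k where k: "P k" "\<And>j. j < k \<Longrightarrow> \<not> P j" using exists_least_iff[of P] by auto
    have "k \<noteq> 0" using False k(1) by (cases k) (auto simp: P_def)
    then obtain j where j: "k = Suc j" by (cases k) auto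
    have "x \<in> A j" using k(2)[of j] j that by (simp add: A_def P_def)
    define g where "g = (\<lambda>k. ennreal ((2^Suc k * \<tau>) powr p) * indicator (A k) x)"
    have "ennreal (\<bar>u x\<bar> powr p) \<le> g j"
      using k(1) assms \<tau> \<open>x \<in> A j\<close> unfolding P_def j g_def by (auto intro!: ennreal_leI powr_mono2)
    also have "\<dots> = sum g {j}" by simp
    also have "\<dots> \<le> suminf g" by (intro sum_le_suminf) auto
    also have "\<dots> = (\<Sum>k. ennreal ((2^Suc k * \<tau>) powr p) * indicator (A k) x)" by (simp add: g_def)
    finally show ?thesis by (simp add: add_increasing)
  qed
  have level: "ennreal ((2^Suc k * \<tau>) powr p) * emeasure M (A k) \<le> ennreal (\<tau> powr p * c k)" for k
  proof -
    have "(2^Suc k * \<tau>) powr p * measure M (A k) \<le> (2^Suc k * \<tau>) powr p * (W * (\<tau> / (2^k * \<tau>)) powr ps)"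
      using weak[of "2^k * \<tau>"] \<tau> by (intro mult_left_mono) (auto simp: A_def)
    also have "\<dots> = \<tau> powr p * c k"
    proof -
      have "\<tau> / (2^k * \<tau>) = 2 powr (- real k)"
        using \<tau> by (simp add: powr_minus powr_realpow field_simps)
      moreover have "(2^Suc k * \<tau>) powr p = 2 powr p * 2 powr (real k * p) * \<tau> powr p"
        using \<tau> by (simp add: powr_mult powr_powr flip: powr_realpow)
      moreover have "(2 powr (p - ps)) ^ k = 2 powr (real k * p) * 2 powr (- real k * ps)"
        by (simp add: powr_powr algebra_simps flip: powr_realpow powr_add)
      ultimately show ?thesis by (simp add: c_def powr_powr)
    qed
    finally show ?thesis
      by (simp add: emeasure_eq_measure ennreal_leI flip: ennreal_mult)
  qed
  have "(\<integral>\<^sup>+x. ennreal (\<bar>u x\<bar> powr p) \<partial>M)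
     \<le> (\<integral>\<^sup>+x. ennreal (\<tau> powr p) + (\<Sum>k. ennreal ((2^Suc k * \<tau>) powr p) * indicator (A k) x) \<partial>M)"
    by (intro nn_integral_mono pw)
  also have "\<dots> = ennreal (\<tau> powr p) * emeasure M (space M) + (\<Sum>k. ennreal ((2^Suc k * \<tau>) powr p) * emeasure M (A k))"
    by (subst nn_integral_add) (auto simp: nn_integral_suminf nn_integral_cmult)
  also have "\<dots> \<le> ennreal (\<tau> powr p * V) + (\<Sum>k. ennreal (\<tau> powr p * c k))"
  proof (intro add_mono suminf_le level)
    show "ennreal (\<tau> powr p) * emeasure M (space M) \<le> ennreal (\<tau> powr p * V)"
      by (simp add: V_def emeasure_eq_measure flip: ennreal_mult)
  qed auto
  also have "(\<Sum>k. ennreal (\<tau> powr p * c k)) = ennreal (\<tau> powr p * suminf c)"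
    using sm c0 by (subst suminf_ennreal2) (auto intro: summable_mult simp: suminf_mult)
  also have "ennreal (\<tau> powr p * V) + ennreal (\<tau> powr p * suminf c) = ennreal (\<tau> powr p * V + \<tau> powr p * suminf c)"
    using suminf_nonneg[OF sm c0] by (simp add: V_def ennreal_plus)
  also have "suminf c = 2 powr p * W / (1 - 2 powr (p - ps))"
  unfolding c_def using x1 by (subst suminf_mult) (auto simp: suminf_geometric)
  finally show ?thesis by (simp add: V_def algebra_simps)
qed

text \<open>
  The squared Gagliardo seminorm of order \<open>s\<close>.
\<close>

definition gagliardo :: "real \<Rightarrow> ('a::euclidean_space \<Rightarrow> real) \<Rightarrow> ennreal" where
  "gagliardo s u = (\<integral>\<^sup>+x. \<integral>\<^sup>+y. ennreal ((u x - u y)\<^sup>2 * dist x y powr (- (real DIM('a) + 2 * s))) \<partial>lborel \<partial>lborel)"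

text \<open>
  Around a point with \<open>t < \<bar>u x\<bar>\<close> take the ball whose measure is twice that of the set
  \<open>{x. t/2 < \<bar>u x\<bar>}\<close>. At least half of the ball lies outside that set, and on this half the
  difference quotient of \<open>u\<close> is at least \<open>t/2\<close> over the radius. The points \<open>x\<close> with \<open>t < \<bar>u x\<bar>\<close>
  therefore all contribute a definite amount to the seminorm.
\<close>

lemma level_set_recursion:
  fixes u :: "'a::euclidean_space \<Rightarrow> real" and s t E :: real
  assumes s: "0 < s" and [measurable]: "u \<in> borel_measurable borel"
    and G: "gagliardo s u \<le> ennreal E" and E: "0 \<le> E"
    and fin: "emeasure lborel {x. t/2 < \<bar>u x\<bar>} < \<infinity>" and t: "0 < t"
  defines "C \<equiv> 4 * (2 / unit_ball_vol (real DIM('a))) powr (1 + 2 * s / DIM('a))"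
  shows "measure lborel {x. t < \<bar>u x\<bar>} * t\<^sup>2 \<le> C * E * measure lborel {x. t/2 < \<bar>u x\<bar>} powr (2 * s / DIM('a))"
proof -
  define n where "n = real DIM('a)"
  have n: "0 < n" by (simp add: n_def)
  define \<omega> where "\<omega> = unit_ball_vol n"
  have \<omega>: "0 < \<omega>" by (simp add: \<omega>_def n_def)
  define A where "A = {x. t < \<bar>u x\<bar>}"
  define B where "B = {x. t/2 < \<bar>u x\<bar>}"
  have [measurable]: "A \<in> sets borel" "B \<in> sets borel" unfolding A_def B_def by measurable
  define m where "m = measure lborel B"
  have emB: "emeasure lborel B = ennreal m"
    using fin by (simp add: emeasure_eq_ennreal_measure B_def m_def less_top)
  have AB: "A \<subseteq> B" using t by (auto simp: A_def B_def)
  have emA: "emeasure lborel A = ennreal (measure lborel A)"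
    using emeasure_mono[OF AB, of lborel] emB by (intro emeasure_eq_ennreal_measure) (auto simp: top_unique)
  show ?thesis
  proof (cases "m = 0")
    case True
    have "emeasure lborel A \<le> 0" using emeasure_mono[OF AB, of lborel] emB True by simp
    then have "measure lborel A = 0" by (simp add: measure_def)
    then show ?thesis using E by (simp add: A_def C_def)
  next
    case False
    then have m: "0 < m" using measure_nonneg[of lborel B] by (simp add: m_def le_less)
    define \<rho> where "\<rho> = (2 * m / \<omega>) powr (1 / n)"
    have \<rho>: "0 < \<rho>" using m \<omega> by (simp add: \<rho>_def)
    have \<rho>n: "\<rho> powr n = 2 * m / \<omega>" using m \<omega> n by (simp add: \<rho>_def powr_powr)
    have ball: "emeasure lborel (ball x \<rho>) = ennreal (2 * m)" for x :: 'a
    proof -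
      have "\<omega> * \<rho> ^ DIM('a) = \<omega> * \<rho> powr n" using \<rho> by (simp add: n_def powr_realpow)
      also have "\<dots> = 2 * m" using \<omega> by (simp add: \<rho>n)
      finally show ?thesis using \<rho> by (simp add: emeasure_ball \<omega>_def n_def)
    qed
    have big: "ennreal m \<le> emeasure lborel (ball x \<rho> - B)" for x
    proof -
      have "ennreal (2 * m) \<le> emeasure lborel (ball x \<rho> - B) + ennreal m"
      proof -
        have "emeasure lborel (ball x \<rho>) \<le> emeasure lborel ((ball x \<rho> - B) \<union> B)"
          by (intro emeasure_mono) auto
        also have "\<dots> \<le> emeasure lborel (ball x \<rho> - B) + emeasure lborel B"
          by (intro emeasure_subadditive) auto
        finally show ?thesis by (simp add: ball emB)
      qed
      moreover have "ennreal (2 * m) = ennreal m + ennreal m" using m by (simp flip: ennreal_plus)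
      ultimately show ?thesis by (simp add: ennreal_add_left_cancel_le add.commute)
    qed
    define c where "c = (t/2)\<^sup>2 * \<rho> powr (- (n + 2 * s))"
    have inner: "ennreal c * ennreal m \<le> (\<integral>\<^sup>+y. ennreal ((u x - u y)\<^sup>2 * dist x y powr (- (n + 2 * s))) \<partial>lborel)"
      if x: "x \<in> A" for x
    proof -
      have "ennreal c * ennreal m \<le> ennreal c * emeasure lborel (ball x \<rho> - B)"
        by (intro mult_left_mono big) auto
      also have "\<dots> = (\<integral>\<^sup>+y. ennreal c * indicator (ball x \<rho> - B) y \<partial>lborel)"
        by (subst nn_integral_cmult_indicator) auto
      also have "\<dots> \<le> (\<integral>\<^sup>+y. ennreal ((u x - u y)\<^sup>2 * dist x y powr (- (n + 2 * s))) \<partial>lborel)"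
      proof (rule nn_integral_mono)
        fix y
        show "ennreal c * indicator (ball x \<rho> - B) y \<le> ennreal ((u x - u y)\<^sup>2 * dist x y powr (- (n + 2 * s)))"
        proof (cases "y \<in> ball x \<rho> - B")
          case True
          then have y: "dist x y < \<rho>" "\<bar>u y\<bar> \<le> t/2" by (auto simp: B_def)
          have "t < \<bar>u x\<bar>" using x by (simp add: A_def)
          then have "t/2 \<le> \<bar>u x - u y\<bar>" using y by linarith
          then have "(t/2)\<^sup>2 \<le> (u x - u y)\<^sup>2" using t by (metis abs_le_square_iff abs_of_pos half_gt_zero)
          moreover have "x \<noteq> y" using \<open>t < \<bar>u x\<bar>\<close> y t by auto
          then have "\<rho> powr (- (n + 2 * s)) \<le> dist x y powr (- (n + 2 * s))"
            using y n s by (intro powr_mono2') auto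
          ultimately have "c \<le> (u x - u y)\<^sup>2 * dist x y powr (- (n + 2 * s))"
            unfolding c_def by (intro mult_mono) auto
          then show ?thesis using True by (simp add: ennreal_leI)
        qed simp
      qed
      finally show ?thesis .
    qed
    have "ennreal c * ennreal m * emeasure lborel A = (\<integral>\<^sup>+x. (ennreal c * ennreal m) * indicator A x \<partial>lborel)"
      by (subst nn_integral_cmult_indicator) auto
    also have "\<dots> \<le> gagliardo s u"
      unfolding gagliardo_def n_def[symmetric]
    proof (rule nn_integral_mono)
      fix x show "(ennreal c * ennreal m) * indicator A x \<le> (\<integral>\<^sup>+y. ennreal ((u x - u y)\<^sup>2 * dist x y powr (- (n + 2 * s))) \<partial>lborel)"
        using inner[of x] by (cases "x \<in> A") auto
    qed
    also have "\<dots> \<le> ennreal E" by fact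
    finally have "ennreal c * ennreal m * emeasure lborel A \<le> ennreal E" .
    note * = this
    have main: "c * m * measure lborel A \<le> E"
    proof -
      have "0 \<le> c" by (simp add: c_def)
      then have "ennreal c * ennreal m * ennreal (measure lborel A) = ennreal (c * m * measure lborel A)"
        using m by (simp add: ennreal_mult)
      with * show ?thesis using E by (simp add: emA)
    qed
    have e: "(2 * m / \<omega>) powr (- (1 + 2 * s / n)) = \<rho> powr (- (n + 2 * s))"
    proof -
      have "(\<rho> powr n) powr (- (1 + 2 * s / n)) = \<rho> powr (- (n + 2 * s))"
        proof -
        have "n * (- (1 + 2 * s / n)) = - (n + 2 * s)" using n by (simp add: field_simps)
        then show ?thesis by (simp add: powr_powr)
      qed
      then show ?thesis by (simp add: \<rho>n)
    qed
    define w where "w = (2 * m / \<omega>) powr (1 + 2 * s / n)"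
    have w: "0 < w" using m \<omega> by (simp add: w_def)
    have cw: "c = (t/2)\<^sup>2 / w"
    proof -
      have *: "\<rho> powr (- (n + 2 * s)) = inverse w"
        unfolding e[symmetric] w_def by (rule powr_minus)
      show ?thesis unfolding c_def * by (rule divide_inverse[symmetric])
    qed
    have cw4: "c * w * 4 = t\<^sup>2" using w unfolding cw by (simp add: power_divide)
    define \<mu> where "\<mu> = measure lborel A"
    have "\<mu> * t\<^sup>2 = \<mu> * (c * w * 4)" by (simp only: cw4)
    also have "\<dots> = 4 * (c * m * \<mu>) * w / m"
      using m by (simp add: field_simps)
    also have "\<dots> \<le> 4 * E * w / m"
      using main m w unfolding \<mu>_def by (intro divide_right_mono mult_right_mono) auto
    also have "w = (2 / \<omega>) powr (1 + 2 * s / n) * (m powr (2 * s / n) * m)"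
      using m \<omega> by (simp add: w_def powr_mult powr_divide powr_add)
    also have "4 * E * ((2 / \<omega>) powr (1 + 2 * s / n) * (m powr (2 * s / n) * m)) / m = C * E * m powr (2 * s / n)"
      using m by (simp add: C_def \<omega>_def n_def)
    finally show ?thesis unfolding \<mu>_def A_def B_def m_def n_def .
  qed
qed

text \<open>
  The recursion for the distribution function of \<open>u\<close> has \<open>\<theta> = 2 * s / n\<close>, for which \<open>2 / (1 - \<theta>)\<close> is the
  critical exponent. Thus \<open>u\<close> is of weak type at the critical exponent, and lies in every
  \<open>L\<^sup>p\<close> below it because \<open>\<Omega>\<close> has finite measure.
\<close>

proposition fractional_sobolev:
  fixes \<Omega> :: "'a::euclidean_space set" and s p :: real
  assumes s: "0 < s" "2 * s < real DIM('a)"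
    and \<Omega>[measurable]: "\<Omega> \<in> sets borel" and fin: "emeasure lborel \<Omega> < \<infinity>"
    and p: "0 < p" "p < crit_exp DIM('a) s"
  obtains C where "0 < C"
    "\<And>(u :: 'a \<Rightarrow> real) (E :: real). \<lbrakk>u \<in> borel_measurable borel; \<And>x. x \<notin> \<Omega> \<Longrightarrow> u x = 0; gagliardo s u \<le> ennreal E; 0 < E\<rbrakk>
      \<Longrightarrow> (\<integral>\<^sup>+x. ennreal (\<bar>u x\<bar> powr p) \<partial>lborel) \<le> ennreal (C * E powr (p / 2))"
proof -
  define n where "n = real DIM('a)"
  have n: "0 < n" by (simp add: n_def)
  define \<theta> where "\<theta> = 2 * s / n"
  have \<theta>: "0 < \<theta>" "\<theta> < 1" using s n by (simp_all add: \<theta>_def n_def)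
  define ps where "ps = 2 / (1 - \<theta>)"
  have ps: "p < ps"
  proof -
    have "ps = crit_exp DIM('a) s" using s n by (simp add: ps_def \<theta>_def crit_exp_def n_def[symmetric] field_simps)
    then show ?thesis using p by simp
  qed
  define C0 where "C0 = 4 * (2 / unit_ball_vol (real DIM('a))) powr (1 + 2 * s / DIM('a))"
  have C0: "0 < C0" by (simp add: C0_def less_imp_neq[symmetric])
  define W where "W = (C0 * 2 powr (2 * \<theta> / (1 - \<theta>))) powr (1 / (1 - \<theta>))"
  have W: "0 \<le> W" by (simp add: W_def)
  define M where "M = restrict_space (lborel :: 'a measure) \<Omega>"
  have sM: "space M = \<Omega>" by (simp add: M_def space_restrict_space)
  have M: "finite_measure M"
    using fin by (intro finite_measureI) (simp add: sM, simp add: M_def emeasure_restrict_space)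
  define C where "C = measure lborel \<Omega> + 2 powr p * W / (1 - 2 powr (p - ps)) + 1"
  have C: "0 < C"
  proof -
    have "2 powr (p - ps) < 1" using ps by (simp add: powr_less_one)
    then have "0 \<le> 2 powr p * W / (1 - 2 powr (p - ps))" using W by simp
    then show ?thesis unfolding C_def using measure_nonneg[of lborel \<Omega>] by linarith
  qed
  show ?thesis
  proof (rule that[OF C])
    fix u :: "'a \<Rightarrow> real" and E
    assume u[measurable]: "u \<in> borel_measurable borel" and u0: "\<And>x. x \<notin> \<Omega> \<Longrightarrow> u x = 0"
      and G: "gagliardo s u \<le> ennreal E" and E: "0 < E"
    define a where "a = (\<lambda>t. measure lborel ({x. t < \<bar>u x\<bar>} \<inter> \<Omega>))"
    have a_eq: "measure lborel {x. t < \<bar>u x\<bar>} = a t" if "0 < t" for t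
    proof -
      have "{x. t < \<bar>u x\<bar>} = {x. t < \<bar>u x\<bar>} \<inter> \<Omega>" using u0 that by force
      then show ?thesis by (simp add: a_def)
    qed
    have weak: "a t \<le> W * (sqrt E / t) powr ps" if t: "0 < t" for t
    proof -
      have "a t \<le> ((C0 * E) * 2 powr (2 * \<theta> / (1 - \<theta>))) powr (1 / (1 - \<theta>)) * t powr (- (2 / (1 - \<theta>)))"
      proof (rule decay_from_doubling[OF _ _ \<theta> _ _ t])
        show "a t \<le> measure lborel \<Omega>" for t
          unfolding a_def using fin by (intro measure_mono_fmeasurable) (auto simp: fmeasurable_def)
        fix t :: real assume t: "0 < t"
        have "emeasure lborel {x. t/2 < \<bar>u x\<bar>} \<le> emeasure lborel \<Omega>"
          using u0 t by (intro emeasure_mono) force+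
        then have "emeasure lborel {x. t/2 < \<bar>u x\<bar>} < \<infinity>" using fin by (rule le_less_trans)
        from level_set_recursion[OF s(1) u G less_imp_le[OF E] this t]
        show "a t * t\<^sup>2 \<le> C0 * E * a (t / 2) powr \<theta>"
          unfolding a_eq[OF t] a_eq[OF half_gt_zero[OF t]] C0_def \<theta>_def n_def .
      qed (use C0 E in \<open>auto simp: a_def\<close>)
      also have "((C0 * E) * 2 powr (2 * \<theta> / (1 - \<theta>))) powr (1 / (1 - \<theta>)) = W * E powr (1 / (1 - \<theta>))"
        using C0 E by (simp add: W_def powr_mult mult_ac)
      also have "E powr (1 / (1 - \<theta>)) = sqrt E powr ps"
        using E by (simp add: ps_def powr_half_sqrt[symmetric] powr_powr)
      also have "W * sqrt E powr ps * t powr (- (2 / (1 - \<theta>))) = W * (sqrt E / t) powr ps"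
        using t E unfolding ps_def[symmetric] by (simp add: powr_divide powr_minus_divide)
      finally show ?thesis .
    qed
    have "(\<integral>\<^sup>+x. ennreal (\<bar>u x\<bar> powr p) \<partial>lborel) = (\<integral>\<^sup>+x. ennreal (\<bar>u x\<bar> powr p) * indicator \<Omega> x \<partial>lborel)"
      using u0 p by (intro nn_integral_cong) (auto simp: indicator_def)
    also have "\<dots> = (\<integral>\<^sup>+x. ennreal (\<bar>u x\<bar> powr p) \<partial>M)"
      by (simp add: M_def nn_integral_restrict_space)
    also have "\<dots> \<le> ennreal ((measure M (space M) + 2 powr p * W / (1 - 2 powr (p - ps))) * sqrt E powr p)"
    proof (rule nn_integral_powr_le_of_weak_type[OF M _ p(1) ps W])
      show "u \<in> borel_measurable M" by (simp add: M_def measurable_restrict_space1)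
      show "measure M {x \<in> space M. t < \<bar>u x\<bar>} \<le> W * (sqrt E / t) powr ps" if "0 < t" for t
      proof -
        have "measure M {x \<in> space M. t < \<bar>u x\<bar>} = measure lborel {x \<in> \<Omega>. t < \<bar>u x\<bar>}"
          unfolding sM by (simp add: M_def measure_restrict_space)
        also have "{x \<in> \<Omega>. t < \<bar>u x\<bar>} = {x. t < \<bar>u x\<bar>} \<inter> \<Omega>" by auto
        finally show ?thesis using weak[OF that] by (simp add: a_def)
      qed
    qed (use E in auto)
    also have "\<dots> \<le> ennreal (C * sqrt E powr p)"
    proof (intro ennreal_leI mult_right_mono)
      have "measure M (space M) = measure lborel \<Omega>"
        unfolding sM by (simp add: M_def measure_restrict_space)
      then show "measure M (space M) + 2 powr p * W / (1 - 2 powr (p - ps)) \<le> C" by (simp add: C_def)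
    qed simp
    also have "sqrt E powr p = E powr (p / 2)"
      using E by (simp add: powr_half_sqrt[symmetric] powr_powr)
    finally show "(\<integral>\<^sup>+x. ennreal (\<bar>u x\<bar> powr p) \<partial>lborel) \<le> ennreal (C * E powr (p / 2))" .
  qed
qed

section \<open>Compactness of bounded sequences\<close>

definition grid_cube :: "real \<Rightarrow> ('a::euclidean_space \<Rightarrow> int) \<Rightarrow> 'a set" where
  "grid_cube \<delta> k = {x. \<forall>i\<in>Basis. \<lfloor>x \<bullet> i / \<delta>\<rfloor> = k i}"

lemma grid_cube_measurable [measurable]: "grid_cube \<delta> k \<in> sets (borel :: 'a::euclidean_space measure)"
proof -
  have "grid_cube \<delta> k = (\<Inter>i\<in>Basis. {x \<in> space borel. \<lfloor>x \<bullet> i / \<delta>\<rfloor> = k i})"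
    by (auto simp: grid_cube_def)
  also have "\<dots> \<in> sets borel" by (intro sets.finite_INT) (auto, measurable)
  finally show ?thesis .
qed

lemma emeasure_grid_cube:
  fixes k :: "'a::euclidean_space \<Rightarrow> int"
  assumes \<delta>: "0 < \<delta>"
  shows "emeasure lborel (grid_cube \<delta> k) = ennreal (\<delta> ^ DIM('a))"
proof -
  define l u :: 'a where "l = (\<Sum>i\<in>Basis. (k i * \<delta>) *\<^sub>R i)" and "u = (\<Sum>i\<in>Basis. ((k i + 1) * \<delta>) *\<^sub>R i)"
  have li: "l \<bullet> i = k i * \<delta>" "u \<bullet> i = (k i + 1) * \<delta>" if "i \<in> Basis" for i
    using that by (simp_all add: l_def u_def)
  have fl: "\<lfloor>y / \<delta>\<rfloor> = j \<longleftrightarrow> j * \<delta> \<le> y \<and> y < (j + 1) * \<delta>" for y :: real and j :: int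
    using \<delta> by (simp add: floor_eq_iff field_simps)
  have sub: "box l u \<subseteq> grid_cube \<delta> k" "grid_cube \<delta> k \<subseteq> cbox l u"
    by (auto simp: grid_cube_def box_def cbox_def li fl less_imp_le)
  have side: "(u - l) \<bullet> i = \<delta>" if "i \<in> Basis" for i
    using that by (simp add: inner_diff_left li algebra_simps)
  have le: "l \<bullet> i \<le> u \<bullet> i" if "i \<in> Basis" for i
    using that \<delta> by (simp add: li)
  have "ennreal (\<delta> ^ DIM('a)) = emeasure lborel (box l u)"
    using le side by (subst emeasure_lborel_box) auto
  moreover have "ennreal (\<delta> ^ DIM('a)) = emeasure lborel (cbox l u)"
    using le side by (subst emeasure_lborel_cbox) auto
  ultimately show ?thesis
    using emeasure_mono[OF sub(1), of lborel] emeasure_mono[OF sub(2), of lborel] by (simp add: antisym)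
qed

lemma grid_cube_dist:
  fixes x y :: "'a::euclidean_space"
  assumes "x \<in> grid_cube \<delta> k" "y \<in> grid_cube \<delta> k" and \<delta>: "0 < \<delta>"
  shows "dist x y \<le> real DIM('a) * \<delta>"
proof -
  have "\<bar>(x - y) \<bullet> i\<bar> \<le> \<delta>" if "i \<in> Basis" for i
  proof -
    have "\<lfloor>x \<bullet> i / \<delta>\<rfloor> = \<lfloor>y \<bullet> i / \<delta>\<rfloor>" using assms that by (auto simp: grid_cube_def)
    then have "\<bar>x \<bullet> i / \<delta> - y \<bullet> i / \<delta>\<bar> \<le> 1" by linarith
    then show ?thesis using \<delta> by (simp add: inner_diff_left flip: diff_divide_distrib)
  qed
  then have "(\<Sum>i\<in>Basis. \<bar>(x - y) \<bullet> i\<bar>) \<le> (\<Sum>i\<in>(Basis::'a set). \<delta>)" by (intro sum_mono)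
  then show ?thesis using norm_le_l1[of "x - y"] by (simp add: dist_norm)
qed

definition grid_index :: "nat \<Rightarrow> ('a::euclidean_space \<Rightarrow> int) set" where
  "grid_index N = PiE Basis (\<lambda>_. {- int N..<int N})"

lemma finite_grid_index [simp]: "finite (grid_index N)"
  by (simp add: grid_index_def finite_PiE)

lemma card_grid_index: "card (grid_index N :: ('a::euclidean_space \<Rightarrow> int) set) = (2 * N) ^ DIM('a)"
proof -
  have "card {- int N..<int N} = 2 * N" by simp
  then show ?thesis by (simp only: grid_index_def card_PiE finite_Basis prod_constant)
qed

lemma grid_cover:
  fixes x :: "'a::euclidean_space"
  assumes "norm x < B" "0 < N"
  obtains k where "k \<in> grid_index N" "x \<in> grid_cube (B / real N) k"
proof -
  have B: "0 < B" using assms norm_ge_zero[of x] by linarith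
  define k where "k = restrict (\<lambda>i. \<lfloor>x \<bullet> i / (B / real N)\<rfloor>) (Basis :: 'a set)"
  have "\<lfloor>x \<bullet> i / (B / real N)\<rfloor> \<in> {- int N..<int N}" if "i \<in> Basis" for i
  proof -
    have "\<bar>x \<bullet> i\<bar> < B" using Basis_le_norm[OF that, of x] assms by linarith
    then have "- B < x \<bullet> i" "x \<bullet> i < B" by auto
    then have "- real N < x \<bullet> i / (B / real N)" "x \<bullet> i / (B / real N) < real N"
    proof -
      have "- B * real N < (x \<bullet> i) * real N" "(x \<bullet> i) * real N < B * real N"
        using \<open>- B < x \<bullet> i\<close> \<open>x \<bullet> i < B\<close> assms(2) by (intro mult_strict_right_mono; simp)+
      then have "- real N * B < (x \<bullet> i) * real N" "(x \<bullet> i) * real N < real N * B"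
        by (simp_all add: mult.commute)
      then have "- real N < (x \<bullet> i) * real N / B" "(x \<bullet> i) * real N / B < real N"
        using B by (simp_all only: pos_less_divide_eq pos_divide_less_eq)
      then show "- real N < x \<bullet> i / (B / real N)" "x \<bullet> i / (B / real N) < real N"
        by simp_all
    qed
    then show ?thesis by (auto simp: le_floor_iff floor_less_iff)
  qed
  then have "k \<in> grid_index N" by (auto simp: k_def grid_index_def)
  moreover have "x \<in> grid_cube (B / real N) k" by (simp add: grid_cube_def k_def)
  ultimately show ?thesis by (rule that)
qed

text \<open>
  A Poincare inequality on the cells of a grid of mesh \<open>B / N\<close>. On one cell, \<open>v x\<close> differs from its
  mean by at most the mean of \<open>\<bar>v x - v y\<bar>\<close>, and \<open>\<bar>v x - v y\<bar> \<le> \<eta> + \<bar>v x - v y\<bar>\<^sup>2 / \<eta>\<close>, where the quadratic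
  term is at most a power of the mesh times the integrand of the seminorm, since \<open>x\<close> and \<open>y\<close> are at
  distance at most \<open>n * B / N\<close> for \<open>n\<close> the dimension. The estimate shows that, up to a small error, the \<open>L\<^sup>1\<close> norm is controlled by the
  finitely many means.
\<close>

lemma L1_le_cube_means:
  fixes v :: "'a::euclidean_space \<Rightarrow> real" and s B E \<eta> :: real
  assumes s: "0 < s" and v: "integrable lborel v" and supp: "\<And>x. v x \<noteq> 0 \<Longrightarrow> norm x < B"
    and G: "gagliardo s v \<le> ennreal E" and E: "0 \<le> E" and B: "0 < B" and N: "0 < N" and \<eta>: "0 < \<eta>"
  shows "(\<integral>x. \<bar>v x\<bar> \<partial>lborel) \<le> \<eta> * (2 * B) ^ DIM('a)
      + DIM('a) powr (DIM('a) + 2 * s) * (B / N) powr (2 * s) / \<eta> * E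
      + (\<Sum>k\<in>grid_index N. \<bar>\<integral>x. indicator (grid_cube (B / N) k) x * v x \<partial>lborel\<bar>)"
proof -
  have [measurable]: "v \<in> borel_measurable borel" using v by auto
  define n where "n = real DIM('a)"
  have n: "0 < n" by (simp add: n_def)
  define \<delta> where "\<delta> = B / N"
  have \<delta>: "0 < \<delta>" using B N by (simp add: \<delta>_def)
  define m where "m = \<delta> ^ DIM('a)"
  have m: "0 < m" using \<delta> by (simp add: m_def)
  have mc: "emeasure lborel (grid_cube \<delta> k) = ennreal m" for k :: "'a \<Rightarrow> int"
    using \<delta> by (simp add: emeasure_grid_cube m_def)
  define T where "T = (\<lambda>k. \<integral>x. indicator (grid_cube \<delta> k) x * v x \<partial>lborel)"
  define g where "g = (\<lambda>x y. (v x - v y)\<^sup>2 * dist x y powr (- (n + 2 * s)))"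
  define H where "H = (\<lambda>x. \<integral>\<^sup>+y. ennreal (g x y) \<partial>lborel)"
  have Hm[measurable]: "H \<in> borel_measurable borel"
    unfolding H_def g_def by measurable
  define c where "c = (n * \<delta>) powr (n + 2 * s) / \<eta>"
  have c: "0 < c" using n \<delta> \<eta> by (simp add: c_def)
  have d: "\<bar>v x - v y\<bar> \<le> \<eta> + c * g x y" if "x \<in> grid_cube \<delta> k" "y \<in> grid_cube \<delta> k" for x y k
  proof (cases "x = y")
    case False
    let ?d = "\<bar>v x - v y\<bar>"
    have "?d * \<eta> \<le> \<eta>\<^sup>2 + ?d\<^sup>2"
    proof -
      have "0 \<le> ?d * \<eta>" using \<eta> by simp
      then show ?thesis using sum_squares_bound[of ?d \<eta>] by linarith
    qed
    then have "?d \<le> \<eta> + (v x - v y)\<^sup>2 / \<eta>"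
      using \<eta> by (simp add: field_simps power2_eq_square)
    also have "(v x - v y)\<^sup>2 / \<eta> \<le> c * g x y"
    proof -
      have "dist x y powr (n + 2 * s) \<le> (n * \<delta>) powr (n + 2 * s)"
        using grid_cube_dist[OF that \<delta>] n s by (intro powr_mono2) (auto simp: n_def)
      moreover have "0 < dist x y powr (n + 2 * s)" using False by simp
      ultimately have "1 \<le> (n * \<delta>) powr (n + 2 * s) * dist x y powr (- (n + 2 * s))"
        by (simp only: powr_minus divide_inverse[symmetric] le_divide_eq_1_pos)
      then have "(v x - v y)\<^sup>2 / \<eta> * 1 \<le> (v x - v y)\<^sup>2 / \<eta> * ((n * \<delta>) powr (n + 2 * s) * dist x y powr (- (n + 2 * s)))"
        using \<eta> by (intro mult_left_mono) auto
      then show ?thesis by (simp add: c_def g_def mult_ac)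
    qed
    finally show ?thesis by simp
  qed (use \<eta> c in \<open>simp add: g_def\<close>)
  have on_cube: "ennreal \<bar>v x\<bar> \<le> ennreal \<eta> + ennreal (c / m) * H x + ennreal (\<bar>T k\<bar> / m)"
    if x: "x \<in> grid_cube \<delta> k" for x k
  proof -
    let ?C = "grid_cube \<delta> k"
    have int: "integrable lborel (\<lambda>y. indicator ?C y * v x)"
      by (intro integrable_mult_left) (auto simp: mc less_top[symmetric])
    have int2: "integrable lborel (\<lambda>y. indicator ?C y * v y)"
      using integrable_mult_indicator[OF _ v, of ?C] by simp
    have "(\<integral>y. indicator ?C y * (v x - v y) \<partial>lborel) = m * v x - T k"
      using int int2 m by (simp add: right_diff_distrib T_def measure_def mc)
    then have "ennreal \<bar>m * v x - T k\<bar> = ennreal (norm (\<integral>y. indicator ?C y * (v x - v y) \<partial>lborel))"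
      by simp
    also have "\<dots> \<le> (\<integral>\<^sup>+y. ennreal (norm (indicator ?C y * (v x - v y))) \<partial>lborel)"
      using int int2 by (intro integral_norm_bound_ennreal) (simp add: right_diff_distrib)
    also have "\<dots> \<le> (\<integral>\<^sup>+y. ennreal \<eta> * indicator ?C y + ennreal c * ennreal (g x y) \<partial>lborel)"
    proof (rule nn_integral_mono)
      fix y show "ennreal (norm (indicator ?C y * (v x - v y))) \<le> ennreal \<eta> * indicator ?C y + ennreal c * ennreal (g x y)"
        using d[OF x, of y] \<eta> c by (cases "y \<in> ?C") (auto simp: g_def ennreal_leI simp flip: ennreal_plus ennreal_mult)
    qed
    also have "\<dots> = ennreal (\<eta> * m) + ennreal c * H x"
      unfolding H_def by (subst nn_integral_add)
        (auto simp: g_def nn_integral_cmult mc ennreal_mult'[symmetric] nn_integral_cmult_indicator \<eta>[THEN less_imp_le])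
    finally have *: "ennreal \<bar>m * v x - T k\<bar> \<le> ennreal (\<eta> * m) + ennreal c * H x" .
    have "ennreal \<bar>v x\<bar> = ennreal (1/m) * ennreal \<bar>m * v x\<bar>"
      using m by (simp add: abs_mult flip: ennreal_mult)
    also have "\<dots> \<le> ennreal (1/m) * (ennreal \<bar>m * v x - T k\<bar> + ennreal \<bar>T k\<bar>)"
      by (intro mult_left_mono) (auto simp flip: ennreal_plus intro!: ennreal_leI)
    also have "\<dots> \<le> ennreal (1/m) * (ennreal (\<eta> * m) + ennreal c * H x + ennreal \<bar>T k\<bar>)"
      by (intro mult_left_mono add_right_mono *) auto
    also have "\<dots> = ennreal \<eta> + ennreal (c / m) * H x + ennreal (\<bar>T k\<bar> / m)"
      using m \<eta> c by (simp add: distrib_left mult.assoc[symmetric] flip: ennreal_mult)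
    finally show ?thesis .
  qed
  have pw: "ennreal \<bar>v x\<bar> \<le> (\<Sum>k\<in>grid_index N. (ennreal \<eta> + ennreal (\<bar>T k\<bar> / m)) * indicator (grid_cube \<delta> k) x) + ennreal (c / m) * H x" for x
  proof (cases "v x = 0")
    case False
    obtain k where k: "k \<in> grid_index N" "x \<in> grid_cube \<delta> k"
      using grid_cover[OF supp[OF False] N] unfolding \<delta>_def by metis
    have "ennreal \<bar>v x\<bar> \<le> (ennreal \<eta> + ennreal (\<bar>T k\<bar> / m)) * indicator (grid_cube \<delta> k) x + ennreal (c / m) * H x"
      using on_cube[OF k(2)] k(2) by (simp add: add_ac)
    also have "(ennreal \<eta> + ennreal (\<bar>T k\<bar> / m)) * indicator (grid_cube \<delta> k) x
        \<le> (\<Sum>k\<in>grid_index N. (ennreal \<eta> + ennreal (\<bar>T k\<bar> / m)) * indicator (grid_cube \<delta> k) x)"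
      using k(1) by (intro member_le_sum) auto
    finally show ?thesis by (simp add: add_right_mono)
  qed simp
  have "(\<integral>\<^sup>+x. ennreal \<bar>v x\<bar> \<partial>lborel) \<le> (\<integral>\<^sup>+x. (\<Sum>k\<in>grid_index N. (ennreal \<eta> + ennreal (\<bar>T k\<bar> / m)) * indicator (grid_cube \<delta> k) x) + ennreal (c / m) * H x \<partial>lborel)"
    by (intro nn_integral_mono pw)
  also have "\<dots> = (\<Sum>k\<in>grid_index N. (ennreal \<eta> + ennreal (\<bar>T k\<bar> / m)) * ennreal m) + ennreal (c / m) * (\<integral>\<^sup>+x. H x \<partial>lborel)"
    by (subst nn_integral_add, measurable, subst nn_integral_sum)
      (auto simp: nn_integral_cmult nn_integral_cmult_indicator mc intro!: sum.cong)
  also have "(\<integral>\<^sup>+x. H x \<partial>lborel) = gagliardo s v"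
    by (simp add: H_def g_def gagliardo_def n_def)
  also have "(\<Sum>k\<in>grid_index N. (ennreal \<eta> + ennreal (\<bar>T k\<bar> / m)) * ennreal m) = (\<Sum>k\<in>(grid_index N :: ('a \<Rightarrow> int) set). ennreal (\<eta> * m + \<bar>T k\<bar>))"
    using \<eta> m by (intro sum.cong) (auto simp: distrib_right simp flip: ennreal_plus ennreal_mult)
  also have "\<dots> = ennreal (\<Sum>k\<in>(grid_index N :: ('a \<Rightarrow> int) set). \<eta> * m + \<bar>T k\<bar>)"
    using \<eta> m by (intro sum_ennreal) auto
  also have "(\<Sum>k\<in>(grid_index N :: ('a \<Rightarrow> int) set). \<eta> * m + \<bar>T k\<bar>) = \<eta> * (2 * B) ^ DIM('a) + (\<Sum>k\<in>grid_index N. \<bar>T k\<bar>)"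
  proof -
    have "real ((2 * N) ^ DIM('a)) * m = (2 * B) ^ DIM('a)"
      unfolding m_def of_nat_power power_mult_distrib[symmetric] using N by (simp add: \<delta>_def)
    then show ?thesis by (simp add: sum.distrib card_grid_index mult.left_commute)
  qed
  finally have *: "(\<integral>\<^sup>+x. ennreal \<bar>v x\<bar> \<partial>lborel) \<le> ennreal (\<eta> * (2 * B) ^ DIM('a) + (\<Sum>k\<in>(grid_index N :: ('a \<Rightarrow> int) set). \<bar>T k\<bar>)) + ennreal (c / m) * gagliardo s v" .
  also have "\<dots> \<le> ennreal (\<eta> * (2 * B) ^ DIM('a) + (\<Sum>k\<in>(grid_index N :: ('a \<Rightarrow> int) set). \<bar>T k\<bar>)) + ennreal (c / m) * ennreal E"
    by (intro add_left_mono mult_left_mono G) auto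
  also have "ennreal (\<eta> * (2 * B) ^ DIM('a) + (\<Sum>k\<in>(grid_index N :: ('a \<Rightarrow> int) set). \<bar>T k\<bar>)) + ennreal (c / m) * ennreal E
     = ennreal (\<eta> * (2 * B) ^ DIM('a) + (\<Sum>k\<in>(grid_index N :: ('a \<Rightarrow> int) set). \<bar>T k\<bar>) + c / m * E)"
    using \<eta> B c m E by (simp add: sum_nonneg flip: ennreal_plus ennreal_mult)
  also have "(\<integral>\<^sup>+x. ennreal \<bar>v x\<bar> \<partial>lborel) = ennreal (\<integral>x. \<bar>v x\<bar> \<partial>lborel)"
    using v by (intro nn_integral_eq_integral) auto
  finally have "(\<integral>x. \<bar>v x\<bar> \<partial>lborel) \<le> \<eta> * (2 * B) ^ DIM('a) + (\<Sum>k\<in>(grid_index N :: ('a \<Rightarrow> int) set). \<bar>T k\<bar>) + c / m * E"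
    using \<eta> B c m E by (subst (asm) ennreal_le_iff) (auto intro!: add_nonneg_nonneg sum_nonneg)
  moreover have "c / m = n powr (n + 2 * s) * \<delta> powr (2 * s) / \<eta>"
    using n \<delta> by (simp add: c_def m_def powr_mult powr_add n_def powr_realpow)
  ultimately show ?thesis by (simp add: T_def \<delta>_def n_def)
qed

lemma gagliardo_diff_le:
  fixes u v :: "'a::euclidean_space \<Rightarrow> real"
  assumes [measurable]: "u \<in> borel_measurable borel" "v \<in> borel_measurable borel"
  shows "gagliardo s (\<lambda>x. u x - v x) \<le> 2 * gagliardo s u + 2 * gagliardo s v"
proof -
  let ?d = "\<lambda>x y::'a. dist x y powr (- (real DIM('a) + 2 * s))"
  have "ennreal ((u x - v x - (u y - v y))\<^sup>2 * ?d x y)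
      \<le> 2 * ennreal ((u x - u y)\<^sup>2 * ?d x y) + 2 * ennreal ((v x - v y)\<^sup>2 * ?d x y)" for x y
  proof -
    have "(u x - v x - (u y - v y))\<^sup>2 \<le> 2 * (u x - u y)\<^sup>2 + 2 * (v x - v y)\<^sup>2"
      using zero_le_power2[of "(u x - u y) + (v x - v y)"] by (simp add: power2_eq_square algebra_simps)
    then have "(u x - v x - (u y - v y))\<^sup>2 * ?d x y \<le> (2 * (u x - u y)\<^sup>2 + 2 * (v x - v y)\<^sup>2) * ?d x y"
      by (rule mult_right_mono) simp
    then have "(u x - v x - (u y - v y))\<^sup>2 * ?d x y \<le> 2 * ((u x - u y)\<^sup>2 * ?d x y) + 2 * ((v x - v y)\<^sup>2 * ?d x y)"
      by (simp add: algebra_simps)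
    from ennreal_leI[OF this] show ?thesis by (simp add: ennreal_mult)
  qed
  then have "gagliardo s (\<lambda>x. u x - v x) \<le> (\<integral>\<^sup>+x. \<integral>\<^sup>+y. 2 * ennreal ((u x - u y)\<^sup>2 * ?d x y) + 2 * ennreal ((v x - v y)\<^sup>2 * ?d x y) \<partial>lborel \<partial>lborel)"
    unfolding gagliardo_def by (intro nn_integral_mono)
  also have "\<dots> = 2 * gagliardo s u + 2 * gagliardo s v"
    unfolding gagliardo_def by (simp add: nn_integral_add nn_integral_cmult)
  finally show ?thesis .
qed

text \<open>
  A diagonal argument makes the means over all cells of all grids converge. By the estimate above,
  applied to differences of members of the sequence, the subsequence is Cauchy in \<open>L\<^sup>1\<close>.
\<close>

proposition fractional_rellich:
  fixes u :: "nat \<Rightarrow> 'a::euclidean_space \<Rightarrow> real" and s E :: real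
  assumes s: "0 < s" "2 * s < real DIM('a)"
    and \<Omega>: "\<Omega> \<in> sets borel" "bounded \<Omega>"
    and u[measurable]: "\<And>n. u n \<in> borel_measurable borel" and supp: "\<And>n x. x \<notin> \<Omega> \<Longrightarrow> u n x = 0"
    and G: "\<And>n. gagliardo s (u n) \<le> ennreal E"
  obtains r where "strict_mono (r :: nat \<Rightarrow> nat)" "AE x in lborel. convergent (\<lambda>n. u (r n) x)"
proof -
  define E' where "E' = \<bar>E\<bar> + 1"
  have E': "0 < E'" by (simp add: E'_def)
  have G': "gagliardo s (u n) \<le> ennreal E'" for n
    by (rule order_trans[OF G]) (simp add: E'_def ennreal_leI del: ennreal_plus)
  obtain B where B: "0 < B" "\<And>x. x \<in> \<Omega> \<Longrightarrow> norm x < B"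
    using \<Omega>(2) unfolding bounded_pos_less by blast
  have fin: "emeasure lborel \<Omega> < \<infinity>" using \<Omega>(2) by (rule emeasure_bounded_finite)
  have "1 < crit_exp DIM('a) s" using s by (simp add: crit_exp_def)
  from fractional_sobolev[OF s \<Omega>(1) fin zero_less_one this]
  obtain C where C: "0 < C" "\<And>(u :: 'a \<Rightarrow> real) (E :: real). \<lbrakk>u \<in> borel_measurable borel; \<And>x. x \<notin> \<Omega> \<Longrightarrow> u x = 0; gagliardo s u \<le> ennreal E; 0 < E\<rbrakk>
      \<Longrightarrow> (\<integral>\<^sup>+x. ennreal (\<bar>u x\<bar> powr 1) \<partial>lborel) \<le> ennreal (C * E powr (1 / 2))" by metis
  define M where "M = C * E' powr (1/2)"
  have L1: "(\<integral>\<^sup>+x. ennreal \<bar>u n x\<bar> \<partial>lborel) \<le> ennreal M" for n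
    using C(2)[OF u[of n] supp G' E'] by (simp add: M_def)
  have int: "integrable lborel (u n)" for n
  proof (rule integrableI_bounded)
    show "(\<integral>\<^sup>+ x. ennreal (norm (u n x)) \<partial>lborel) < \<infinity>"
      using le_less_trans[OF L1[of n] ennreal_less_top] by simp
  qed simp
  have M: "0 \<le> M" using C E' by (simp add: M_def)
  have L1': "(\<integral>x. \<bar>u n x\<bar> \<partial>lborel) \<le> M" for n
  proof -
    have "ennreal (\<integral>x. \<bar>u n x\<bar> \<partial>lborel) \<le> ennreal M"
      using L1[of n] int[of n] by (subst (asm) nn_integral_eq_integral) auto
    then show ?thesis using M by simp
  qed
  define A where "A = (\<lambda>n (N, k). \<integral>x. indicator (grid_cube (B / real N) k) x * u n x \<partial>lborel)"
  define S where "S = (SIGMA N:(UNIV::nat set). (grid_index N :: ('a \<Rightarrow> int) set))"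
  have "countable S" unfolding S_def by (intro countable_SIGMA) (auto intro: countable_finite)
  have ic: "integrable lborel (\<lambda>x. indicator (grid_cube \<delta> k) x * u n x)" for \<delta> k n
    using integrable_mult_indicator[OF _ int, of "grid_cube \<delta> k" n] by simp
  have bnd: "norm (A n z) \<le> M" for n z
  proof (cases z)
    case (Pair N k)
    have "norm (A n z) \<le> (\<integral>x. norm (indicator (grid_cube (B / real N) k) x * u n x) \<partial>lborel)"
      unfolding A_def Pair split_conv by (rule integral_norm_bound)
    also have "\<dots> \<le> (\<integral>x. \<bar>u n x\<bar> \<partial>lborel)"
      using ic int by (intro integral_mono) (auto simp: indicator_def)
    finally show ?thesis using L1'[of n] by simp
  qed
  obtain r where r: "strict_mono (r :: nat \<Rightarrow> nat)" "\<And>z. z \<in> S \<Longrightarrow> \<exists>l. (\<lambda>n. A (r n) z) \<longlonglongrightarrow> l"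
    using function_convergent_subsequence[OF \<open>countable S\<close>, of A M] bnd by blast
  have cau: "Cauchy (\<lambda>n. A (r n) z)" if "z \<in> S" for z
    using r(2)[OF that] LIMSEQ_imp_Cauchy by blast
  define V where "V = (2 * B) ^ DIM('a)"
  have V: "0 < V" using B by (simp add: V_def)
  define D where "D = DIM('a) powr (DIM('a) + 2 * s)"
  have est: "\<exists>K. \<forall>i\<ge>K. \<forall>j\<ge>K. (\<integral>x. norm (u (r i) x - u (r j) x) \<partial>lborel) < e" if e: "0 < e" for e
  proof -
    define \<eta> where "\<eta> = e / (4 * V)"
    have \<eta>: "0 < \<eta>" "\<eta> * V = e / 4" using e V by (simp_all add: \<eta>_def)
    have "(\<lambda>N. D * (B / real N) powr (2 * s) / \<eta> * (4 * E')) \<longlonglongrightarrow> D * 0 / \<eta> * (4 * E')"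
    proof (intro tendsto_intros)
      have "((\<lambda>N. (B / real N) powr (2 * s)) \<longlongrightarrow> 0 powr (2 * s)) sequentially"
        using s B by (intro tendsto_powr2) (auto intro!: tendsto_eq_intros lim_const_over_n always_eventually)
      then show "(\<lambda>N. (B / real N) powr (2 * s)) \<longlonglongrightarrow> 0" by simp
    qed (use \<eta> in auto)
    then have "eventually (\<lambda>N. D * (B / real N) powr (2 * s) / \<eta> * (4 * E') < e / 4) sequentially"
      using e by (intro order_tendstoD(2)[of _ "D * 0 / \<eta> * (4 * E')"]) auto
    then obtain N where N: "0 < N" "D * (B / real N) powr (2 * s) / \<eta> * (4 * E') < e / 4"
      using eventually_happens'[OF sequentially_bot eventually_conj[OF eventually_gt_at_top[of "0::nat"]]] by blast
    let ?I = "grid_index N :: ('a \<Rightarrow> int) set"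
    define \<epsilon> where "\<epsilon> = e / (4 * (real (card ?I) + 1))"
    have \<epsilon>: "0 < \<epsilon>" using e by (simp add: \<epsilon>_def)
    have "\<forall>k\<in>?I. \<exists>K. \<forall>i\<ge>K. \<forall>j\<ge>K. \<bar>A (r i) (N, k) - A (r j) (N, k)\<bar> < \<epsilon>"
      using cau \<epsilon> by (fastforce simp: S_def Cauchy_iff)
    then obtain K where K: "\<And>k i j. k \<in> ?I \<Longrightarrow> i \<ge> K k \<Longrightarrow> j \<ge> K k \<Longrightarrow> \<bar>A (r i) (N, k) - A (r j) (N, k)\<bar> < \<epsilon>"
      by metis
    show ?thesis
    proof (intro exI allI impI)
      fix i j assume ij: "(\<Sum>k\<in>?I. K k) \<le> i" "(\<Sum>k\<in>?I. K k) \<le> j"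
      have Kle: "K k \<le> (\<Sum>k\<in>?I. K k)" if "k \<in> ?I" for k using that by (intro member_le_sum) auto
      define v where "v = (\<lambda>x. u (r i) x - u (r j) x)"
      have Gv: "gagliardo s v \<le> ennreal (4 * E')"
      proof -
        have "gagliardo s v \<le> 2 * ennreal E' + 2 * ennreal E'"
          unfolding v_def by (rule order_trans[OF gagliardo_diff_le]) (auto intro!: add_mono mult_left_mono G')
        also have "\<dots> = ennreal (4 * E')" using E' by (simp add: ennreal_mult flip: distrib_right)
        finally show ?thesis .
      qed
      have "(\<integral>x. \<bar>v x\<bar> \<partial>lborel) \<le> \<eta> * V + D * (B / N) powr (2 * s) / \<eta> * (4 * E')
          + (\<Sum>k\<in>?I. \<bar>\<integral>x. indicator (grid_cube (B / N) k) x * v x \<partial>lborel\<bar>)"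
        unfolding V_def D_def
      proof (rule L1_le_cube_means[OF s(1) _ _ Gv _ B(1) N(1) \<eta>(1)])
        show "integrable lborel v" unfolding v_def by (intro Bochner_Integration.integrable_diff int)
        show "norm x < B" if "v x \<noteq> 0" for x
          using that supp B(2) by (cases "x \<in> \<Omega>") (auto simp: v_def)
      qed (use E' in simp)
      also have "(\<Sum>k\<in>?I. \<bar>\<integral>x. indicator (grid_cube (B / N) k) x * v x \<partial>lborel\<bar>) \<le> (\<Sum>k\<in>?I. \<epsilon>)"
      proof (rule sum_mono)
        fix k assume k: "k \<in> ?I"
        have "(\<integral>x. indicator (grid_cube (B / N) k) x * v x \<partial>lborel) = A (r i) (N, k) - A (r j) (N, k)"
          using ic by (simp add: A_def v_def right_diff_distrib)
        then show "\<bar>\<integral>x. indicator (grid_cube (B / N) k) x * v x \<partial>lborel\<bar> \<le> \<epsilon>"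
          using K[OF k, of i j] Kle[OF k] ij by simp
      qed
      also have "(\<Sum>k\<in>?I. \<epsilon>) \<le> e / 4"
        using e by (simp add: \<epsilon>_def field_simps)
      finally show "(\<integral>x. norm (u (r i) x - u (r j) x) \<partial>lborel) < e"
        using \<eta>(2) N(2) e unfolding v_def by simp
    qed
  qed
  obtain r' where r': "strict_mono (r' :: nat \<Rightarrow> nat)" "AE x in lborel. Cauchy (\<lambda>i. u (r (r' i)) x)"
    using cauchy_L1_AE_cauchy_subseq[of lborel "\<lambda>n. u (r n)", OF int est] by blast
  show ?thesis
  proof (rule that[of "r \<circ> r'"])
    show "strict_mono (r \<circ> r')" using r(1) r'(1) by (rule strict_mono_o)
    show "AE x in lborel. convergent (\<lambda>n. u ((r \<circ> r') n) x)"
      using r'(2) by (auto simp: Cauchy_convergent_iff)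
  qed
qed

section \<open>Lebesgue measure on a product\<close>

text \<open>
  The Lebesgue sigma-algebra of the product is larger than the product of the Lebesgue sigma-algebras,
  so Fubini's theorem is used for Borel representatives only. The lemmas of this section
  transport measurability and null sets along \<open>fst\<close>, \<open>snd\<close> and the difference.
\<close>

lemma borel_measurable_pair:
  fixes g :: "'a::euclidean_space \<Rightarrow> 'b::topological_space"
  assumes "g \<in> borel_measurable borel"
  shows "(\<lambda>z. g (fst z)) \<in> borel_measurable (borel :: ('a \<times> 'a) measure)"
    and "(\<lambda>z. g (snd z)) \<in> borel_measurable (borel :: ('a \<times> 'a) measure)"
    and "(\<lambda>z. g (fst z - snd z)) \<in> borel_measurable (borel :: ('a \<times> 'a) measure)"
  by (rule measurable_compose[OF _ assms], intro borel_measurable_continuous_onI continuous_intros)+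

lemma nn_integral_lborel_pair:
  fixes f :: "'a::euclidean_space \<times> 'b::euclidean_space \<Rightarrow> ennreal"
  assumes [measurable]: "f \<in> borel_measurable borel"
  shows "(\<integral>\<^sup>+z. f z \<partial>lborel) = (\<integral>\<^sup>+x. \<integral>\<^sup>+y. f (x, y) \<partial>lborel \<partial>lborel)"
    and "(\<integral>\<^sup>+z. f z \<partial>lborel) = (\<integral>\<^sup>+y. \<integral>\<^sup>+x. f (x, y) \<partial>lborel \<partial>lborel)"
proof -
  have f: "f \<in> borel_measurable (lborel \<Otimes>\<^sub>M lborel)" by (simp add: lborel_prod)
  show "(\<integral>\<^sup>+z. f z \<partial>lborel) = (\<integral>\<^sup>+x. \<integral>\<^sup>+y. f (x, y) \<partial>lborel \<partial>lborel)"
    using lborel.nn_integral_fst[OF f] by (simp add: lborel_prod)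
  show "(\<integral>\<^sup>+z. f z \<partial>lborel) = (\<integral>\<^sup>+y. \<integral>\<^sup>+x. f (x, y) \<partial>lborel \<partial>lborel)"
    using lborel_pair.nn_integral_snd[OF f] by (simp add: lborel_prod)
qed

lemma nn_integral_lborel_reflect:
  fixes g :: "'a::euclidean_space \<Rightarrow> ennreal"
  assumes [measurable]: "g \<in> borel_measurable borel"
  shows "(\<integral>\<^sup>+y. g (x - y) \<partial>lborel) = (\<integral>\<^sup>+y. g y \<partial>lborel)"
proof -
  have "(\<integral>\<^sup>+y. g y \<partial>lborel) = (\<integral>\<^sup>+y. g y \<partial>density (distr lborel borel (\<lambda>y. x + (-1) *\<^sub>R y)) (\<lambda>_. 1))"
    using lborel_affine[of "-1" x] by (intro arg_cong[where f = "\<lambda>M. nn_integral M g"]) simp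
  also have "\<dots> = (\<integral>\<^sup>+y. g (x - y) \<partial>lborel)"
    by (simp add: nn_integral_density nn_integral_distr)
  finally show ?thesis ..
qed

lemma nn_integral_lborel_translate:
  fixes g :: "'a::euclidean_space \<Rightarrow> ennreal"
  assumes [measurable]: "g \<in> borel_measurable borel"
  shows "(\<integral>\<^sup>+x. g (x - y) \<partial>lborel) = (\<integral>\<^sup>+x. g x \<partial>lborel)"
proof -
  have "(\<integral>\<^sup>+x. g (x - y) \<partial>lborel) = (\<integral>\<^sup>+x. (\<lambda>z. g (- z)) (y - x) \<partial>lborel)" by simp
  also have "\<dots> = (\<integral>\<^sup>+z. g (0 - z) \<partial>lborel)"
    by (subst nn_integral_lborel_reflect) auto
  also have "\<dots> = (\<integral>\<^sup>+x. g x \<partial>lborel)" by (rule nn_integral_lborel_reflect) simp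
  finally show ?thesis .
qed

lemma AE_lborel_fst:
  assumes "AE x in (lborel :: 'a::euclidean_space measure). P x"
  shows "AE z in (lborel :: ('a \<times> 'b::euclidean_space) measure). P (fst z)"
proof -
  obtain N where N: "{x \<in> space lborel. \<not> P x} \<subseteq> N" "emeasure lborel N = 0" "N \<in> sets (lborel :: 'a measure)"
    using assms by (rule AE_E)
  have "emeasure (lborel \<Otimes>\<^sub>M lborel) (N \<times> (UNIV :: 'b set)) = 0"
    using N by (subst lborel.emeasure_pair_measure_Times) auto
  moreover have "N \<times> (UNIV :: 'b set) \<in> sets (lborel \<Otimes>\<^sub>M lborel)"
    using N by (intro pair_measureI) auto
  ultimately show ?thesis
    using N by (intro AE_I[of _ _ "N \<times> UNIV"]) (auto simp: lborel_prod intro: borel_Times)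
qed

lemma AE_lborel_snd:
  assumes "AE x in (lborel :: 'b::euclidean_space measure). P x"
  shows "AE z in (lborel :: ('a::euclidean_space \<times> 'b) measure). P (snd z)"
proof -
  obtain N where N: "{x \<in> space lborel. \<not> P x} \<subseteq> N" "emeasure lborel N = 0" "N \<in> sets (lborel :: 'b measure)"
    using assms by (rule AE_E)
  have "emeasure (lborel \<Otimes>\<^sub>M lborel) ((UNIV :: 'a set) \<times> N) = 0"
    using N by (subst lborel.emeasure_pair_measure_Times) auto
  moreover have "(UNIV :: 'a set) \<times> N \<in> sets (lborel \<Otimes>\<^sub>M lborel)"
    using N by (intro pair_measureI) auto
  ultimately show ?thesis
    using N by (intro AE_I[of _ _ "UNIV \<times> N"]) (auto simp: lborel_prod intro: borel_Times)
qed

lemma AE_lborel_diff: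
  assumes "AE x in (lborel :: 'a::euclidean_space measure). P x"
  shows "AE z in (lborel :: ('a \<times> 'a) measure). P (fst z - snd z)"
proof -
  obtain N where N: "{x \<in> space lborel. \<not> P x} \<subseteq> N" "emeasure lborel N = 0" "N \<in> sets (lborel :: 'a measure)"
    using assms by (rule AE_E)
  have [measurable]: "N \<in> sets borel" using N by simp
  define S where "S = {z :: 'a \<times> 'a. fst z - snd z \<in> N}"
  have Sm[measurable]: "S \<in> sets borel"
  proof -
    have "(\<lambda>z. fst z - snd z) -` N \<inter> space borel \<in> sets (borel :: ('a \<times> 'a) measure)"
      by (intro measurable_sets[of _ _ borel]) (auto intro!: borel_measurable_continuous_onI continuous_intros)
    then show ?thesis by (simp add: S_def vimage_def)
  qed
  have "emeasure lborel S = (\<integral>\<^sup>+z. indicator S z \<partial>lborel)" by simp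
  also have "\<dots> = (\<integral>\<^sup>+x. \<integral>\<^sup>+y. indicator S (x, y) \<partial>lborel \<partial>lborel)"
    by (rule nn_integral_lborel_pair) simp
  also have "\<dots> = (\<integral>\<^sup>+x. \<integral>\<^sup>+y. indicator N (x - y) \<partial>lborel \<partial>lborel)"
    by (intro nn_integral_cong) (simp add: S_def indicator_def)
  also have "\<dots> = 0"
    using N(2) by (subst nn_integral_lborel_reflect) auto
  finally have "emeasure lborel S = 0" .
  moreover have "{z \<in> space lborel. \<not> P (fst z - snd z)} \<subseteq> S" using N(1) by (auto simp: S_def)
  ultimately show ?thesis using Sm by (intro AE_I[of _ _ S]) auto
qed

lemma AE_lebesgue_iff: "(AE x in lebesgue. P x) \<longleftrightarrow> (AE x in lborel. P x)"
  by (rule AE_completion_iff)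

lemma AE_lebesgue_pair:
  assumes "AE x in (lebesgue :: 'a::euclidean_space measure). P x"
  shows "AE z in (lebesgue :: ('a \<times> 'a) measure). P (fst z)"
    and "AE z in (lebesgue :: ('a \<times> 'a) measure). P (snd z)"
    and "AE z in (lebesgue :: ('a \<times> 'a) measure). P (fst z - snd z)"
  using assms AE_lborel_fst[of P] AE_lborel_snd[of P] AE_lborel_diff[of P]
  unfolding AE_lebesgue_iff by auto

lemma lebesgue_measurable_pair:
  fixes g :: "'a::euclidean_space \<Rightarrow> real"
  assumes g: "g \<in> borel_measurable lebesgue"
  shows "(\<lambda>z. g (fst z)) \<in> borel_measurable (lebesgue :: ('a \<times> 'a) measure)"
    and "(\<lambda>z. g (snd z)) \<in> borel_measurable (lebesgue :: ('a \<times> 'a) measure)"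
    and "(\<lambda>z. g (fst z - snd z)) \<in> borel_measurable (lebesgue :: ('a \<times> 'a) measure)"
proof -
  obtain g' where g'[measurable]: "g' \<in> borel_measurable borel" and "AE x in lborel. g x = g' x"
    using completion_ex_borel_measurable_real[OF g] by auto
  then have ae: "AE x in lebesgue. g' x = g x" by (auto simp: AE_lebesgue_iff)
  show "(\<lambda>z. g (fst z)) \<in> borel_measurable (lebesgue :: ('a \<times> 'a) measure)"
    by (rule borel_measurable_AE[OF _ AE_lebesgue_pair(1)[OF ae]])
      (intro measurable_completion, simp add: borel_measurable_pair[OF g'])
  show "(\<lambda>z. g (snd z)) \<in> borel_measurable (lebesgue :: ('a \<times> 'a) measure)"
    by (rule borel_measurable_AE[OF _ AE_lebesgue_pair(2)[OF ae]])
      (intro measurable_completion, simp add: borel_measurable_pair[OF g'])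
  show "(\<lambda>z. g (fst z - snd z)) \<in> borel_measurable (lebesgue :: ('a \<times> 'a) measure)"
    by (rule borel_measurable_AE[OF _ AE_lebesgue_pair(3)[OF ae]])
      (intro measurable_completion, simp add: borel_measurable_pair[OF g'])
qed

section \<open>The energy space\<close>

text \<open>
  With this function the energy space is a space of functions whose image under a linear map is square
  integrable, and norm and inner product are those of \<open>L\<^sup>2\<close> on \<open>Q_set \<Omega>\<close>.
\<close>

definition weighted_diff :: "('a::euclidean_space \<Rightarrow> real) \<Rightarrow> ('a \<Rightarrow> real) \<Rightarrow> 'a \<times> 'a \<Rightarrow> real" where
  "weighted_diff K u z = (u (fst z) - u (snd z)) * sqrt (K (fst z - snd z))"

locale fractional_kernel =
  fixes K :: "'a::euclidean_space \<Rightarrow> real" and \<Omega> :: "'a set" and s \<beta> :: real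
  assumes s: "0 < s" "2 * s < real DIM('a)"
    and \<Omega>: "open \<Omega>" "bounded \<Omega>"
    and K_pos: "\<And>x. x \<noteq> 0 \<Longrightarrow> 0 < K x"
    and K_int: "integrable lebesgue (\<lambda>x. min ((norm x)\<^sup>2) 1 * K x)"
    and \<beta>: "0 < \<beta>" and K_lower: "\<And>x. x \<noteq> 0 \<Longrightarrow> \<beta> * norm x powr (- (real DIM('a) + 2 * s)) \<le> K x"
begin

abbreviation "X0 \<equiv> X0_space K \<Omega>"
abbreviation "nrm \<equiv> X0_norm K \<Omega>"
abbreviation "MQ \<equiv> lebesgue_on (Q_set \<Omega>)"
abbreviation "D \<equiv> weighted_diff K"

lemma \<Omega>_borel [measurable]: "\<Omega> \<in> sets borel" using \<Omega> by simp

lemma \<Omega>_fin: "emeasure lborel \<Omega> < \<infinity>" using \<Omega>(2) by (rule emeasure_bounded_finite)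

lemma finite_measure_\<Omega>: "finite_measure (lebesgue_on \<Omega>)"
  using \<Omega>_fin by (intro finite_measureI) (simp add: emeasure_restrict_space)

lemma Q_set_eq: "Q_set \<Omega> = {z. fst z \<in> \<Omega> \<or> snd z \<in> \<Omega>}"
  by (auto simp: Q_set_def)

lemma Q_borel [measurable]: "Q_set \<Omega> \<in> sets borel"
proof -
  have "open (fst -` \<Omega> \<union> snd -` \<Omega> :: ('a \<times> 'a) set)"
    using \<Omega>(1) by (intro open_Un open_vimage_fst open_vimage_snd)
  then show ?thesis by (simp add: Q_set_eq vimage_def Collect_disj_eq)
qed

lemma Q_lebesgue: "Q_set \<Omega> \<in> sets lebesgue"
  using Q_borel by (simp add: sets_completionI_sets)

lemma \<Omega>_lebesgue: "\<Omega> \<in> sets lebesgue"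
  using \<Omega>_borel by (simp add: sets_completionI_sets)

lemma K_measurable [measurable]: "K \<in> borel_measurable lebesgue"
proof -
  let ?m = "\<lambda>x::'a. min ((norm x)\<^sup>2) 1"
  have "(\<lambda>x. (?m x * K x) / ?m x) \<in> borel_measurable lebesgue"
    by (rule borel_measurable_divide[OF borel_measurable_integrable[OF K_int]])
      (auto intro!: measurable_completion)
  moreover have "AE x in lebesgue. (?m x * K x) / ?m x = K x"
  proof -
    have "AE x in lebesgue. x \<noteq> (0::'a)" by (simp add: AE_lebesgue_iff AE_lborel_singleton)
    then show ?thesis by eventually_elim (simp add: min_def)
  qed
  ultimately show ?thesis by (rule borel_measurable_AE)
qed

lemma D_measurable: "u \<in> borel_measurable lebesgue \<Longrightarrow> D u \<in> borel_measurable lebesgue"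
  using lebesgue_measurable_pair[of u] lebesgue_measurable_pair(3)[OF K_measurable]
  unfolding weighted_diff_def[abs_def] by (intro borel_measurable_times borel_measurable_diff) auto

lemma D_measurable_Q: "u \<in> borel_measurable lebesgue \<Longrightarrow> D u \<in> borel_measurable MQ"
  by (intro measurable_restrict_space1 D_measurable)

lemma D_mult: "D u z * D v z = (u (fst z) - u (snd z)) * (v (fst z) - v (snd z)) * K (fst z - snd z)"
proof (cases "fst z = snd z")
  case False
  then have "sqrt (K (fst z - snd z)) * sqrt (K (fst z - snd z)) = K (fst z - snd z)"
    using K_pos[of "fst z - snd z"] by simp
  then show ?thesis by (simp add: weighted_diff_def algebra_simps)
qed (simp add: weighted_diff_def)

lemma D_linear: "D (\<lambda>x. u x + t * v x) z = D u z + t * D v z"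
  by (simp add: weighted_diff_def algebra_simps)

lemma D_diff: "D (\<lambda>x. u x - v x) z = D u z - D v z"
  by (simp add: weighted_diff_def algebra_simps)

lemma inner_eq: "X0_inner K \<Omega> u v = (\<integral>z. D u z * D v z \<partial>MQ)"
  by (simp add: X0_inner_def D_mult case_prod_unfold)

lemma energy_eq: "(\<integral>(x, y). \<bar>u x - u y\<bar>\<^sup>2 * K (x - y) \<partial>MQ) = (\<integral>z. (D u z)\<^sup>2 \<partial>MQ)"
  unfolding power2_eq_square D_mult by (simp add: case_prod_unfold)

lemma nrm_sq: "(nrm u)\<^sup>2 = (\<integral>z. (D u z)\<^sup>2 \<partial>MQ)"
  unfolding X0_norm_def energy_eq by simp

lemma nrm_nonneg: "0 \<le> nrm u"
  unfolding X0_norm_def energy_eq by simp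

lemma X0_iff: "u \<in> X0 \<longleftrightarrow> u \<in> borel_measurable lebesgue \<and> integrable (lebesgue_on \<Omega>) (\<lambda>x. (u x)\<^sup>2) \<and>
    integrable MQ (\<lambda>z. (D u z)\<^sup>2) \<and> (AE x in lebesgue. x \<notin> \<Omega> \<longrightarrow> u x = 0)"
proof -
  have *: "(\<lambda>(x, y). (u x - u y) * sqrt (K (x - y))) = D u" for u by (auto simp: weighted_diff_def)
  show ?thesis
    unfolding X0_space_def X_space_def L2_on_def *
    by (auto intro: measurable_restrict_space1 D_measurable_Q)
qed

lemma integrable_D_mult:
  assumes "u \<in> X0" "v \<in> X0"
  shows "integrable MQ (\<lambda>z. D u z * D v z)"
proof (rule Bochner_Integration.integrable_bound)
  show "integrable MQ (\<lambda>z. (D u z)\<^sup>2 + (D v z)\<^sup>2)" using assms by (auto simp: X0_iff)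
  show "(\<lambda>z. D u z * D v z) \<in> borel_measurable MQ"
    using assms by (intro borel_measurable_times D_measurable_Q) (auto simp: X0_iff)
  have "\<bar>x * y\<bar> \<le> x\<^sup>2 + y\<^sup>2" for x y :: real
  proof -
    have "0 \<le> \<bar>x\<bar> * \<bar>y\<bar>" by simp
    then show ?thesis using sum_squares_bound[of "\<bar>x\<bar>" "\<bar>y\<bar>"] unfolding abs_mult by (simp only: power2_abs)
  qed
  then show "AE z in MQ. norm (D u z * D v z) \<le> norm ((D u z)\<^sup>2 + (D v z)\<^sup>2)"
    by (simp add: abs_mult)
qed

lemma X0_add_mult:
  assumes "u \<in> X0" "v \<in> X0"
  shows "(\<lambda>x. u x + t * v x) \<in> X0"
    and "(nrm (\<lambda>x. u x + t * v x))\<^sup>2 = (nrm u)\<^sup>2 + 2 * t * X0_inner K \<Omega> u v + t\<^sup>2 * (nrm v)\<^sup>2"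
proof -
  have sq: "(D (\<lambda>x. u x + t * v x) z)\<^sup>2 = (D u z)\<^sup>2 + 2 * t * (D u z * D v z) + t\<^sup>2 * (D v z)\<^sup>2" for z
    by (simp add: D_linear power2_eq_square algebra_simps)
  have int: "integrable MQ (\<lambda>z. (D u z)\<^sup>2)" "integrable MQ (\<lambda>z. (D v z)\<^sup>2)"
    using assms by (auto simp: X0_iff)
  note int3 = integrable_D_mult[OF assms]
  have 1: "integrable (lebesgue_on \<Omega>) (\<lambda>x. (u x + t * v x)\<^sup>2)"
  proof (rule Bochner_Integration.integrable_bound)
    show "integrable (lebesgue_on \<Omega>) (\<lambda>x. 2 * (u x)\<^sup>2 + 2 * t\<^sup>2 * (v x)\<^sup>2)"
      using assms by (auto simp: X0_iff)
    show "(\<lambda>x. (u x + t * v x)\<^sup>2) \<in> borel_measurable (lebesgue_on \<Omega>)"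
      using assms by (intro measurable_restrict_space1) (auto simp: X0_iff)
    have "(a + t * b)\<^sup>2 \<le> 2 * a\<^sup>2 + 2 * t\<^sup>2 * b\<^sup>2" for a b :: real
      using zero_le_power2[of "a - t * b"] by (simp add: power2_eq_square algebra_simps)
    then show "AE x in lebesgue_on \<Omega>. norm ((u x + t * v x)\<^sup>2) \<le> norm (2 * (u x)\<^sup>2 + 2 * t\<^sup>2 * (v x)\<^sup>2)"
      by (simp add: abs_of_nonneg)
  qed
  have 2: "AE x in lebesgue. x \<notin> \<Omega> \<longrightarrow> u x + t * v x = 0"
  proof -
    have "AE x in lebesgue. x \<notin> \<Omega> \<longrightarrow> u x = 0" "AE x in lebesgue. x \<notin> \<Omega> \<longrightarrow> v x = 0"
      using assms by (auto simp: X0_iff)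
    then show ?thesis by eventually_elim simp
  qed
  show "(\<lambda>x. u x + t * v x) \<in> X0"
    unfolding X0_iff sq using assms int int3 1 2 by (auto simp: X0_iff)
  show "(nrm (\<lambda>x. u x + t * v x))\<^sup>2 = (nrm u)\<^sup>2 + 2 * t * X0_inner K \<Omega> u v + t\<^sup>2 * (nrm v)\<^sup>2"
    unfolding nrm_sq sq inner_eq using int int3 by simp
qed

text \<open>
  This takes the place of the triangle inequality; it is the integrated form of Young's inequality
  \<open>(x + y)\<^sup>2 \<le> (1 + \<delta>) * x\<^sup>2 + (1 + 1 / \<delta>) * y\<^sup>2\<close>.
\<close>

lemma nrm_sq_le_of_close:
  assumes "u \<in> X0" "v \<in> X0" and \<delta>: "0 < \<delta>"
  shows "(nrm v)\<^sup>2 \<le> (1 + \<delta>) * (nrm u)\<^sup>2 + (1 + 1 / \<delta>) * (nrm (\<lambda>x. v x - u x))\<^sup>2"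
proof -
  have w: "(\<lambda>x. v x - u x) \<in> X0" using X0_add_mult(1)[OF assms(2,1), of "-1"] by simp
  have int: "integrable MQ (\<lambda>z. (D u z)\<^sup>2)" "integrable MQ (\<lambda>z. (D v z)\<^sup>2)" "integrable MQ (\<lambda>z. (D (\<lambda>x. v x - u x) z)\<^sup>2)"
    using assms w by (auto simp: X0_iff)
  have "(nrm v)\<^sup>2 \<le> (\<integral>z. (1 + \<delta>) * (D u z)\<^sup>2 + (1 + 1 / \<delta>) * (D (\<lambda>x. v x - u x) z)\<^sup>2 \<partial>MQ)"
    unfolding nrm_sq
  proof (intro integral_mono)
    fix z
    have "0 \<le> (\<delta> * D u z - (D v z - D u z))\<^sup>2 / \<delta>" using \<delta> by simp
    also have "\<dots> = (1 + \<delta>) * (D u z)\<^sup>2 + (1 + 1 / \<delta>) * (D v z - D u z)\<^sup>2 - (D v z)\<^sup>2"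
      using \<delta> by (simp add: power2_eq_square field_simps)
    finally show "(D v z)\<^sup>2 \<le> (1 + \<delta>) * (D u z)\<^sup>2 + (1 + 1 / \<delta>) * (D (\<lambda>x. v x - u x) z)\<^sup>2"
      by (simp add: D_diff)
  qed (use int in auto)
  also have "\<dots> = (1 + \<delta>) * (nrm u)\<^sup>2 + (1 + 1 / \<delta>) * (nrm (\<lambda>x. v x - u x))\<^sup>2"
    unfolding nrm_sq using int by simp
  finally show ?thesis .
qed

lemma nn_nrm_sq:
  assumes "u \<in> X0"
  shows "ennreal ((nrm u)\<^sup>2) = (\<integral>\<^sup>+z. ennreal ((D u z)\<^sup>2) \<partial>MQ)"
  unfolding nrm_sq using assms by (subst nn_integral_eq_integral) (auto simp: X0_iff)

text \<open>
  Passing to a Borel function that vanishes identically outside \<open>\<Omega>\<close> turns the double integral over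
  \<open>Q_set \<Omega>\<close> into one over the whole product, where the lower bound on the kernel compares it with the
  Gagliardo seminorm.
\<close>

lemma borel_representative:
  assumes u: "u \<in> X0"
  obtains v where "v \<in> borel_measurable borel" "\<And>x. x \<notin> \<Omega> \<Longrightarrow> v x = 0"
    "AE x in lebesgue. u x = v x" "gagliardo s v \<le> ennreal ((nrm u)\<^sup>2 / \<beta>)"
proof -
  have um: "u \<in> borel_measurable lebesgue" using u by (simp add: X0_iff)
  obtain u' where u'[measurable]: "u' \<in> borel_measurable borel" and "AE x in lborel. u x = u' x"
    using completion_ex_borel_measurable_real[OF um] by auto
  then have ae1: "AE x in lebesgue. u x = u' x" by (simp add: AE_lebesgue_iff)
  define v where "v = (\<lambda>x. u' x * indicator \<Omega> x)"
  have v[measurable]: "v \<in> borel_measurable borel" unfolding v_def by measurable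
  have ae: "AE x in lebesgue. u x = v x"
  proof -
    have "AE x in lebesgue. x \<notin> \<Omega> \<longrightarrow> u x = 0" using u by (simp add: X0_iff)
    with ae1 show ?thesis by eventually_elim (auto simp: v_def indicator_def)
  qed
  let ?g = "\<lambda>z. ennreal ((v (fst z) - v (snd z))\<^sup>2 * dist (fst z) (snd z) powr (- (real DIM('a) + 2 * s)))"
  have "gagliardo s v = (\<integral>\<^sup>+z. ?g z \<partial>lborel)"
    unfolding gagliardo_def
  proof (subst nn_integral_lborel_pair(1))
    have "continuous_on UNIV (\<lambda>z::'a \<times> 'a. dist (fst z) (snd z))" by (intro continuous_intros)
    note [measurable] = borel_measurable_continuous_onI[OF this] borel_measurable_pair[OF v]
    show "?g \<in> borel_measurable borel" by measurable
  qed simp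
  also have "\<dots> = (\<integral>\<^sup>+z. ?g z \<partial>lebesgue)" by (simp add: nn_integral_completion)
  also have "\<dots> \<le> (\<integral>\<^sup>+z. ennreal (1 / \<beta>) * (ennreal ((D u z)\<^sup>2) * indicator (Q_set \<Omega>) z) \<partial>lebesgue)"
  proof (rule nn_integral_mono_AE)
    show "AE z in lebesgue. ?g z \<le> ennreal (1 / \<beta>) * (ennreal ((D u z)\<^sup>2) * indicator (Q_set \<Omega>) z)"
      using AE_lebesgue_pair(1)[OF ae] AE_lebesgue_pair(2)[OF ae]
    proof eventually_elim
      case (elim z)
      show ?case
      proof (cases "z \<in> Q_set \<Omega> \<and> fst z \<noteq> snd z")
        case True
        have "dist (fst z) (snd z) powr (- (real DIM('a) + 2 * s)) \<le> K (fst z - snd z) / \<beta>"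
          using K_lower[of "fst z - snd z"] True \<beta> by (simp add: dist_norm field_simps)
        then have "(v (fst z) - v (snd z))\<^sup>2 * dist (fst z) (snd z) powr (- (real DIM('a) + 2 * s))
            \<le> (v (fst z) - v (snd z))\<^sup>2 * (K (fst z - snd z) / \<beta>)"
          by (rule mult_left_mono) simp
        also have "\<dots> = 1 / \<beta> * (D u z)\<^sup>2"
          by (simp add: power2_eq_square D_mult elim)
        finally show ?thesis using True \<beta> by (simp add: ennreal_leI flip: ennreal_mult)
      next
        case False
        then have "v (fst z) = v (snd z)" by (auto simp: Q_set_eq v_def)
        then show ?thesis by simp
      qed
    qed
  qed
  also have "\<dots> = ennreal (1 / \<beta>) * (\<integral>\<^sup>+z. ennreal ((D u z)\<^sup>2) * indicator (Q_set \<Omega>) z \<partial>lebesgue)"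
  proof (intro nn_integral_cmult borel_measurable_times_ennreal borel_measurable_indicator)
    show "(\<lambda>z. ennreal ((D u z)\<^sup>2)) \<in> borel_measurable lebesgue" using D_measurable[OF um] by simp
    show "Q_set \<Omega> \<in> sets lebesgue" by (rule Q_lebesgue)
  qed
  also have "(\<integral>\<^sup>+z. ennreal ((D u z)\<^sup>2) * indicator (Q_set \<Omega>) z \<partial>lebesgue) = (\<integral>\<^sup>+z. ennreal ((D u z)\<^sup>2) \<partial>MQ)"
    by (subst nn_integral_restrict_space) auto
  also have "\<dots> = ennreal ((nrm u)\<^sup>2)" by (simp add: nn_nrm_sq[OF u])
  also have "ennreal (1 / \<beta>) * \<dots> = ennreal ((nrm u)\<^sup>2 / \<beta>)"
    using \<beta> by (simp flip: ennreal_mult)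
  finally show ?thesis using that[OF v _ ae] by (simp add: v_def)
qed

lemma AE_lebesgue_on_\<Omega>: "AE x in lebesgue. P x \<Longrightarrow> AE x in lebesgue_on \<Omega>. P x"
  by (subst AE_restrict_space_iff) (simp_all add: \<Omega>_lebesgue, erule eventually_mono, simp)

lemma sobolev_nn:
  assumes p: "0 < p" "p < crit_exp DIM('a) s"
  obtains C where "0 < C" "\<And>u. u \<in> X0 \<Longrightarrow>
    (\<integral>\<^sup>+x. ennreal (\<bar>u x\<bar> powr p) \<partial>lebesgue_on \<Omega>) \<le> ennreal (C * nrm u powr p)"
proof (rule fractional_sobolev[OF s \<Omega>_borel \<Omega>_fin p])
  fix C :: real assume C: "0 < C" and
    C2: "\<And>(u :: 'a \<Rightarrow> real) (E :: real). \<lbrakk>u \<in> borel_measurable borel; \<And>x. x \<notin> \<Omega> \<Longrightarrow> u x = 0; gagliardo s u \<le> ennreal E; 0 < E\<rbrakk>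
      \<Longrightarrow> (\<integral>\<^sup>+x. ennreal (\<bar>u x\<bar> powr p) \<partial>lborel) \<le> ennreal (C * E powr (p / 2))"
  define C' where "C' = C * (1 / \<beta>) powr (p / 2)"
  show thesis
  proof (rule that[of C'])
    show "0 < C'" using C \<beta> by (simp add: C'_def)
    fix u assume u: "u \<in> X0"
    obtain v where v: "v \<in> borel_measurable borel" "\<And>x. x \<notin> \<Omega> \<Longrightarrow> v x = 0"
      "AE x in lebesgue. u x = v x" "gagliardo s v \<le> ennreal ((nrm u)\<^sup>2 / \<beta>)"
      using borel_representative[OF u] by blast
    let ?I = "\<integral>\<^sup>+x. ennreal (\<bar>u x\<bar> powr p) \<partial>lebesgue_on \<Omega>"
    have "?I = (\<integral>\<^sup>+x. ennreal (\<bar>u x\<bar> powr p) * indicator \<Omega> x \<partial>lebesgue)"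
      by (subst nn_integral_restrict_space) auto
    also have "\<dots> \<le> (\<integral>\<^sup>+x. ennreal (\<bar>v x\<bar> powr p) \<partial>lebesgue)"
      by (rule nn_integral_mono_AE) (use v(3) in eventually_elim, simp add: indicator_def)
    also have "\<dots> = (\<integral>\<^sup>+x. ennreal (\<bar>v x\<bar> powr p) \<partial>lborel)" by (simp add: nn_integral_completion)
    finally have I: "?I \<le> ennreal (C * E powr (p / 2))" if "(nrm u)\<^sup>2 / \<beta> \<le> E" "0 < E" for E
      using C2[OF v(1,2) order_trans[OF v(4) ennreal_leI[OF that(1)]] that(2)] by (rule order_trans)
    show "?I \<le> ennreal (C' * nrm u powr p)"
    proof (cases "nrm u = 0")
      case False
      then have n: "0 < nrm u" using nrm_nonneg[of u] by simp
      have "((nrm u)\<^sup>2 / \<beta>) powr (p / 2) = (1 / \<beta>) powr (p / 2) * ((nrm u)\<^sup>2) powr (p / 2)"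
        using \<beta> n by (simp add: powr_divide)
      also have "((nrm u)\<^sup>2) powr (p / 2) = nrm u powr p"
      proof -
        have "(nrm u)\<^sup>2 = nrm u powr 2" using n by simp
        then show ?thesis by (simp only: powr_powr) simp
      qed
      finally show ?thesis using I[OF order_refl] n \<beta> by (simp add: C'_def mult_ac)
    next
      case True
      \<comment> \<open>if the norm vanishes, the bound holds for every positive energy \<open>E\<close>; the one chosen here makes it equal to \<open>e\<close>\<close>
      have eps: "?I \<le> 0 + ennreal e" if e: "0 < e" for e
      proof -
        have "?I \<le> ennreal (C * ((e / C) powr (2 / p)) powr (p / 2))"
          using e C by (intro I) (auto simp: True)
        also have "((e / C) powr (2 / p)) powr (p / 2) = e / C"
          using p e C by (simp add: powr_powr)
        finally show ?thesis using C by simp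
      qed
      have "?I \<le> 0" by (rule ennreal_le_epsilon) (rule eps)
      then show ?thesis by simp
    qed
  qed
qed

lemma sobolev:
  assumes p: "0 < p" "p < crit_exp DIM('a) s"
  obtains C where "0 < C" "\<And>u. u \<in> X0 \<Longrightarrow> integrable (lebesgue_on \<Omega>) (\<lambda>x. \<bar>u x\<bar> powr p)"
    "\<And>u. u \<in> X0 \<Longrightarrow> (\<integral>x. \<bar>u x\<bar> powr p \<partial>lebesgue_on \<Omega>) \<le> C * nrm u powr p"
proof (rule sobolev_nn[OF p])
  fix C :: real assume C: "0 < C" and
    C2: "\<And>u. u \<in> X0 \<Longrightarrow> (\<integral>\<^sup>+x. ennreal (\<bar>u x\<bar> powr p) \<partial>lebesgue_on \<Omega>) \<le> ennreal (C * nrm u powr p)"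
  have int: "integrable (lebesgue_on \<Omega>) (\<lambda>x. \<bar>u x\<bar> powr p)" if "u \<in> X0" for u
  proof (rule integrableI_bounded)
    have "u \<in> borel_measurable (lebesgue_on \<Omega>)"
      using that by (auto simp: X0_iff intro: measurable_restrict_space1)
    then show "(\<lambda>x. \<bar>u x\<bar> powr p) \<in> borel_measurable (lebesgue_on \<Omega>)" by simp
    show "(\<integral>\<^sup>+ x. ennreal (norm (\<bar>u x\<bar> powr p)) \<partial>lebesgue_on \<Omega>) < \<infinity>"
      using le_less_trans[OF C2[OF that] ennreal_less_top] by simp
  qed
  have "(\<integral>x. \<bar>u x\<bar> powr p \<partial>lebesgue_on \<Omega>) \<le> C * nrm u powr p" if "u \<in> X0" for u
  proof -
    have "ennreal (\<integral>x. \<bar>u x\<bar> powr p \<partial>lebesgue_on \<Omega>) \<le> ennreal (C * nrm u powr p)"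
      using C2[OF that] nn_integral_eq_integral[OF int[OF that]] by simp
    then show ?thesis using C by simp
  qed
  then show thesis using that[OF C int] by blast
qed

text \<open>
  Two degenerate cases matter: a function of norm \<open>0\<close> vanishes almost everywhere, so that no quotient
  in the supremum has denominator \<open>0\<close>; and the supremum is finite, so that passing to a real number
  does not lose its value.
\<close>

lemma emb_const_bound:
  assumes q: "0 < q" "q < crit_exp DIM('a) s" and u: "u \<in> X0"
  shows "(\<integral>\<^sup>+x. ennreal (\<bar>u x\<bar> powr q) \<partial>lebesgue_on \<Omega>) \<le> ennreal (emb_const K \<Omega> q * nrm u powr q)"
proof (rule sobolev_nn[OF q])
  fix C :: real assume C: "0 < C" and
    C2: "\<And>u. u \<in> X0 \<Longrightarrow> (\<integral>\<^sup>+x. ennreal (\<bar>u x\<bar> powr q) \<partial>lebesgue_on \<Omega>) \<le> ennreal (C * nrm u powr q)"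
  let ?I = "\<lambda>u. \<integral>\<^sup>+x. ennreal (\<bar>u x\<bar> powr q) \<partial>lebesgue_on \<Omega>"
  let ?S = "{u \<in> X0. \<not> (AE x in lebesgue. u x = 0)}"
  have zero: "AE x in lebesgue. u x = 0" if "u \<in> X0" "nrm u = 0" for u
  proof -
    have "u \<in> borel_measurable (lebesgue_on \<Omega>)"
      using that by (auto simp: X0_iff intro: measurable_restrict_space1)
    moreover have "?I u = 0" using C2[OF that(1)] that(2) by simp
    ultimately have "AE x in lebesgue_on \<Omega>. ennreal (\<bar>u x\<bar> powr q) = 0"
      by (subst (asm) nn_integral_0_iff_AE) auto
    then have "AE x in lebesgue. x \<in> \<Omega> \<longrightarrow> u x = 0"
      by (subst (asm) AE_restrict_space_iff) (auto elim: eventually_mono)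
    moreover have "AE x in lebesgue. x \<notin> \<Omega> \<longrightarrow> u x = 0" using that by (simp add: X0_iff)
    ultimately show ?thesis by eventually_elim blast
  qed
  have quot: "?I u / ennreal (nrm u powr q) \<le> ennreal C" if "u \<in> ?S" for u
  proof -
    have n: "0 < nrm u" using that zero[of u] nrm_nonneg[of u] by (cases "nrm u = 0") auto
    have "?I u / ennreal (nrm u powr q) \<le> ennreal (C * nrm u powr q) / ennreal (nrm u powr q)"
      using C2[of u] that by (intro divide_right_mono_ennreal) auto
    also have "\<dots> = ennreal C" using n C by (simp add: divide_ennreal)
    finally show ?thesis .
  qed
  define S where "S = (SUP u\<in>?S. ?I u / ennreal (nrm u powr q))"
  have "S \<le> ennreal C" unfolding S_def using quot by (intro SUP_least) auto
  then have S: "S = ennreal (emb_const K \<Omega> q)"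
    by (auto simp: emb_const_def S_def[symmetric] ennreal_enn2real_if top_unique)
  show ?thesis
  proof (cases "nrm u = 0")
    case True
    then show ?thesis using C2[OF u] by simp
  next
    case False
    then have n: "0 < nrm u" using nrm_nonneg[of u] by simp
    show ?thesis
    proof (cases "AE x in lebesgue. u x = 0")
      case True
      from AE_lebesgue_on_\<Omega>[OF this] have "?I u = (\<integral>\<^sup>+x. 0 \<partial>lebesgue_on \<Omega>)"
        by (intro nn_integral_cong_AE) (auto elim: eventually_mono)
      then show ?thesis by simp
    next
      case False
      then have "?I u / ennreal (nrm u powr q) \<le> S"
        unfolding S_def using u by (intro SUP_upper) auto
      then have "?I u / ennreal (nrm u powr q) * ennreal (nrm u powr q) \<le> S * ennreal (nrm u powr q)"
        by (rule mult_right_mono) simp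
      moreover have "?I u / ennreal (nrm u powr q) * ennreal (nrm u powr q) = ?I u"
        using n by (simp add: ennreal_divide_times ennreal_divide_self flip: ennreal_times_divide)
      ultimately show ?thesis by (simp add: S emb_const_def flip: ennreal_mult)
    qed
  qed
qed

end

section \<open>Closedness and compactness in the energy space\<close>

lemma fatou_square:
  fixes f :: "nat \<Rightarrow> 'a \<Rightarrow> real"
  assumes f[measurable]: "\<And>n. f n \<in> borel_measurable M" and g[measurable]: "g \<in> borel_measurable M"
    and lim: "AE x in M. (\<lambda>n. f n x) \<longlonglongrightarrow> g x"
    and int: "\<And>n. integrable M (\<lambda>x. (f n x)\<^sup>2)" and le: "\<And>n. (\<integral>x. (f n x)\<^sup>2 \<partial>M) \<le> c"
  shows "integrable M (\<lambda>x. (g x)\<^sup>2)" "(\<integral>x. (g x)\<^sup>2 \<partial>M) \<le> c"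
proof -
  have "0 \<le> (\<integral>x. (f 0 x)\<^sup>2 \<partial>M)" by simp
  with le[of 0] have c: "0 \<le> c" by linarith
  have "(\<integral>\<^sup>+x. ennreal ((g x)\<^sup>2) \<partial>M) \<le> (\<integral>\<^sup>+x. liminf (\<lambda>n. ennreal ((f n x)\<^sup>2)) \<partial>M)"
  proof (rule nn_integral_mono_AE)
    show "AE x in M. ennreal ((g x)\<^sup>2) \<le> liminf (\<lambda>n. ennreal ((f n x)\<^sup>2))"
      using lim
    proof eventually_elim
      case (elim x)
      have "(\<lambda>n. ennreal ((f n x)\<^sup>2)) \<longlonglongrightarrow> ennreal ((g x)\<^sup>2)"
        by (intro tendsto_ennrealI tendsto_intros elim)
      from lim_imp_Liminf[OF _ this] show ?case by simp
    qed
  qed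
  also have "\<dots> \<le> liminf (\<lambda>n. \<integral>\<^sup>+x. ennreal ((f n x)\<^sup>2) \<partial>M)"
    by (rule nn_integral_liminf) simp
  also have "\<dots> \<le> liminf (\<lambda>n. ennreal c)"
    using le int by (intro Liminf_mono always_eventually) (auto simp: nn_integral_eq_integral ennreal_leI)
  also have "\<dots> = ennreal c" by (simp add: Liminf_const)
  finally have le: "(\<integral>\<^sup>+x. ennreal ((g x)\<^sup>2) \<partial>M) \<le> ennreal c" .
  show *: "integrable M (\<lambda>x. (g x)\<^sup>2)"
    using le_less_trans[OF le ennreal_less_top] by (intro integrableI_bounded) auto
  show "(\<integral>x. (g x)\<^sup>2 \<partial>M) \<le> c"
    using le c by (subst (asm) nn_integral_eq_integral[OF *]) auto
qed

context fractional_kernel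
begin

text \<open>
  Sublevel sets of the norm are closed under almost everywhere convergence, by Fatou's lemma on
  \<open>Q_set \<Omega>\<close>. Together with the compactness lemma below, this replaces weak compactness and weak lower
  semicontinuity of the norm.
\<close>

lemma X0_limit:
  assumes u: "\<And>n. u n \<in> X0" and v: "v \<in> borel_measurable lebesgue"
    and lim: "AE x in lebesgue. (\<lambda>n. u n x) \<longlonglongrightarrow> v x" and le: "\<And>n. (nrm (u n))\<^sup>2 \<le> c"
  shows "v \<in> X0" "(nrm v)\<^sup>2 \<le> c"
proof -
  have um: "u n \<in> borel_measurable lebesgue" for n using u[of n] by (simp add: X0_iff)
  have limD: "AE z in MQ. (\<lambda>n. D (u n) z) \<longlonglongrightarrow> D v z"
  proof (subst AE_restrict_space_iff)
    show "AE z in lebesgue. z \<in> Q_set \<Omega> \<longrightarrow> (\<lambda>n. D (u n) z) \<longlonglongrightarrow> D v z"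
      using AE_lebesgue_pair(1)[OF lim] AE_lebesgue_pair(2)[OF lim]
      by eventually_elim (auto simp: weighted_diff_def intro!: tendsto_intros)
  qed (simp add: Q_lebesgue)
  have intD: "integrable MQ (\<lambda>z. (D (u n) z)\<^sup>2)" for n using u[of n] by (simp add: X0_iff)
  note D = fatou_square[OF D_measurable_Q[OF um] D_measurable_Q[OF v] limD intD le[unfolded nrm_sq]]
  show "(nrm v)\<^sup>2 \<le> c" unfolding nrm_sq by (rule D(2))
  have p2: "\<bar>x\<bar> powr 2 = x\<^sup>2" for x :: real by (cases "x = 0") auto
  have crit: "2 < crit_exp DIM('a) s" using s by (simp add: crit_exp_def field_simps)
  obtain C where C: "0 < C" "\<And>u. u \<in> X0 \<Longrightarrow> (\<integral>x. \<bar>u x\<bar> powr 2 \<partial>lebesgue_on \<Omega>) \<le> C * nrm u powr 2"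
    using sobolev[OF _ crit] by (metis zero_less_numeral)
  have L2: "(\<integral>x. (u n x)\<^sup>2 \<partial>lebesgue_on \<Omega>) \<le> C * c" for n
  proof -
    have "(\<integral>x. (u n x)\<^sup>2 \<partial>lebesgue_on \<Omega>) \<le> C * (nrm (u n))\<^sup>2"
      using C(2)[OF u[of n]] p2[of "nrm (u n)"] by (simp add: p2 nrm_nonneg)
    also have "\<dots> \<le> C * c" using le[of n] C(1) by (intro mult_left_mono) auto
    finally show ?thesis .
  qed
  have "integrable (lebesgue_on \<Omega>) (\<lambda>x. (v x)\<^sup>2)"
    by (rule fatou_square(1)[OF measurable_restrict_space1[OF um] measurable_restrict_space1[OF v] AE_lebesgue_on_\<Omega>[OF lim] _ L2])
      (use u in \<open>simp add: X0_iff\<close>)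
  moreover have "AE x in lebesgue. x \<notin> \<Omega> \<longrightarrow> v x = 0"
  proof -
    have "AE x in lebesgue. \<forall>n. x \<notin> \<Omega> \<longrightarrow> u n x = 0"
      unfolding AE_all_countable using u by (simp add: X0_iff)
    with lim show ?thesis
    proof eventually_elim
      case (elim x)
      show ?case
      proof
        assume "x \<notin> \<Omega>"
        then have "(\<lambda>n. u n x) = (\<lambda>_. 0)" using elim by auto
        then show "v x = 0" using elim(1) by (simp add: LIMSEQ_const_iff)
      qed
    qed
  qed
  ultimately show "v \<in> X0" unfolding X0_iff using v D(1) by blast
qed

lemma X0_compact:
  assumes u: "\<And>n. u n \<in> X0" and le: "\<And>n. (nrm (u n))\<^sup>2 \<le> c"
  obtains r v where "strict_mono (r :: nat \<Rightarrow> nat)" "v \<in> X0"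
    "AE x in lebesgue. (\<lambda>n. u (r n) x) \<longlonglongrightarrow> v x"
proof -
  have "\<exists>w. w \<in> borel_measurable borel \<and> (\<forall>x. x \<notin> \<Omega> \<longrightarrow> w x = 0) \<and>
    (AE x in lebesgue. u n x = w x) \<and> gagliardo s w \<le> ennreal (c / \<beta>)" for n
  proof -
    obtain w where w: "w \<in> borel_measurable borel" "\<And>x. x \<notin> \<Omega> \<Longrightarrow> w x = 0"
      "AE x in lebesgue. u n x = w x" "gagliardo s w \<le> ennreal ((nrm (u n))\<^sup>2 / \<beta>)"
      using borel_representative[OF u[of n]] by blast
    have "ennreal ((nrm (u n))\<^sup>2 / \<beta>) \<le> ennreal (c / \<beta>)"
      using le[of n] \<beta> by (intro ennreal_leI divide_right_mono) auto
    then show ?thesis using w order_trans by blast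
  qed
  then obtain w where w: "\<And>n. w n \<in> borel_measurable borel" "\<And>n x. x \<notin> \<Omega> \<Longrightarrow> w n x = 0"
    "\<And>n. AE x in lebesgue. u n x = w n x" "\<And>n. gagliardo s (w n) \<le> ennreal (c / \<beta>)"
    by metis
  obtain r where r: "strict_mono (r :: nat \<Rightarrow> nat)" "AE x in lborel. convergent (\<lambda>n. w (r n) x)"
    by (rule fractional_rellich[OF s \<Omega>_borel \<Omega>(2) w(1) w(2) w(4)]) (assumption, rule that)
  define v where "v = (\<lambda>x. lim (\<lambda>n. w (r n) x))"
  have v: "v \<in> borel_measurable lebesgue"
    unfolding v_def using w(1) by (intro measurable_completion) (simp add: borel_measurable_lim_metric)
  have "AE x in lebesgue. \<forall>n. u (r n) x = w (r n) x"
    unfolding AE_all_countable using w(3) by simp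
  moreover have "AE x in lebesgue. convergent (\<lambda>n. w (r n) x)"
    using r(2) by (simp add: AE_lebesgue_iff)
  ultimately have lim: "AE x in lebesgue. (\<lambda>n. u (r n) x) \<longlonglongrightarrow> v x"
    by eventually_elim (simp add: v_def convergent_LIMSEQ_iff)
  show ?thesis
    using that[OF r(1) X0_limit(1)[OF u v lim le] lim] .
qed

text \<open>
  A cone over a small ball is Lipschitz with compact support; the integrability of
  \<open>min (\<bar>x\<bar>\<^sup>2) 1 * K x\<close> is what makes its energy finite, so the energy space contains a nonzero function.
\<close>

lemma emb_const_pos:
  assumes "\<Omega> \<noteq> {}" and q: "0 < q" "q < crit_exp DIM('a) s"
  shows "0 < emb_const K \<Omega> q"
proof -
  obtain x0 where "x0 \<in> \<Omega>" using assms(1) by blast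
  then obtain \<rho> where x0: "0 < \<rho>" "ball x0 \<rho> \<subseteq> \<Omega>"
    using \<Omega>(1) openE by blast
  define w where "w = (\<lambda>x. max 0 (\<rho> - dist x x0))"
  have wm: "w \<in> borel_measurable borel"
    unfolding w_def by (intro borel_measurable_continuous_onI continuous_intros)
  then have wl: "w \<in> borel_measurable lebesgue" by (intro measurable_completion) simp
  have w0: "w x = 0" if "x \<notin> \<Omega>" for x
  proof -
    have "x \<notin> ball x0 \<rho>" using that x0(2) by blast
    then show ?thesis by (simp add: w_def dist_commute)
  qed
  have wb: "0 \<le> w x" "w x \<le> \<rho>" for x using x0(1) by (auto simp: w_def)
  have wlip: "\<bar>w x - w y\<bar> \<le> norm (x - y)" for x y
    using dist_triangle[of x x0 y] dist_triangle[of y x0 x] by (auto simp: w_def dist_norm norm_minus_commute)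
  define W where "W = (\<lambda>x::'a. min ((norm x)\<^sup>2) 1 * K x)"
  obtain W' where W'[measurable]: "W' \<in> borel_measurable borel" and "AE x in lborel. W x = W' x"
    using completion_ex_borel_measurable_real[OF borel_measurable_integrable[OF K_int[folded W_def]]] by auto
  then have WW: "AE x in lebesgue. W x = W' x" by (simp add: AE_lebesgue_iff)
  define c where "c = max 1 (\<rho>\<^sup>2)"
  have c: "0 \<le> c" by (simp add: c_def)
  have Dw: "(D w z)\<^sup>2 \<le> c * W (fst z - snd z)" for z
  proof (cases "fst z = snd z")
    case False
    let ?d = "norm (fst z - snd z)"
    have a: "(w (fst z) - w (snd z))\<^sup>2 \<le> ?d\<^sup>2"
      using power_mono[OF wlip[of "fst z" "snd z"] abs_ge_zero, of 2] by simp
    have b: "(w (fst z) - w (snd z))\<^sup>2 \<le> \<rho>\<^sup>2"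
    proof -
      have "\<bar>w (fst z) - w (snd z)\<bar> \<le> \<rho>" using wb[of "fst z"] wb[of "snd z"] by linarith
      from power_mono[OF this abs_ge_zero, of 2] show ?thesis by simp
    qed
    have "(w (fst z) - w (snd z))\<^sup>2 \<le> c * min (?d\<^sup>2) 1"
    proof (cases "?d\<^sup>2 \<le> 1")
      case True
      have "1 * ?d\<^sup>2 \<le> c * ?d\<^sup>2" by (intro mult_right_mono) (auto simp: c_def)
      then show ?thesis using a True by simp
    next
      case False
      then show ?thesis using b by (simp add: c_def)
    qed
    then have "(w (fst z) - w (snd z))\<^sup>2 * K (fst z - snd z) \<le> c * min (?d\<^sup>2) 1 * K (fst z - snd z)"
      using K_pos[of "fst z - snd z"] False by (intro mult_right_mono) auto
    then show ?thesis unfolding power2_eq_square[of "D w z"] D_mult by (simp add: W_def power2_eq_square mult.assoc)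
  qed (simp add: weighted_diff_def W_def)
  define I where "I = (\<integral>\<^sup>+x. ennreal (W' x) \<partial>lborel)"
  have I: "I < \<infinity>"
  proof -
    have "I = (\<integral>\<^sup>+x. ennreal (W' x) \<partial>lebesgue)" by (simp add: I_def nn_integral_completion)
    also have "\<dots> = (\<integral>\<^sup>+x. ennreal (W x) \<partial>lebesgue)"
      by (rule nn_integral_cong_AE) (use WW in eventually_elim, simp)
    also have "\<dots> \<le> (\<integral>\<^sup>+x. ennreal (norm (W x)) \<partial>lebesgue)"
      by (intro nn_integral_mono ennreal_leI) simp
    also have "\<dots> < \<infinity>" using K_int[folded W_def] by (simp add: integrable_iff_bounded)
    finally show ?thesis .
  qed
  let ?k = "\<lambda>z. ennreal (W' (fst z - snd z))"
  have km[measurable]: "?k \<in> borel_measurable borel"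
    using borel_measurable_pair(3)[OF W'] by simp
  have im: "(\<lambda>z::'a \<times> 'a. indicator \<Omega> (fst z) :: ennreal) \<in> borel_measurable borel" "(\<lambda>z::'a \<times> 'a. indicator \<Omega> (snd z) :: ennreal) \<in> borel_measurable borel"
    using borel_measurable_pair(1,2)[of "indicator \<Omega> :: 'a \<Rightarrow> ennreal"] by simp_all
  note [measurable] = im
  have "(\<integral>\<^sup>+z. ennreal ((D w z)\<^sup>2) \<partial>MQ) = (\<integral>\<^sup>+z. ennreal ((D w z)\<^sup>2) * indicator (Q_set \<Omega>) z \<partial>lebesgue)"
    by (subst nn_integral_restrict_space) (auto simp: Q_lebesgue)
  also have "\<dots> \<le> (\<integral>\<^sup>+z. ennreal c * (indicator \<Omega> (fst z) * ?k z + indicator \<Omega> (snd z) * ?k z) \<partial>lebesgue)"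
  proof (rule nn_integral_mono_AE)
    show "AE z in lebesgue. ennreal ((D w z)\<^sup>2) * indicator (Q_set \<Omega>) z \<le> ennreal c * (indicator \<Omega> (fst z) * ?k z + indicator \<Omega> (snd z) * ?k z)"
      using AE_lebesgue_pair(3)[OF WW]
    proof eventually_elim
      case (elim z)
      have "ennreal ((D w z)\<^sup>2) \<le> ennreal c * ?k z"
        using Dw[of z] c by (simp add: elim ennreal_leI flip: ennreal_mult')
      then show ?case
        by (auto simp: Q_set_eq indicator_def distrib_left intro: add_increasing2)
    qed
  qed
  also have "\<dots> = (\<integral>\<^sup>+z. ennreal c * (indicator \<Omega> (fst z) * ?k z + indicator \<Omega> (snd z) * ?k z) \<partial>lborel)"
    by (rule nn_integral_completion)
  also have "\<dots> = ennreal c * ((\<integral>\<^sup>+z. indicator \<Omega> (fst z) * ?k z \<partial>lborel) + (\<integral>\<^sup>+z. indicator \<Omega> (snd z) * ?k z \<partial>lborel))"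
    using km im by (subst nn_integral_cmult) (auto simp: nn_integral_add)
  also have "(\<integral>\<^sup>+z. indicator \<Omega> (fst z) * ?k z \<partial>lborel) = emeasure lborel \<Omega> * I"
  proof -
    have "(\<integral>\<^sup>+z. indicator \<Omega> (fst z) * ?k z \<partial>lborel) = (\<integral>\<^sup>+x. \<integral>\<^sup>+y. indicator \<Omega> x * ennreal (W' (x - y)) \<partial>lborel \<partial>lborel)"
      using km im by (subst nn_integral_lborel_pair(1)) auto
    also have "\<dots> = (\<integral>\<^sup>+x. indicator \<Omega> x * I \<partial>lborel)"
      unfolding I_def by (subst nn_integral_cmult) (auto simp: nn_integral_lborel_reflect[of "\<lambda>x. ennreal (W' x)"])
    also have "\<dots> = emeasure lborel \<Omega> * I" by (subst nn_integral_multc) auto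
    finally show ?thesis .
  qed
  also have "(\<integral>\<^sup>+z. indicator \<Omega> (snd z) * ?k z \<partial>lborel) = emeasure lborel \<Omega> * I"
  proof -
    have "(\<integral>\<^sup>+z. indicator \<Omega> (snd z) * ?k z \<partial>lborel) = (\<integral>\<^sup>+y. \<integral>\<^sup>+x. indicator \<Omega> y * ennreal (W' (x - y)) \<partial>lborel \<partial>lborel)"
      using km im by (subst nn_integral_lborel_pair(2)) auto
    also have "\<dots> = (\<integral>\<^sup>+y. indicator \<Omega> y * I \<partial>lborel)"
      unfolding I_def by (subst nn_integral_cmult) (auto simp: nn_integral_lborel_translate[of "\<lambda>x. ennreal (W' x)"])
    also have "\<dots> = emeasure lborel \<Omega> * I" by (subst nn_integral_multc) auto
    finally show ?thesis .
  qed
  also have "ennreal c * (emeasure lborel \<Omega> * I + emeasure lborel \<Omega> * I) < \<infinity>"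
    using \<Omega>_fin I by (auto simp: ennreal_mult_less_top ennreal_add_less_top)
  finally have fin: "(\<integral>\<^sup>+z. ennreal ((D w z)\<^sup>2) \<partial>MQ) < \<infinity>" .
  interpret fm: finite_measure "lebesgue_on \<Omega>" by (rule finite_measure_\<Omega>)
  have "w \<in> X0"
    unfolding X0_iff
  proof (intro conjI wl)
    show "integrable MQ (\<lambda>z. (D w z)\<^sup>2)"
      using fin D_measurable_Q[OF wl] by (intro integrableI_bounded) auto
    show "integrable (lebesgue_on \<Omega>) (\<lambda>x. (w x)\<^sup>2)"
    proof (rule fm.integrable_const_bound[of _ "\<rho>\<^sup>2"])
      show "AE x in lebesgue_on \<Omega>. norm ((w x)\<^sup>2) \<le> \<rho>\<^sup>2" using wb by (simp add: power_mono)
      show "(\<lambda>x. (w x)\<^sup>2) \<in> borel_measurable (lebesgue_on \<Omega>)"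
        using wl by (intro borel_measurable_power measurable_restrict_space1)
    qed
  qed (use w0 in auto)
  from emb_const_bound[OF q this]
  have le: "(\<integral>\<^sup>+x. ennreal (\<bar>w x\<bar> powr q) \<partial>lebesgue_on \<Omega>) \<le> ennreal (emb_const K \<Omega> q * nrm w powr q)" .
  show ?thesis
  proof (rule ccontr)
    assume "\<not> ?thesis"
    then have "emb_const K \<Omega> q * nrm w powr q \<le> 0" by (simp add: mult_nonpos_nonneg)
    then have "(\<integral>\<^sup>+x. ennreal (\<bar>w x\<bar> powr q) \<partial>lebesgue_on \<Omega>) = 0"
      using le by (simp add: ennreal_neg)
    then have "AE x in lebesgue_on \<Omega>. ennreal (\<bar>w x\<bar> powr q) = 0"
      using wl by (subst (asm) nn_integral_0_iff_AE) (auto intro!: measurable_restrict_space1)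
    then have "AE x in lebesgue. x \<in> \<Omega> \<longrightarrow> w x = 0"
      by (subst (asm) AE_restrict_space_iff) (auto simp: \<Omega>_lebesgue elim: eventually_mono)
    then have "AE x in lborel. x \<notin> ball x0 \<rho>"
      unfolding AE_lebesgue_iff
    proof eventually_elim
      case (elim x)
      then show ?case using x0 by (auto simp: w_def dist_commute)
    qed
    then have "emeasure lborel (ball x0 \<rho>) = 0"
      by (subst (asm) AE_iff_measurable[of "ball x0 \<rho>"]) auto
    then show False using x0(1) emeasure_ball[of \<rho> x0] content_ball_pos[of \<rho> x0]
      by (simp add: measure_def)
  qed
qed

end

section \<open>Continuity of superposition integrals\<close>

lemma (in finite_measure) integrable_weighted_comp:
  fixes h u :: "_ \<Rightarrow> real" and G :: "real \<Rightarrow> real"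
  assumes [measurable]: "h \<in> borel_measurable M" "u \<in> borel_measurable M" "G \<in> borel_measurable borel"
    and h: "AE x in M. \<bar>h x\<bar> \<le> H" and G: "\<And>t. \<bar>G t\<bar> \<le> C * (1 + \<bar>t\<bar> powr p)"
    and u: "integrable M (\<lambda>x. \<bar>u x\<bar> powr p)"
  shows "integrable M (\<lambda>x. h x * G (u x))"
proof (rule Bochner_Integration.integrable_bound)
  show "integrable M (\<lambda>x. H * (C * (1 + \<bar>u x\<bar> powr p)))" using u by simp
  show "AE x in M. norm (h x * G (u x)) \<le> norm (H * (C * (1 + \<bar>u x\<bar> powr p)))"
    using h
  proof eventually_elim
    case (elim x)
    have "\<bar>h x * G (u x)\<bar> \<le> H * (C * (1 + \<bar>u x\<bar> powr p))"
      unfolding abs_mult using elim G by (intro mult_mono) auto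
    then show ?case by simp
  qed
qed simp

text \<open>
  Growth of order \<open>\<gamma>\<close> together with a bound in \<open>L\<^sup>p\<close> for some \<open>p > \<gamma>\<close> makes the integrands uniformly
  integrable: replacing the argument of \<open>F\<close> by its truncation at height \<open>T\<close> costs at most a multiple of
  \<open>T powr (\<gamma> - p)\<close>, uniformly in \<open>n\<close>, and for the truncated integrals dominated convergence applies.
\<close>

lemma (in finite_measure) integral_comp_tendsto:
  fixes h v :: "_ \<Rightarrow> real" and F :: "real \<Rightarrow> real" and u :: "nat \<Rightarrow> _ \<Rightarrow> real"
  assumes [measurable]: "h \<in> borel_measurable M" "\<And>n. u n \<in> borel_measurable M" "v \<in> borel_measurable M"
    and F: "continuous_on UNIV F" and h: "AE x in M. \<bar>h x\<bar> \<le> H" and "0 \<le> H"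
    and growth: "\<And>t. \<bar>F t\<bar> \<le> C * (1 + \<bar>t\<bar> powr \<gamma>)" and \<gamma>: "0 < \<gamma>" "\<gamma> < p"
    and lim: "AE x in M. (\<lambda>n. u n x) \<longlonglongrightarrow> v x"
    and u: "\<And>n. integrable M (\<lambda>x. \<bar>u n x\<bar> powr p)" "\<And>n. (\<integral>x. \<bar>u n x\<bar> powr p \<partial>M) \<le> B"
    and v: "integrable M (\<lambda>x. \<bar>v x\<bar> powr p)" "(\<integral>x. \<bar>v x\<bar> powr p \<partial>M) \<le> B"
  shows "(\<lambda>n. \<integral>x. h x * F (u n x) \<partial>M) \<longlonglongrightarrow> (\<integral>x. h x * F (v x) \<partial>M)"
proof -
  have Fm[measurable]: "F \<in> borel_measurable borel" using F by (rule borel_measurable_continuous_onI)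
  have C: "0 \<le> C" using growth[of 0] by (smt (verit) abs_ge_zero powr_ge_zero zero_le_mult_iff)
  have B: "0 \<le> B"
    using v(2) by (rule order_trans[rotated]) simp
  define cl where "cl = (\<lambda>T t::real. max (- T) (min T t))"
  have clc: "continuous_on UNIV (cl T)" for T unfolding cl_def by (intro continuous_intros)
  have clb: "\<bar>cl T t\<bar> \<le> T" if "0 \<le> T" for T t using that by (auto simp: cl_def)
  have [measurable]: "cl T \<in> borel_measurable borel" for T using clc by (rule borel_measurable_continuous_onI)
  have growth_p: "\<bar>F t\<bar> \<le> (2 * C) * (1 + \<bar>t\<bar> powr p)" for t
  proof -
    have "\<bar>t\<bar> powr \<gamma> \<le> 1 + \<bar>t\<bar> powr p"
    proof (cases "\<bar>t\<bar> \<le> 1")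
      case True
      then have "\<bar>t\<bar> powr \<gamma> \<le> 1" using \<gamma> by (intro powr_le1) auto
      then show ?thesis by (simp add: add_increasing2)
    next
      case False
      then have "\<bar>t\<bar> powr \<gamma> \<le> \<bar>t\<bar> powr p" using \<gamma> by (intro powr_mono) auto
      then show ?thesis by simp
    qed
    then have "1 + \<bar>t\<bar> powr \<gamma> \<le> 2 * (1 + \<bar>t\<bar> powr p)" proof -
      have *: "1 + x \<le> 2 * (1 + y)" if "x \<le> 1 + y" "0 \<le> y" for x y :: real using that by simp
      show ?thesis by (rule *[OF \<open>\<bar>t\<bar> powr \<gamma> \<le> 1 + \<bar>t\<bar> powr p\<close> powr_ge_zero])
    qed
    then have "C * (1 + \<bar>t\<bar> powr \<gamma>) \<le> C * (2 * (1 + \<bar>t\<bar> powr p))" using C by (rule mult_left_mono)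
    from order_trans[OF growth this] show ?thesis by (simp only: mult.left_commute[of C 2] mult.assoc)
  qed
  have intF: "integrable M (\<lambda>x. h x * F (w x))"
    if "w \<in> borel_measurable M" "integrable M (\<lambda>x. \<bar>w x\<bar> powr p)" for w
    using that by (intro integrable_weighted_comp[OF _ _ Fm h growth_p]) auto
  have Fcl: "\<bar>F (cl T t)\<bar> \<le> C * (1 + T powr \<gamma>)" if "0 \<le> T" for T t
    using order_trans[OF growth mult_left_mono[OF add_left_mono[OF powr_mono2[OF _ _ clb[OF that]]]]] C \<gamma> by auto
  have intT: "integrable M (\<lambda>x. h x * F (cl T (w x)))" if "0 \<le> T" "w \<in> borel_measurable M" for T w
  proof (rule integrable_const_bound[of _ "H * (C * (1 + T powr \<gamma>))"])
    show "AE x in M. norm (h x * F (cl T (w x))) \<le> H * (C * (1 + T powr \<gamma>))"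
      using h
    proof eventually_elim
      case (elim x)
      then show ?case unfolding real_norm_def abs_mult using Fcl[OF that(1)] by (intro mult_mono) auto
    qed
  qed (use that(2) in measurable)
  have tail: "\<bar>F t - F (cl T t)\<bar> \<le> 4 * C * T powr (\<gamma> - p) * \<bar>t\<bar> powr p" if T: "1 \<le> T" for T t
  proof (cases "\<bar>t\<bar> \<le> T")
    case True
    then have "cl T t = t" by (auto simp: cl_def)
    then show ?thesis using C by simp
  next
    case False
    then have t: "T < \<bar>t\<bar>" by simp
    have "T powr \<gamma> \<le> \<bar>t\<bar> powr \<gamma>" using T t \<gamma> by (intro powr_mono2) auto
    moreover have "1 \<le> \<bar>t\<bar> powr \<gamma>" using T t \<gamma> by (intro ge_one_powr_ge_zero) auto
    ultimately have "C * (1 + \<bar>t\<bar> powr \<gamma>) + C * (1 + T powr \<gamma>) \<le> C * (2 * \<bar>t\<bar> powr \<gamma>) + C * (2 * \<bar>t\<bar> powr \<gamma>)"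
      using C by (intro add_mono mult_left_mono) auto
    moreover have "\<bar>t\<bar> powr \<gamma> \<le> T powr (\<gamma> - p) * \<bar>t\<bar> powr p"
    proof -
      have "\<bar>t\<bar> powr \<gamma> = \<bar>t\<bar> powr (\<gamma> - p) * \<bar>t\<bar> powr p" by (simp flip: powr_add)
      also have "\<dots> \<le> T powr (\<gamma> - p) * \<bar>t\<bar> powr p"
        using T t \<gamma> by (intro mult_right_mono powr_mono2') auto
      finally show ?thesis .
    qed
    then have "4 * C * \<bar>t\<bar> powr \<gamma> \<le> 4 * C * (T powr (\<gamma> - p) * \<bar>t\<bar> powr p)" using C by (intro mult_left_mono) auto
    moreover have "\<bar>F t - F (cl T t)\<bar> \<le> C * (1 + \<bar>t\<bar> powr \<gamma>) + C * (1 + T powr \<gamma>)"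
      using growth[of t] Fcl[of T t] T by linarith
    ultimately show ?thesis by simp
  qed
  have tail_int: "\<bar>(\<integral>x. h x * F (w x) \<partial>M) - (\<integral>x. h x * F (cl T (w x)) \<partial>M)\<bar> \<le> 4 * H * C * B * T powr (\<gamma> - p)"
    if T: "1 \<le> T" and w[measurable]: "w \<in> borel_measurable M" and wi: "integrable M (\<lambda>x. \<bar>w x\<bar> powr p)" and wB: "(\<integral>x. \<bar>w x\<bar> powr p \<partial>M) \<le> B" for T w
  proof -
    have i: "integrable M (\<lambda>x. h x * F (w x))" "integrable M (\<lambda>x. h x * F (cl T (w x)))"
      using intF[OF w wi] intT[OF _ w, of T] T by auto
    have "\<bar>(\<integral>x. h x * F (w x) \<partial>M) - (\<integral>x. h x * F (cl T (w x)) \<partial>M)\<bar> = norm (\<integral>x. h x * F (w x) - h x * F (cl T (w x)) \<partial>M)"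
      using i by simp
    also have "\<dots> \<le> (\<integral>x. norm (h x * F (w x) - h x * F (cl T (w x))) \<partial>M)"
      by (rule integral_norm_bound)
    also have "\<dots> \<le> (\<integral>x. H * (4 * C * T powr (\<gamma> - p) * \<bar>w x\<bar> powr p) \<partial>M)"
    proof (rule integral_mono_AE)
      show "AE x in M. norm (h x * F (w x) - h x * F (cl T (w x))) \<le> H * (4 * C * T powr (\<gamma> - p) * \<bar>w x\<bar> powr p)"
        using h
      proof eventually_elim
        case (elim x)
        then show ?case unfolding real_norm_def right_diff_distrib[symmetric] abs_mult
          using tail[OF T] by (intro mult_mono) auto
      qed
    qed (use i wi in auto)
    also have "\<dots> = 4 * H * C * T powr (\<gamma> - p) * (\<integral>x. \<bar>w x\<bar> powr p \<partial>M)" by (simp add: mult_ac)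
    also have "\<dots> \<le> 4 * H * C * T powr (\<gamma> - p) * B"
      using wB C \<open>0 \<le> H\<close> by (intro mult_left_mono) auto
    finally show ?thesis by (simp add: mult_ac)
  qed
  have trunc: "(\<lambda>n. \<integral>x. h x * F (cl T (u n x)) \<partial>M) \<longlonglongrightarrow> (\<integral>x. h x * F (cl T (v x)) \<partial>M)" if T: "1 \<le> T" for T
  proof (rule integral_dominated_convergence)
    show "integrable M (\<lambda>x. H * (C * (1 + T powr \<gamma>)))" by simp
    show "AE x in M. (\<lambda>n. h x * F (cl T (u n x))) \<longlonglongrightarrow> h x * F (cl T (v x))"
      using lim
    proof eventually_elim
      case (elim x)
      have "isCont (\<lambda>t. F (cl T t)) (v x)"
        using continuous_on_compose2[OF F clc, of T] by (simp add: continuous_on_eq_continuous_at)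
      from isCont_tendsto_compose[OF this elim] show ?case by (intro tendsto_intros)
    qed
    show "AE x in M. norm (h x * F (cl T (u n x))) \<le> H * (C * (1 + T powr \<gamma>))" for n
      using h
    proof eventually_elim
      case (elim x)
      then show ?case unfolding real_norm_def abs_mult using Fcl T by (intro mult_mono) auto
    qed
  qed simp_all
  show ?thesis
  proof (rule LIMSEQ_I)
    fix e :: real assume e: "0 < e"
    define A where "A = 4 * H * C * B"
    have "((\<lambda>T. A * T powr (\<gamma> - p)) \<longlongrightarrow> A * 0) at_top"
      using \<gamma> by (intro tendsto_intros tendsto_neg_powr filterlim_ident) auto
    then have "eventually (\<lambda>T. A * T powr (\<gamma> - p) < e / 3) at_top"
      using e by (intro order_tendstoD(2)[of _ "A * 0"]) auto
    then obtain T where T: "1 \<le> T" "A * T powr (\<gamma> - p) < e / 3"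
      using eventually_happens'[OF trivial_limit_at_top_linorder eventually_conj[OF eventually_ge_at_top[of "1::real"]]] by blast
    obtain N where N: "\<And>n. n \<ge> N \<Longrightarrow> norm ((\<integral>x. h x * F (cl T (u n x)) \<partial>M) - (\<integral>x. h x * F (cl T (v x)) \<partial>M)) < e / 3"
      using LIMSEQ_D[OF trunc[OF T(1)], of "e / 3"] e by auto
    have "norm ((\<integral>x. h x * F (u n x) \<partial>M) - (\<integral>x. h x * F (v x) \<partial>M)) < e" if "n \<ge> N" for n
      using N[OF that] tail_int[OF T(1) _ u(1,2), of n] tail_int[OF T(1) _ v] T(2)
      unfolding A_def real_norm_def by (simp add: abs_if split: if_splits)
    then show "\<exists>N. \<forall>n\<ge>N. norm ((\<integral>x. h x * F (u n x) \<partial>M) - (\<integral>x. h x * F (v x) \<partial>M)) < e" by blast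
  qed
qed

section \<open>The energy functional\<close>

lemma primitive_has_derivative:
  assumes f: "continuous_on UNIV f"
  shows "(primitive f has_real_derivative f x) (at x)"
proof -
  define a b where "a = min 0 x - 1" and "b = max 0 x + 1"
  have ab: "a \<le> 0" "0 \<le> b" "a < x" "x < b" by (auto simp: a_def b_def)
  have "((\<lambda>u. LBINT y=0..u. f y) has_vector_derivative f x) (at x within {a..b})"
    using ab interval_integral_FTC2[of a 0 b f x] continuous_on_subset[OF f, of "{a..b}"] by (simp add: zero_ereal_def)
  then have "(primitive f has_vector_derivative f x) (at x within {a..b})"
    unfolding primitive_def[abs_def] .
  moreover have "at x within {a..b} = at x" using ab by (intro at_within_Icc_at) auto
  ultimately show ?thesis by (simp add: has_real_derivative_iff_has_vector_derivative)
qed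

lemma primitive_0 [simp]: "primitive f 0 = 0"
  by (simp add: primitive_def zero_ereal_def[symmetric])

lemma primitive_continuous:
  assumes "continuous_on UNIV f"
  shows "continuous_on UNIV (primitive f)"
  using DERIV_isCont[OF primitive_has_derivative[OF assms]] by (auto simp: continuous_on_eq_continuous_at)

lemma powr_add_le:
  fixes a b p :: real
  assumes "0 \<le> a" "0 \<le> b" "0 < p"
  shows "(a + b) powr p \<le> 2 powr p * (a powr p + b powr p)"
proof -
  have "(a + b) powr p \<le> (2 * max a b) powr p" using assms by (intro powr_mono2) auto
  also have "\<dots> = 2 powr p * max a b powr p" using assms by (simp add: powr_mult)
  also have "max a b powr p \<le> a powr p + b powr p" by (auto simp: max_def)
  finally show ?thesis by simp
qed

text \<open>
  The mean value theorem. The bound serves both as the growth condition on the primitive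
  (\<open>a = 0\<close>, \<open>t = 1\<close>) and as a majorant of its difference quotients.
\<close>

lemma primitive_increment:
  fixes f :: "real \<Rightarrow> real"
  assumes f: "continuous_on UNIV f" and growth: "\<And>t. \<bar>f t\<bar> \<le> C * (1 + \<bar>t\<bar> powr (\<gamma> - 1))"
    and \<gamma>: "1 \<le> \<gamma>" and t: "\<bar>t\<bar> \<le> 1"
  shows "\<bar>primitive f (a + t * b) - primitive f a\<bar> \<le> \<bar>t\<bar> * (2 * C * (1 + (\<bar>a\<bar> + \<bar>b\<bar>) powr \<gamma>))"
proof -
  define y where "y = \<bar>a\<bar> + \<bar>b\<bar>"
  have y: "0 \<le> y" by (simp add: y_def)
  have C: "0 \<le> C"
  proof -
    have "0 \<le> C * (1 + \<bar>0\<bar> powr (\<gamma> - 1))" by (rule order_trans[OF abs_ge_zero growth])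
    then show ?thesis by (simp add: zero_le_mult_iff)
  qed
  have tb: "\<bar>t * b\<bar> \<le> \<bar>b\<bar>" using t mult_right_mono[of "\<bar>t\<bar>" 1 "\<bar>b\<bar>"] by (simp add: abs_mult)
  have "norm (primitive f (a + t * b) - primitive f a) \<le> (C * (1 + y powr (\<gamma> - 1))) * norm ((a + t * b) - a)"
  proof (rule field_differentiable_bound[of "cball 0 y"])
    fix z :: real assume z: "z \<in> cball 0 y"
    show "(primitive f has_field_derivative f z) (at z within cball 0 y)"
      using primitive_has_derivative[OF f] by (rule has_field_derivative_at_within)
    have "\<bar>z\<bar> powr (\<gamma> - 1) \<le> y powr (\<gamma> - 1)" using z \<gamma> by (intro powr_mono2) auto
    then have "C * (1 + \<bar>z\<bar> powr (\<gamma> - 1)) \<le> C * (1 + y powr (\<gamma> - 1))" using C by (intro mult_left_mono) auto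
    then show "norm (f z) \<le> C * (1 + y powr (\<gamma> - 1))" using growth[of z] by simp
  qed (use tb in \<open>auto simp: y_def\<close>)
  also have "\<dots> = \<bar>t\<bar> * (C * (\<bar>b\<bar> * (1 + y powr (\<gamma> - 1))))" by (simp add: abs_mult mult_ac)
  also have "\<dots> \<le> \<bar>t\<bar> * (C * (2 * (1 + y powr \<gamma>)))"
  proof (intro mult_left_mono)
    have "\<bar>b\<bar> * (1 + y powr (\<gamma> - 1)) \<le> y * (1 + y powr (\<gamma> - 1))"
      by (intro mult_right_mono) (auto simp: y_def)
    also have "\<dots> = y + y powr \<gamma>"
    proof -
      have "y powr \<gamma> = y * y powr (\<gamma> - 1)"
        using y by (cases "y = 0") (auto simp: powr_diff)
      then show ?thesis by (simp add: distrib_left)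
    qed
    also have "\<dots> \<le> (1 + y powr \<gamma>) + y powr \<gamma>"
    proof (rule add_right_mono, cases "y \<le> 1")
      case False
      then have "y powr 1 \<le> y powr \<gamma>" using \<gamma> by (intro powr_mono) auto
      then show "y \<le> 1 + y powr \<gamma>" using False by simp
    qed (simp add: add_increasing2)
    finally show "\<bar>b\<bar> * (1 + y powr (\<gamma> - 1)) \<le> 2 * (1 + y powr \<gamma>)" by simp
  qed (use C in auto)
  finally show ?thesis by (simp add: y_def mult_ac)
qed

locale subcritical_problem = fractional_kernel K \<Omega> s \<beta>
  for K :: "'a::euclidean_space \<Rightarrow> real" and \<Omega> s \<beta> +
  fixes h :: "'a \<Rightarrow> real" and f :: "real \<Rightarrow> real" and H C \<gamma> :: real
  assumes h_measurable [measurable]: "h \<in> borel_measurable (lebesgue_on \<Omega>)"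
    and h_bound: "AE x in lebesgue_on \<Omega>. \<bar>h x\<bar> \<le> H" and H: "0 \<le> H"
    and f_cont: "continuous_on UNIV f"
    and f_growth: "\<And>t. \<bar>f t\<bar> \<le> C * (1 + \<bar>t\<bar> powr (\<gamma> - 1))"
    and \<gamma>: "1 \<le> \<gamma>" "\<gamma> < crit_exp DIM('a) s"
begin

abbreviation "F \<equiv> primitive f"
abbreviation "J \<equiv> energy K \<Omega> h f"

definition "N u = (\<integral>x. h x * F (u x) \<partial>lebesgue_on \<Omega>)"

lemma J_eq: "J u = 1 / 2 * (nrm u)\<^sup>2 - N u"
  by (simp add: energy_def N_def)

lemma F_growth: "\<bar>F t\<bar> \<le> 2 * C * (1 + \<bar>t\<bar> powr \<gamma>)"
  using primitive_increment[OF f_cont f_growth \<gamma>(1), of 1 0 t] by simp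

lemma F_borel [measurable]: "F \<in> borel_measurable borel"
  using primitive_continuous[OF f_cont] by (rule borel_measurable_continuous_onI)

lemma X0_measurable_\<Omega>: "u \<in> X0 \<Longrightarrow> u \<in> borel_measurable (lebesgue_on \<Omega>)"
  by (auto simp: X0_iff intro: measurable_restrict_space1)

lemma X0_integrable_powr:
  assumes "u \<in> X0"
  shows "integrable (lebesgue_on \<Omega>) (\<lambda>x. \<bar>u x\<bar> powr \<gamma>)"
  by (rule sobolev[of \<gamma>]) (use \<gamma> assms in auto)

lemma N_integrable:
  assumes "u \<in> X0"
  shows "integrable (lebesgue_on \<Omega>) (\<lambda>x. h x * F (u x))"
proof -
  interpret fm: finite_measure "lebesgue_on \<Omega>" by (rule finite_measure_\<Omega>)
  show ?thesis
    by (rule fm.integrable_weighted_comp[OF h_measurable X0_measurable_\<Omega>[OF assms] F_borel h_bound F_growth X0_integrable_powr[OF assms]])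
qed

text \<open>
  Directional differentiability of \<open>N\<close>, along the sequence \<open>1 / Suc n\<close> of increments, which is all that
  the first variation of a minimizer needs.
\<close>

lemma N_derivative:
  assumes u: "u \<in> X0" and \<phi>: "\<phi> \<in> X0"
  shows "(\<lambda>n. (N (\<lambda>x. u x + 1 / real (Suc n) * \<phi> x) - N u) * real (Suc n)) \<longlonglongrightarrow>
    (\<integral>x. h x * f (u x) * \<phi> x \<partial>lebesgue_on \<Omega>)"
proof -
  interpret fm: finite_measure "lebesgue_on \<Omega>" by (rule finite_measure_\<Omega>)
  note [measurable] = X0_measurable_\<Omega>[OF u] X0_measurable_\<Omega>[OF \<phi>] borel_measurable_continuous_onI[OF f_cont]
  define t where "t = (\<lambda>n. 1 / real (Suc n))"
  have t: "0 < t n" "t n \<le> 1" "t n \<noteq> 0" for n by (simp_all add: t_def)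
  define q where "q = (\<lambda>n x. h x * ((F (u x + t n * \<phi> x) - F (u x)) / t n))"
  have q: "(N (\<lambda>x. u x + 1 / real (Suc n) * \<phi> x) - N u) * real (Suc n) = (\<integral>x. q n x \<partial>lebesgue_on \<Omega>)" for n
  proof -
    have "(\<integral>x. q n x \<partial>lebesgue_on \<Omega>) = (\<integral>x. (h x * F (u x + t n * \<phi> x) - h x * F (u x)) * real (Suc n) \<partial>lebesgue_on \<Omega>)"
      by (intro Bochner_Integration.integral_cong) (auto simp: q_def t_def algebra_simps)
    also have "\<dots> = (N (\<lambda>x. u x + t n * \<phi> x) - N u) * real (Suc n)"
      using N_integrable[OF u] N_integrable[OF X0_add_mult(1)[OF u \<phi>, of "t n"]] by (simp add: N_def)
    finally show ?thesis by (simp add: t_def)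
  qed
  define g where "g = (\<lambda>x. H * (2 * C * (1 + 2 powr \<gamma> * (\<bar>u x\<bar> powr \<gamma> + \<bar>\<phi> x\<bar> powr \<gamma>))))"
  have C: "0 \<le> C" using order_trans[OF abs_ge_zero f_growth[of 0]] by (simp add: zero_le_mult_iff)
  have "(\<lambda>n. \<integral>x. q n x \<partial>lebesgue_on \<Omega>) \<longlonglongrightarrow> (\<integral>x. h x * f (u x) * \<phi> x \<partial>lebesgue_on \<Omega>)"
  proof (rule integral_dominated_convergence[where w = g])
    show "integrable (lebesgue_on \<Omega>) g"
      unfolding g_def using X0_integrable_powr[OF u] X0_integrable_powr[OF \<phi>] by simp
    show "AE x in lebesgue_on \<Omega>. (\<lambda>n. q n x) \<longlonglongrightarrow> h x * f (u x) * \<phi> x"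
    proof (rule always_eventually, rule allI)
      fix x
      have "((\<lambda>\<tau>. F (u x + \<tau> * \<phi> x)) has_real_derivative f (u x + 0 * \<phi> x) * \<phi> x) (at 0)"
        by (rule DERIV_chain2[of F]) (auto intro!: primitive_has_derivative[OF f_cont] derivative_eq_intros)
      then have "((\<lambda>\<tau>. (F (u x + \<tau> * \<phi> x) - F (u x)) / \<tau>) \<longlongrightarrow> f (u x) * \<phi> x) (at 0)"
        by (simp add: has_field_derivative_iff)
      moreover have "filterlim t (at 0) sequentially"
        unfolding filterlim_at using t(3) by (auto simp: t_def intro!: LIMSEQ_inverse_real_of_nat[unfolded inverse_eq_divide] simp del: of_nat_Suc)
      ultimately have "(\<lambda>n. (F (u x + t n * \<phi> x) - F (u x)) / t n) \<longlonglongrightarrow> f (u x) * \<phi> x"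
        by (rule filterlim_compose)
      from tendsto_mult_left[OF this, of "h x"]
      show "(\<lambda>n. q n x) \<longlonglongrightarrow> h x * f (u x) * \<phi> x" by (simp add: q_def mult.assoc)
    qed
    show "AE x in lebesgue_on \<Omega>. norm (q n x) \<le> g x" for n
      using h_bound
    proof eventually_elim
      case (elim x)
      have "\<bar>(F (u x + t n * \<phi> x) - F (u x)) / t n\<bar> \<le> 2 * C * (1 + (\<bar>u x\<bar> + \<bar>\<phi> x\<bar>) powr \<gamma>)"
        using primitive_increment[OF f_cont f_growth \<gamma>(1), of "t n" "u x" "\<phi> x"] t[of n]
        by (simp add: divide_le_eq mult_ac)
      also have "\<dots> \<le> 2 * C * (1 + 2 powr \<gamma> * (\<bar>u x\<bar> powr \<gamma> + \<bar>\<phi> x\<bar> powr \<gamma>))"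
        using C \<gamma> by (intro mult_left_mono add_left_mono powr_add_le) auto
      finally show ?case
        unfolding q_def g_def real_norm_def abs_mult[of "h x"] using elim H by (intro mult_mono) auto
    qed
    show "(\<lambda>x. h x * f (u x) * \<phi> x) \<in> borel_measurable (lebesgue_on \<Omega>)" by measurable
    show "q n \<in> borel_measurable (lebesgue_on \<Omega>)" for n unfolding q_def by measurable
  qed
  then show ?thesis by (simp only: q)
qed

lemma nrm_scale: "nrm (\<lambda>x. t * \<phi> x) = \<bar>t\<bar> * nrm \<phi>"
proof -
  have "D (\<lambda>x. t * \<phi> x) z = t * D \<phi> z" for z by (simp add: weighted_diff_def algebra_simps)
  then have "(nrm (\<lambda>x. t * \<phi> x))\<^sup>2 = (\<bar>t\<bar> * nrm \<phi>)\<^sup>2"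
    by (simp add: nrm_sq power_mult_distrib)
  then show ?thesis using nrm_nonneg by (simp add: power2_eq_iff_nonneg)
qed

lemma local_min_weak_solution:
  assumes min: "X0_local_min K \<Omega> J u"
  shows "weak_solution K \<Omega> h f u"
proof -
  obtain \<epsilon> where u: "u \<in> X0" and \<epsilon>: "0 < \<epsilon>" "\<And>v. v \<in> X0 \<Longrightarrow> nrm (\<lambda>x. v x - u x) < \<epsilon> \<Longrightarrow> J u \<le> J v"
    using min unfolding X0_local_min_def by blast
  have le: "(\<integral>x. h x * f (u x) * \<phi> x \<partial>lebesgue_on \<Omega>) \<le> X0_inner K \<Omega> u \<phi>" if \<phi>: "\<phi> \<in> X0" for \<phi>
  proof (rule LIMSEQ_le[OF N_derivative[OF u \<phi>]])
    have l: "(\<lambda>n. 1 / real (Suc n)) \<longlonglongrightarrow> 0"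
      using LIMSEQ_inverse_real_of_nat by (simp add: inverse_eq_divide)
    have "(\<lambda>n. X0_inner K \<Omega> u \<phi> + 1 / real (Suc n) * ((nrm \<phi>)\<^sup>2 / 2)) \<longlonglongrightarrow> X0_inner K \<Omega> u \<phi> + 0 * ((nrm \<phi>)\<^sup>2 / 2)"
      by (intro tendsto_intros l)
    then show "(\<lambda>n. X0_inner K \<Omega> u \<phi> + 1 / real (Suc n) * ((nrm \<phi>)\<^sup>2 / 2)) \<longlonglongrightarrow> X0_inner K \<Omega> u \<phi>" by simp
    have "(\<lambda>n. 1 / real (Suc n) * nrm \<phi>) \<longlonglongrightarrow> 0 * nrm \<phi>" by (intro tendsto_intros l)
    then have "eventually (\<lambda>n. 1 / real (Suc n) * nrm \<phi> < \<epsilon>) sequentially"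
      using \<epsilon>(1) by (intro order_tendstoD(2)[of _ "0 * nrm \<phi>"]) auto
    then have "eventually (\<lambda>n. (N (\<lambda>x. u x + 1 / real (Suc n) * \<phi> x) - N u) * real (Suc n) \<le> X0_inner K \<Omega> u \<phi> + 1 / real (Suc n) * ((nrm \<phi>)\<^sup>2 / 2)) sequentially"
    proof eventually_elim
      case (elim n)
      define t where "t = 1 / real (Suc n)"
      have t: "0 < t" by (simp add: t_def)
      let ?v = "\<lambda>x. u x + t * \<phi> x"
      have "nrm (\<lambda>x. ?v x - u x) < \<epsilon>" using elim t nrm_scale[of t \<phi>] by (simp add: t_def)
      then have "J u \<le> J ?v" by (intro \<epsilon>(2) X0_add_mult(1) u \<phi>)
      then have "N ?v - N u \<le> t * (X0_inner K \<Omega> u \<phi> + t * ((nrm \<phi>)\<^sup>2 / 2))"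
        unfolding J_eq X0_add_mult(2)[OF u \<phi>] by (simp add: power2_eq_square algebra_simps)
      then have "(N ?v - N u) / t \<le> X0_inner K \<Omega> u \<phi> + t * ((nrm \<phi>)\<^sup>2 / 2)"
        using t by (simp add: divide_le_eq mult.commute)
      then show ?case by (simp add: t_def)
    qed
    then show "\<exists>M. \<forall>n\<ge>M. (N (\<lambda>x. u x + 1 / real (Suc n) * \<phi> x) - N u) * real (Suc n) \<le> X0_inner K \<Omega> u \<phi> + 1 / real (Suc n) * ((nrm \<phi>)\<^sup>2 / 2)"
      by (simp add: eventually_sequentially)
  qed
  have "X0_inner K \<Omega> u \<phi> = (\<integral>x. h x * f (u x) * \<phi> x \<partial>lebesgue_on \<Omega>)" if \<phi>: "\<phi> \<in> X0" for \<phi>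
  proof (rule antisym)
    have z: "(\<lambda>x. 0) \<in> X0" by (simp add: X0_iff weighted_diff_def)
    have m: "(\<lambda>x. - \<phi> x) \<in> X0" using X0_add_mult(1)[OF z \<phi>, of "-1"] by simp
    have "D (\<lambda>x. - \<phi> x) z = - D \<phi> z" for z by (simp add: weighted_diff_def algebra_simps)
    then have "X0_inner K \<Omega> u (\<lambda>x. - \<phi> x) = - X0_inner K \<Omega> u \<phi>" by (simp add: inner_eq)
    then show "X0_inner K \<Omega> u \<phi> \<le> (\<integral>x. h x * f (u x) * \<phi> x \<partial>lebesgue_on \<Omega>)"
      using le[OF m] by simp
  qed (rule le[OF \<phi>])
  then show ?thesis using u by (simp add: weak_solution_def)
qed

text \<open>
  The direct method. Along an almost everywhere convergent minimizing sequence \<open>N\<close> converges because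
  \<open>f\<close> is subcritical, and the norm can only drop in the limit.
\<close>

lemma ball_minimizer:
  assumes c: "0 \<le> c" and bound: "\<And>v. v \<in> X0 \<Longrightarrow> (nrm v)\<^sup>2 \<le> c \<Longrightarrow> N v \<le> B"
  obtains u where "u \<in> X0" "(nrm u)\<^sup>2 \<le> c" "\<And>v. v \<in> X0 \<Longrightarrow> (nrm v)\<^sup>2 \<le> c \<Longrightarrow> J u \<le> J v"
proof -
  interpret fm: finite_measure "lebesgue_on \<Omega>" by (rule finite_measure_\<Omega>)
  define S where "S = J ` {v \<in> X0. (nrm v)\<^sup>2 \<le> c}"
  have "(\<lambda>x. 0) \<in> X0" by (simp add: X0_iff weighted_diff_def)
  moreover have "(nrm (\<lambda>x. 0))\<^sup>2 \<le> c" using c by (simp add: nrm_sq weighted_diff_def)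
  ultimately have S0: "S \<noteq> {}" by (auto simp: S_def)
  have "- B \<le> J v" if "v \<in> X0" "(nrm v)\<^sup>2 \<le> c" for v
    using bound[OF that] zero_le_power2[of "nrm v"] unfolding J_eq by linarith
  then have Sb: "bdd_below S" by (auto simp: S_def intro!: bdd_belowI[of _ "- B"])
  define I where "I = Inf S"
  have "\<exists>v. v \<in> X0 \<and> (nrm v)\<^sup>2 \<le> c \<and> J v < I + 1 / real (Suc n)" for n
    using cInf_less_iff[OF S0 Sb, of "I + 1 / real (Suc n)"] by (auto simp: I_def S_def)
  then obtain v where v: "\<And>n. v n \<in> X0" "\<And>n. (nrm (v n))\<^sup>2 \<le> c" "\<And>n. J (v n) < I + 1 / real (Suc n)"
    by metis
  have Ile: "I \<le> J w" if "w \<in> X0" "(nrm w)\<^sup>2 \<le> c" for w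
    unfolding I_def using that by (intro cInf_lower Sb) (auto simp: S_def)
  obtain r u where r: "strict_mono (r :: nat \<Rightarrow> nat)" and u: "u \<in> X0"
    and lim: "AE x in lebesgue. (\<lambda>n. v (r n) x) \<longlonglongrightarrow> u x"
    by (rule X0_compact[OF v(1) v(2)]) (rule that)
  have um: "u \<in> borel_measurable lebesgue" using u by (simp add: X0_iff)
  have uc: "(nrm u)\<^sup>2 \<le> c" using X0_limit(2)[OF v(1) um lim v(2)] .
  obtain p where p: "\<gamma> < p" "p < crit_exp DIM('a) s" using dense[OF \<gamma>(2)] by blast
  have p0: "0 < p" using p \<gamma> by simp
  have Nlim: "(\<lambda>n. N (v (r n))) \<longlonglongrightarrow> N u"
  proof (rule sobolev[OF p0 p(2)])
    fix Cp :: real assume Cp: "0 < Cp"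
      and int: "\<And>u. u \<in> X0 \<Longrightarrow> integrable (lebesgue_on \<Omega>) (\<lambda>x. \<bar>u x\<bar> powr p)"
      and le: "\<And>u. u \<in> X0 \<Longrightarrow> (\<integral>x. \<bar>u x\<bar> powr p \<partial>lebesgue_on \<Omega>) \<le> Cp * nrm u powr p"
    have le': "(\<integral>x. \<bar>w x\<bar> powr p \<partial>lebesgue_on \<Omega>) \<le> Cp * sqrt c powr p" if "w \<in> X0" "(nrm w)\<^sup>2 \<le> c" for w
    proof -
      have "nrm w \<le> sqrt c" using that(2) by (rule real_le_rsqrt)
      then have "Cp * nrm w powr p \<le> Cp * sqrt c powr p"
        using Cp p0 nrm_nonneg by (intro mult_left_mono powr_mono2) auto
      with le[OF that(1)] show ?thesis by linarith
    qed
    have g0: "0 < \<gamma>" using \<gamma> by simp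
    show ?thesis
      unfolding N_def
      by (rule fm.integral_comp_tendsto[OF h_measurable X0_measurable_\<Omega>[OF v(1)] X0_measurable_\<Omega>[OF u]
          primitive_continuous[OF f_cont] h_bound H F_growth g0 p(1) AE_lebesgue_on_\<Omega>[OF lim]
          int[OF v(1)] le'[OF v(1) v(2)] int[OF u] le'[OF u uc]])
  qed
  have Jlim: "(\<lambda>n. J (v (r n))) \<longlonglongrightarrow> I"
  proof (rule tendsto_sandwich[OF _ _ tendsto_const])
    show "\<forall>\<^sub>F n in sequentially. I \<le> J (v (r n))" using Ile v by simp
    have "J (v (r n)) \<le> I + 1 / real (Suc n)" for n
    proof -
      have "1 / real (Suc (r n)) \<le> 1 / real (Suc n)"
        using seq_suble[OF r, of n] by (intro divide_left_mono) auto
      then show ?thesis using v(3)[of "r n"] by linarith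
    qed
    then show "\<forall>\<^sub>F n in sequentially. J (v (r n)) \<le> I + 1 / real (Suc n)" by simp
    have "(\<lambda>n. I + 1 / real (Suc n)) \<longlonglongrightarrow> I + 0"
      using LIMSEQ_inverse_real_of_nat by (intro tendsto_intros) (simp add: inverse_eq_divide)
    then show "(\<lambda>n. I + 1 / real (Suc n)) \<longlonglongrightarrow> I" by simp
  qed
  have "(\<lambda>n. 2 * (J (v (r n)) + N (v (r n)))) \<longlonglongrightarrow> 2 * (I + N u)"
    by (intro tendsto_intros Jlim Nlim)
  then have nlim: "(\<lambda>n. (nrm (v (r n)))\<^sup>2) \<longlonglongrightarrow> 2 * (I + N u)" by (simp add: J_eq)
  have "(nrm u)\<^sup>2 \<le> 2 * (I + N u)"
  proof (rule field_le_epsilon)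
    fix e :: real assume "0 < e"
    then have "eventually (\<lambda>n. (nrm (v (r n)))\<^sup>2 < 2 * (I + N u) + e) sequentially"
      using nlim by (intro order_tendstoD(2)[of _ "2 * (I + N u)"]) auto
    then obtain n0 where n0: "\<And>n. n \<ge> n0 \<Longrightarrow> (nrm (v (r n)))\<^sup>2 < 2 * (I + N u) + e"
      by (auto simp: eventually_sequentially)
    have "AE x in lebesgue. (\<lambda>n. v (r (n + n0)) x) \<longlonglongrightarrow> u x"
      using lim by eventually_elim (rule LIMSEQ_ignore_initial_segment)
    from X0_limit(2)[OF v(1) um this, of "2 * (I + N u) + e"] n0
    show "(nrm u)\<^sup>2 \<le> 2 * (I + N u) + e" by (simp add: less_imp_le)
  qed
  then have "J u \<le> I" by (simp add: J_eq)
  then show ?thesis using that[OF u uc] Ile order_trans by blast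
qed

text \<open>
  The minimum over the ball is at most \<open>J 0 = 0\<close>, while on the sphere \<open>J = c / 2 - N > 0\<close>. A minimizer
  over the ball therefore lies in its interior.
\<close>

lemma interior_minimizer:
  assumes bound: "\<And>v. v \<in> X0 \<Longrightarrow> (nrm v)\<^sup>2 \<le> c \<Longrightarrow> N v \<le> B" and c: "B < c / 2" "0 < c"
  obtains u where "X0_local_min K \<Omega> J u" "(nrm u)\<^sup>2 < c"
proof -
  have c0: "0 \<le> c" using c by simp
  obtain u where u: "u \<in> X0" "(nrm u)\<^sup>2 \<le> c" and min: "\<And>v. v \<in> X0 \<Longrightarrow> (nrm v)\<^sup>2 \<le> c \<Longrightarrow> J u \<le> J v"
    by (rule ball_minimizer[OF c0 bound]) (assumption, assumption, rule that)
  have z: "(\<lambda>x. 0) \<in> X0" "nrm (\<lambda>x. 0) = 0" "N (\<lambda>x. 0) = 0"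
    by (simp_all add: X0_iff weighted_diff_def N_def X0_norm_def case_prod_unfold)
  have "J u \<le> 0" using min[OF z(1)] c0 by (simp add: J_eq z)
  then have "(nrm u)\<^sup>2 \<noteq> c" using bound[OF u] c(1) by (auto simp: J_eq)
  with u have a: "(nrm u)\<^sup>2 < c" by simp
  define a where "a = (nrm u)\<^sup>2"
  have a: "0 \<le> a" "a < c" using a by (simp_all add: a_def)
  define \<delta> where "\<delta> = (c - a) / (2 * c)"
  have \<delta>: "0 < \<delta>" using a c by (simp add: \<delta>_def)
  have d1: "(1 + \<delta>) * a \<le> a + (c - a) / 2"
  proof -
    have "\<delta> * a \<le> \<delta> * c" using \<delta> a by (intro mult_left_mono) auto
    also have "\<dots> = (c - a) / 2" using c by (simp add: \<delta>_def)
    finally show ?thesis by (simp add: distrib_right)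
  qed
  define \<epsilon> where "\<epsilon> = sqrt ((c - a) / 2 / (1 + 1 / \<delta>))"
  have pos: "0 < 1 + 1 / \<delta>" using \<delta> by (simp add: add_pos_pos)
  have \<epsilon>: "0 < \<epsilon>" using a pos by (simp add: \<epsilon>_def)
  have "X0_local_min K \<Omega> J u"
    unfolding X0_local_min_def
  proof (intro conjI exI[of _ \<epsilon>] ballI impI \<epsilon> u(1))
    fix v assume v: "v \<in> X0" and close: "nrm (\<lambda>x. v x - u x) < \<epsilon>"
    have "(nrm (\<lambda>x. v x - u x))\<^sup>2 \<le> \<epsilon>\<^sup>2" using close nrm_nonneg by (intro power_mono) auto
    also have "\<epsilon>\<^sup>2 = (c - a) / 2 / (1 + 1 / \<delta>)" using a pos by (simp add: \<epsilon>_def)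
    finally have "(1 + 1 / \<delta>) * (nrm (\<lambda>x. v x - u x))\<^sup>2 \<le> (c - a) / 2"
      by (simp only: pos_le_divide_eq[OF pos] mult.commute)
    moreover have "(nrm v)\<^sup>2 \<le> (1 + \<delta>) * a + (1 + 1 / \<delta>) * (nrm (\<lambda>x. v x - u x))\<^sup>2"
      using nrm_sq_le_of_close[OF u(1) v \<delta>] by (simp add: a_def)
    ultimately have "(nrm v)\<^sup>2 \<le> c" using d1 by (simp add: field_simps)
    then show "J u \<le> J v" by (rule min[OF v])
  qed
  then show ?thesis using that a by (simp add: a_def)
qed

end

section \<open>The localization theorem\<close>

text \<open>
  At \<open>t = 0\<close>, where the quotient defining \<open>growth_const\<close> says nothing, lower semicontinuity gives
  \<open>\<psi> 0 \<le> 0\<close>. The constant is positive because \<open>\<psi>\<close> is positive somewhere, hence away from \<open>0\<close>.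
\<close>

lemma F_class_growth:
  assumes "\<psi> \<in> F_class q" "0 < q"
  shows "\<psi> t \<le> growth_const q \<psi> * \<bar>t\<bar> powr q" "0 < growth_const q \<psi>"
proof -
  let ?g = "growth_const q \<psi>"
  have bdd: "bdd_above ((\<lambda>t. \<psi> t / \<bar>t\<bar> powr q) ` (UNIV - {0}))"
    and lsc: "lower_semicont \<psi>" and pos: "0 < (SUP t. ereal (\<psi> t))"
    using assms by (auto simp: F_class_def)
  have quot: "\<psi> t / \<bar>t\<bar> powr q \<le> ?g" if "t \<noteq> 0" for t
    unfolding growth_const_def using that by (intro cSUP_upper bdd) auto
  have nz: "\<psi> t \<le> ?g * \<bar>t\<bar> powr q" if "t \<noteq> 0" for t
    using quot[OF that] that by (simp add: divide_le_eq)
  have z: "\<psi> 0 \<le> 0"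
  proof (rule ccontr)
    assume "\<not> ?thesis"
    then have c: "0 < \<psi> 0 / 2" "\<psi> 0 / 2 < \<psi> 0" by auto
    define c where "c = \<psi> 0 / 2"
    have c: "0 < c" "c < \<psi> 0" using c by (auto simp: c_def)
    have "\<forall>\<^sub>F t in nhds 0. c < \<psi> t" using lsc c(2) by (simp add: lower_semicont_def)
    then obtain d where d: "0 < d" "\<And>t. dist t 0 < d \<Longrightarrow> c < \<psi> t"
      unfolding eventually_nhds_metric by blast
    define t where "t = min (d / 2) ((c / (\<bar>?g\<bar> + 1)) powr (1 / q))"
    have t: "0 < t" using d c by (simp add: t_def)
    have "c < \<psi> t" using d(1) t by (intro d(2)) (auto simp: t_def)
    also have "\<psi> t \<le> ?g * t powr q" using nz[of t] t by simp
    also have "\<dots> \<le> (\<bar>?g\<bar> + 1) * t powr q" by (intro mult_right_mono) auto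
    also have "\<dots> \<le> (\<bar>?g\<bar> + 1) * ((c / (\<bar>?g\<bar> + 1)) powr (1 / q)) powr q"
      using t assms by (intro mult_left_mono powr_mono2) (auto simp: t_def)
    also have "\<dots> = c" using c assms by (simp add: powr_powr)
    finally show False by simp
  qed
  show "\<psi> t \<le> ?g * \<bar>t\<bar> powr q" using nz[of t] z by (cases "t = 0") auto
  obtain t where t: "0 < \<psi> t" using pos by (auto simp: less_SUP_iff zero_ereal_def)
  then have "t \<noteq> 0" using z by auto
  then have "0 < \<psi> t / \<bar>t\<bar> powr q" using t by simp
  then show "0 < ?g" using quot[OF \<open>t \<noteq> 0\<close>] by linarith
qed

theorem theorem3p2:
  fixes \<Omega> :: "(real ^ 'n) set" and K h :: "real ^ 'n \<Rightarrow> real"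
    and f \<psi> :: "real \<Rightarrow> real" and s a q r :: real and b :: ereal
  assumes "0 < s" "s < 1" "2 * s < real CARD('n)"
    and "open \<Omega>" "bounded \<Omega>" "lipschitz_boundary \<Omega>"
    and K_pos: "\<forall>x. x \<noteq> 0 \<longrightarrow> 0 < K x"
    and k1: "integrable lebesgue (\<lambda>x. min ((norm x)\<^sup>2) 1 * K x)"
    and k2: "\<exists>\<beta>>0. \<forall>x. x \<noteq> 0 \<longrightarrow> K x \<ge> \<beta> * norm x powr (- (real CARD('n) + 2 * s))"
    and k3: "\<forall>x. x \<noteq> 0 \<longrightarrow> K x = K (- x)"
    and "f \<in> class_A (crit_exp CARD('n) s)"
    and "h \<in> Linf_on \<Omega>" "\<not> (AE x in lebesgue_on \<Omega>. h x = 0)" "AE x in lebesgue_on \<Omega>. 0 \<le> h x"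
    and "0 \<le> a" "ereal a < b"
    and "1 \<le> q" "q < crit_exp CARD('n) s"
    and "\<psi> \<in> F_class q"
    and "\<forall>l. a < l \<and> ereal l < b \<longrightarrow>
           coercive (g_fun (primitive f) \<psi> l) \<and>
           is_singleton (min_points (g_fun (primitive f) \<psi> l))"
    and "0 < r"
    and "alpha (primitive f) \<psi> b < ereal r" "ereal r < beta (primitive f) \<psi> (ereal a)"
    and "(SUP \<xi> \<in> \<psi> -` {r}. ereal (primitive f \<xi>)) <
           ereal (r powr (2 / q) /
             (2 * (emb_const K \<Omega> q * growth_const q \<psi> * real_of_ereal (ess_sup_on \<Omega> h)) powr (2 / q)
                * L1_norm_on \<Omega> h powr ((q - 2) / q)))"
  shows "\<exists>u. weak_solution K \<Omega> h f u \<and>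
           X0_local_min K \<Omega> (energy K \<Omega> h f) u \<and>
           (\<integral>(x, y). \<bar>u x - u y\<bar>\<^sup>2 * K (x - y) \<partial>lebesgue_on (Q_set \<Omega>)) <
             (r * L1_norm_on \<Omega> h /
               (emb_const K \<Omega> q * growth_const q \<psi> * real_of_ereal (ess_sup_on \<Omega> h))) powr (2 / q)"
proof -
  obtain \<beta> where \<beta>: "0 < \<beta>" "\<And>x. x \<noteq> 0 \<Longrightarrow> K x \<ge> \<beta> * norm x powr (- (real CARD('n) + 2 * s))"
    using k2 by blast
  have q: "0 < q" using \<open>1 \<le> q\<close> by simp
  obtain \<gamma> where \<gamma>: "1 \<le> \<gamma>" "\<gamma> < crit_exp CARD('n) s"
    and fc: "continuous_on UNIV f" and "bdd_above (range (\<lambda>t. \<bar>f t\<bar> / (1 + \<bar>t\<bar> powr (\<gamma> - 1))))"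
    using \<open>f \<in> class_A _\<close> unfolding class_A_def by blast
  then obtain C where C: "\<And>t. \<bar>f t\<bar> / (1 + \<bar>t\<bar> powr (\<gamma> - 1)) \<le> C"
    by (auto simp: bdd_above_def)
  have growth: "\<bar>f t\<bar> \<le> C * (1 + \<bar>t\<bar> powr (\<gamma> - 1))" for t
  proof -
    have "0 < 1 + \<bar>t\<bar> powr (\<gamma> - 1)" by (simp add: add_pos_nonneg)
    then show ?thesis using C[of t] by (simp add: divide_le_eq)
  qed
  have hm: "h \<in> borel_measurable (lebesgue_on \<Omega>)" and hfin: "ess_sup_on \<Omega> (\<lambda>x. \<bar>h x\<bar>) < \<infinity>"
    using \<open>h \<in> Linf_on \<Omega>\<close> by (auto simp: Linf_on_def)
  note hpos = \<open>AE x in lebesgue_on \<Omega>. 0 \<le> h x\<close>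
  define H where "H = real_of_ereal (ess_sup_on \<Omega> h)"
  have AE_H: "AE x in lebesgue_on \<Omega>. ereal (h x) \<le> ess_sup_on \<Omega> h"
    unfolding ess_sup_on_def by (rule esssup_AE)
  have ess_pos: "0 < ess_sup_on \<Omega> h"
  proof (rule ccontr)
    assume "\<not> ?thesis"
    then have "ess_sup_on \<Omega> h \<le> 0" by simp
    have "AE x in lebesgue_on \<Omega>. h x = 0"
      using AE_H hpos
    proof eventually_elim
      case (elim x)
      from order_trans[OF elim(1) \<open>ess_sup_on \<Omega> h \<le> 0\<close>] have "h x \<le> 0" by simp
      with elim(2) show ?case by simp
    qed
    then show False using \<open>\<not> (AE x in lebesgue_on \<Omega>. h x = 0)\<close> by simp
  qed
  have "ess_sup_on \<Omega> h \<le> ess_sup_on \<Omega> (\<lambda>x. \<bar>h x\<bar>)"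
    unfolding ess_sup_on_def using hm by (intro esssup_mono) auto
  then have ess_fin: "ess_sup_on \<Omega> h < \<infinity>" using hfin by (rule le_less_trans)
  have ess: "ess_sup_on \<Omega> h = ereal H"
    using ess_pos ess_fin unfolding H_def by (cases "ess_sup_on \<Omega> h") auto
  have H_pos: "0 < H" using ess_pos ess by simp
  have h_le: "AE x in lebesgue_on \<Omega>. \<bar>h x\<bar> \<le> H"
    using AE_H hpos by eventually_elim (simp add: ess)
  interpret subcritical_problem K \<Omega> s \<beta> h f H C \<gamma>
  proof
    show "2 * s < real DIM(real ^ 'n)" "\<gamma> < crit_exp DIM(real ^ 'n) s"
      using \<open>2 * s < real CARD('n)\<close> \<gamma>(2) by simp_all
    show "\<beta> * norm x powr - (real DIM(real ^ 'n) + 2 * s) \<le> K x" if "x \<noteq> 0" for x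
      using \<beta>(2)[OF that] by simp
    show "0 < K x" if "x \<noteq> 0" for x using K_pos that by blast
    show "integrable lebesgue (\<lambda>x. min ((norm x)\<^sup>2) 1 * K x)" by (rule k1)
    show "0 \<le> H" using H_pos by simp
  qed (fact \<open>0 < s\<close> \<open>open \<Omega>\<close> \<open>bounded \<Omega>\<close> \<beta>(1) hm h_le fc growth \<gamma>(1))+
  interpret fm: finite_measure "lebesgue_on \<Omega>" by (rule finite_measure_\<Omega>)
  have q_crit: "q < crit_exp DIM(real ^ 'n) s" using \<open>q < crit_exp CARD('n) s\<close> by simp
  define n1 where "n1 = L1_norm_on \<Omega> h"
  have h_int: "integrable (lebesgue_on \<Omega>) h"
    using h_le hm by (intro fm.integrable_const_bound[of _ H]) auto
  have n1_eq: "n1 = (\<integral>x. h x \<partial>lebesgue_on \<Omega>)"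
    unfolding n1_def L1_norm_on_def
  proof (rule integral_cong_AE)
    show "AE x in lebesgue_on \<Omega>. \<bar>h x\<bar> = h x" using hpos by eventually_elim simp
  qed (use hm in auto)
  have n1: "0 < n1"
  proof -
    have "n1 \<noteq> 0"
      using integral_nonneg_eq_0_iff_AE[OF h_int hpos] \<open>\<not> (AE x in lebesgue_on \<Omega>. h x = 0)\<close> by (simp add: n1_eq)
    moreover have "0 \<le> n1" by (simp add: n1_def L1_norm_on_def)
    ultimately show ?thesis by simp
  qed
  have ne: "\<Omega> \<noteq> {}"
  proof
    assume "\<Omega> = {}"
    then have "AE x in lebesgue_on \<Omega>. h x = 0"
      by (intro AE_I2) simp
    then show False using \<open>\<not> (AE x in lebesgue_on \<Omega>. h x = 0)\<close> by simp
  qed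
  define c where "c = emb_const K \<Omega> q"
  have c: "0 < c" unfolding c_def by (rule emb_const_pos[OF ne q q_crit])
  define g where "g = growth_const q \<psi>"
  have g: "0 < g" "\<And>t. \<psi> t \<le> g * \<bar>t\<bar> powr q"
    unfolding g_def using F_class_growth[OF \<open>\<psi> \<in> F_class q\<close> q] by auto
  define \<rho> where "\<rho> = r * n1 / (c * g * H)"
  have \<rho>: "0 < \<rho>" using \<open>0 < r\<close> n1 c g H_pos by (simp add: \<rho>_def)
  have lsc: "lower_semicont \<psi>" using \<open>\<psi> \<in> F_class q\<close> by (simp add: F_class_def)
  obtain l \<xi> where l: "a < l" "\<psi> \<xi> = r" "\<xi> \<in> min_points (g_fun F \<psi> l)"
    using ex_multiplier[OF primitive_continuous[OF fc] lsc \<open>0 \<le> a\<close> \<open>ereal a < b\<close> assms(20)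
      \<open>alpha (primitive f) \<psi> b < ereal r\<close> \<open>ereal r < beta (primitive f) \<psi> (ereal a)\<close>] by blast
  have l0: "0 < l" using l(1) \<open>0 \<le> a\<close> by simp
  \<comment> \<open>the multiplier turns the constraint on \<open>\<psi>\<close> into a pointwise majorant of \<open>F\<close>\<close>
  have F_le: "F t \<le> F \<xi> - l * r + l * g * \<bar>t\<bar> powr q" for t
  proof -
    have "l * r - F \<xi> \<le> l * \<psi> t - F t" using l(2,3) by (auto simp: min_points_def g_fun_def)
    moreover have "l * \<psi> t \<le> l * (g * \<bar>t\<bar> powr q)" using g(2) l0 by (intro mult_left_mono) auto
    ultimately show ?thesis by (simp add: algebra_simps)
  qed
  have N_le: "N v \<le> F \<xi> * n1" if v: "v \<in> X0" and le: "(nrm v)\<^sup>2 \<le> \<rho> powr (2 / q)" for v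
  proof -
    have int: "integrable (lebesgue_on \<Omega>) (\<lambda>x. \<bar>v x\<bar> powr q)"
      by (rule sobolev[OF q q_crit]) (use v in auto)
    have ennr: "ennreal (\<integral>x. \<bar>v x\<bar> powr q \<partial>lebesgue_on \<Omega>) \<le> ennreal (c * nrm v powr q)"
      using emb_const_bound[OF q q_crit v] nn_integral_eq_integral[OF int] by (simp add: c_def)
    have Iq: "(\<integral>x. \<bar>v x\<bar> powr q \<partial>lebesgue_on \<Omega>) \<le> c * \<rho>"
    proof -
      have "nrm v powr q = ((nrm v)\<^sup>2) powr (q / 2)"
      proof (cases "nrm v = 0")
        case False
        then have "0 < nrm v" using nrm_nonneg[of v] by simp
        then have "(nrm v)\<^sup>2 = nrm v powr 2" by simp
        then show ?thesis by (simp only: powr_powr) simp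
      qed simp
      also have "\<dots> \<le> (\<rho> powr (2 / q)) powr (q / 2)" using le q by (intro powr_mono2) auto
      also have "\<dots> = \<rho>" using \<rho> q by (simp add: powr_powr)
      finally have "c * nrm v powr q \<le> c * \<rho>" using c by (intro mult_left_mono) auto
      moreover have "(\<integral>x. \<bar>v x\<bar> powr q \<partial>lebesgue_on \<Omega>) \<le> c * nrm v powr q" using ennr c by simp
      ultimately show ?thesis by linarith
    qed
    have "N v \<le> (\<integral>x. (F \<xi> - l * r) * h x + (l * g * H) * \<bar>v x\<bar> powr q \<partial>lebesgue_on \<Omega>)"
      unfolding N_def
    proof (rule integral_mono_AE)
      show "AE x in lebesgue_on \<Omega>. h x * F (v x) \<le> (F \<xi> - l * r) * h x + (l * g * H) * \<bar>v x\<bar> powr q"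
        using hpos h_le
      proof eventually_elim
        case (elim x)
        have "h x * F (v x) \<le> h x * (F \<xi> - l * r + l * g * \<bar>v x\<bar> powr q)"
          using F_le elim by (intro mult_left_mono) auto
        also have "\<dots> = (F \<xi> - l * r) * h x + h x * (l * g * \<bar>v x\<bar> powr q)" by (simp add: algebra_simps)
        also have "\<dots> \<le> (F \<xi> - l * r) * h x + H * (l * g * \<bar>v x\<bar> powr q)"
          using elim l0 g by (intro add_left_mono mult_right_mono) auto
        finally show ?case by (simp add: mult_ac)
      qed
    qed (use N_integrable[OF v] h_int int in auto)
    also have "\<dots> = (F \<xi> - l * r) * n1 + (l * g * H) * (\<integral>x. \<bar>v x\<bar> powr q \<partial>lebesgue_on \<Omega>)"
      using h_int int by (simp add: n1_eq)
    also have "\<dots> \<le> (F \<xi> - l * r) * n1 + (l * g * H) * (c * \<rho>)"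
      using Iq l0 g H_pos by (intro add_left_mono mult_left_mono) auto
    \<comment> \<open>the radius was chosen such that the terms carrying the multiplier cancel\<close>
    also have "(l * g * H) * (c * \<rho>) = l * r * n1" using c g H_pos by (simp add: \<rho>_def)
    finally show ?thesis by (simp add: algebra_simps)
  qed
  have small: "F \<xi> * n1 < \<rho> powr (2 / q) / 2"
  proof -
    define A where "A = c * g * H"
    have A: "0 < A" using c g H_pos by (simp add: A_def)
    have "ereal (F \<xi>) \<le> (SUP \<xi> \<in> \<psi> -` {r}. ereal (F \<xi>))"
      using l(2) by (intro SUP_upper) simp
    also have "\<dots> < ereal (r powr (2 / q) / (2 * A powr (2 / q) * n1 powr ((q - 2) / q)))"
      using assms(24) by (simp add: A_def c_def g_def H_def n1_def)
    finally have "F \<xi> < r powr (2 / q) / (2 * A powr (2 / q) * n1 powr ((q - 2) / q))" by simp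
    then have "F \<xi> * n1 < r powr (2 / q) / (2 * A powr (2 / q) * n1 powr ((q - 2) / q)) * n1"
      using n1 by (rule mult_strict_right_mono)
    also have "\<dots> = r powr (2 / q) / (2 * A powr (2 / q)) * (n1 / n1 powr ((q - 2) / q))"
      by simp
    also have "n1 / n1 powr ((q - 2) / q) = n1 powr (2 / q)"
    proof -
      have "n1 / n1 powr ((q - 2) / q) = n1 powr (1 - (q - 2) / q)" using n1 by (simp add: powr_diff)
      also have "1 - (q - 2) / q = 2 / q" using q by (simp add: field_simps)
      finally show ?thesis .
    qed
    also have "r powr (2 / q) / (2 * A powr (2 / q)) * n1 powr (2 / q) = \<rho> powr (2 / q) / 2"
      using A n1 \<open>0 < r\<close> by (simp add: \<rho>_def A_def[symmetric] powr_divide powr_mult)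
    finally show ?thesis .
  qed
  have "0 < \<rho> powr (2 / q)" using \<rho> by simp
  then obtain u where u: "X0_local_min K \<Omega> J u" "(nrm u)\<^sup>2 < \<rho> powr (2 / q)"
    using interior_minimizer[OF N_le small] by blast
  have "(\<integral>(x, y). \<bar>u x - u y\<bar>\<^sup>2 * K (x - y) \<partial>MQ) < \<rho> powr (2 / q)"
    using u(2) by (simp only: energy_eq nrm_sq)
  then show ?thesis
    using local_min_weak_solution[OF u(1)] u(1)
    unfolding \<rho>_def c_def g_def H_def n1_def by blast
qed

end
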